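(* Let $D,F,M$ be positive integers, and consider simulating $F$ fermions in $M$ modes, under a fermion-number-conserving electronic structure Hamiltonian, in the degree-$D$ code (defined in the context). Then we can implement (a) an encoded hop gate $h(\varphi)$ (defined in the context), which is universal for real-valued wavefunctions with fixed fermion number, or (b) the encoding of a rotation $e^{i\theta T}$ generated by any term $T$ in the Hamiltonian, using one ancilla qubit and a number of doubly-controlled (three-qubit) gates given by $$O(D^2F^2\log^3M),$$ which in the $M\gg F$ limit (where $D$ is chosen to minimize the number of qubits and satisfies $D=O(\log M)$) becomes $O(F^2\log^5M)$.
   Context: Hamiltonian: $H=\sum_{ij}h_{ij}a_i^\dagger a_j+\sum_{ijkl}h_{ijkl}a_i^\dagger a_j^\dagger a_ka_l$, where $a_i^\dagger,a_i$ are the fermionic creation and annihilation operators of $M$ modes. It is rewritten as a linear combination of products of at most four Majorana operators $a_i^\dagger+a_i$ and $i(a_i^\dagger-a_i)$; a "term" $T$ is one such product (up to phase), and is both unitary and Hermitian. Hop gate: for real $\varphi$, the gate acting on two fermionic modes, in the occupation number basis ordered $00,01,10,11$, as $$h(\varphi)=\begin{pmatrix}1&0&0&0\\0&\cos\varphi&-\sin\varphi&0\\0&\sin\varphi&\cos\varphi&0\\0&0&0&-1\end{pmatrix}.$$ Bravyi-Kitaev (BK) mapping: an occupation number state is represented by a bitstring $b$ of $M$ bits (the BK bits), each the parity of a subset of the mode occupations; the map is linear over $\mathbb{F}_2$ and invertible, and a state of at most $f$ fermions has a BK bitstring of Hamming weight at most $f\lceil\log_2(M+1)\rceil$. Each Majorana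 operator becomes a Pauli operator acting nontrivially on $O(\log M)$ BK bits, hence, up to a phase, a product of $O(\log M)$ single-bit Pauli operators $X_i^{(BK)}$, $Z_i^{(BK)}$. Degree-$D$ code $\mathcal{E}$ (built so as to encode correctly all states of up to $F+4$ fermions): $G=(F+4)\lceil\log_2(M+1)\rceil$, $L=2DG+1$, and $L'$ is the least prime with $L'\ge L$ and $(L')^{D+1}\ge M$. There are $Q=L'L$ qubits in $L$ blocks of $L'$. To each BK bit $i$ is assigned a polynomial function $y_i$ of degree at most $D$ over $\mathbb{Z}_{L'}$, distinct for distinct $i$; the $i$-th elementary codeword has in each block $x\in\{0,\dots,L-1\}$ a single $1$, at position $y_i(x)$, and $S_i$ is the set of its $L$ qubits equal to $1$. A BK bitstring of Hamming weight at most $G$ is encoded as the bitwise sum (mod 2) of the elementary codewords of its $1$s, extended linearly to superpositions. Encoded operators: $\mathcal{E}(X_i^{(BK)})=\prod_{j\in S_i}X_j$, and $\mathcal{E}(Z_i^{(BK)})$ multiplies a computational basis state by $-1$ if more than half of the qubits in $S_i$ are $1$ and by $+1$ otherwise. Arbitrary qubit connectivity is assumed. *)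

theory Defs
  imports
    "HOL-Analysis.Analysis"
    "HOL-Library.Landau_Symbols"
    "HOL-Computational_Algebra.Primes"
begin

text \<open>
  A basis state of a register (fermionic modes, Bravyi-Kitaev bits or qubits, always numbered from
  0) is the set of positions holding a 1, and a state is its amplitude function. In particular a
  state of the qubits \<open>{..<Q}\<close> is, literally, also the state of the qubits \<open>{..Q}\<close> in which qubit
  \<open>Q\<close> is in the state 0.
\<close>

type_synonym ket = "nat set \<Rightarrow> complex"
type_synonym operator = "ket \<Rightarrow> ket"

definition kets :: "nat \<Rightarrow> ket set" where
  "kets m = {\<psi>. \<forall>s. \<psi> s \<noteq> 0 \<longrightarrow> s \<subseteq> {..<m}}"

definition set_bit_to :: "nat \<Rightarrow> bool \<Rightarrow> nat set \<Rightarrow> nat set" where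
  "set_bit_to t v s = (if v then insert t s else s - {t})"

text \<open>The linear extension of a map \<open>f\<close> from the basis states of an \<open>m\<close>-bit register.\<close>

definition linear_ext :: "nat \<Rightarrow> (nat set \<Rightarrow> nat set) \<Rightarrow> ket \<Rightarrow> ket" where
  "linear_ext m f \<psi> = (\<lambda>s. \<Sum>b | b \<subseteq> {..<m} \<and> f b = s. \<psi> b)"

definition hermitian_on :: "nat \<Rightarrow> operator \<Rightarrow> bool" where
  "hermitian_on m A \<longleftrightarrow> (\<forall>\<psi>\<in>kets m. \<forall>\<xi>\<in>kets m.
     (\<Sum>s\<in>Pow {..<m}. cnj (\<psi> s) * A \<xi> s) = (\<Sum>s\<in>Pow {..<m}. cnj (A \<psi> s) * \<xi> s))"

definition op_exp :: "operator \<Rightarrow> operator" where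
  "op_exp A \<psi> = (\<lambda>s. \<Sum>k. (A ^^ k) \<psi> s / fact k)"


subsection \<open>Fermions\<close>

definition fermions_upto :: "nat \<Rightarrow> nat \<Rightarrow> ket set" where
  "fermions_upto M f = {\<psi>\<in>kets M. \<forall>n. \<psi> n \<noteq> 0 \<longrightarrow> card n \<le> f}"

definition annihilate :: "nat \<Rightarrow> operator" where
  "annihilate j \<psi> = (\<lambda>n. if j \<in> n then 0 else (-1) ^ card {k\<in>n. k < j} * \<psi> (insert j n))"

definition create :: "nat \<Rightarrow> operator" where
  "create j \<psi> = (\<lambda>n. if j \<in> n then (-1) ^ card {k\<in>n. k < j} * \<psi> (n - {j}) else 0)"

definition majorana :: "nat \<Rightarrow> bool \<Rightarrow> operator" where
  "majorana j v \<psi> = (\<lambda>n. if v then \<i> * (create j \<psi> n - annihilate j \<psi> n)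
                          else create j \<psi> n + annihilate j \<psi> n)"

text \<open>Every summand preserves the number of fermions.\<close>

definition electronic_hamiltonian ::
  "nat \<Rightarrow> (nat \<Rightarrow> nat \<Rightarrow> complex) \<Rightarrow> (nat \<Rightarrow> nat \<Rightarrow> nat \<Rightarrow> nat \<Rightarrow> complex) \<Rightarrow> operator" where
  "electronic_hamiltonian M h1 h2 \<psi> = (\<lambda>n.
     (\<Sum>i<M. \<Sum>j<M. h1 i j * create i (annihilate j \<psi>) n) +
     (\<Sum>i<M. \<Sum>j<M. \<Sum>k<M. \<Sum>l<M.
        h2 i j k l * create i (create j (annihilate k (annihilate l \<psi>))) n))"

text \<open>
  Writing \<open>\<gamma> = majorana j False\<close> and \<open>\<gamma>' = majorana j True\<close>, the ladder operators of mode \<open>j\<close> are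
  \<open>(\<gamma> + \<i> \<gamma>') / 2\<close> (annihilation) and \<open>(\<gamma> - \<i> \<gamma>') / 2\<close> (creation). So a nonzero coefficient
  contributes every Majorana product on its modes; the phase makes the product Hermitian.
\<close>

definition hamiltonian_term ::
  "nat \<Rightarrow> (nat \<Rightarrow> nat \<Rightarrow> complex) \<Rightarrow> (nat \<Rightarrow> nat \<Rightarrow> nat \<Rightarrow> nat \<Rightarrow> complex) \<Rightarrow> operator \<Rightarrow> bool" where
  "hamiltonian_term M h1 h2 T \<longleftrightarrow> hermitian_on M T \<and> (\<exists>c. norm c = 1 \<and>
     ((\<exists>i<M. \<exists>j<M. \<exists>u v. h1 i j \<noteq> 0 \<and>
         T = (\<lambda>\<psi> n. c * majorana i u (majorana j v \<psi>) n)) \<or>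
      (\<exists>i<M. \<exists>j<M. \<exists>k<M. \<exists>l<M. \<exists>u v w z. h2 i j k l \<noteq> 0 \<and>
         T = (\<lambda>\<psi> n. c * majorana i u (majorana j v (majorana k w (majorana l z \<psi>))) n))))"

definition rotation :: "real \<Rightarrow> operator \<Rightarrow> operator" where
  "rotation \<theta> T = op_exp (\<lambda>\<psi> n. \<i> * \<theta> * T \<psi> n)"

definition hop_matrix :: "real \<Rightarrow> complex ^ (bool \<times> bool) ^ (bool \<times> bool)" where
  "hop_matrix \<phi> = (\<chi> r c.
     if r = (False, False) \<and> c = (False, False) then 1
     else if r = (False, True) \<and> c = (False, True) then of_real (cos \<phi>)
     else if r = (False, True) \<and> c = (True, False) then - of_real (sin \<phi>)
     else if r = (True, False) \<and> c = (False, True) then of_real (sin \<phi>)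
     else if r = (True, False) \<and> c = (True, False) then of_real (cos \<phi>)
     else if r = (True, True) \<and> c = (True, True) then - 1
     else 0)"

text \<open>
  The hop gate on the modes \<open>p, q\<close> (the first and the second bit of the matrix indices). For
  \<open>ferm = True\<close> it is the fermionic operator, an even element of the algebra generated by the ladder
  operators of \<open>p\<close> and \<open>q\<close>: its off-diagonal entries belong to \<open>create p \<circ> annihilate q\<close> and its
  adjoint, which pick up the sign of the fermions on the modes strictly between \<open>p\<close> and \<open>q\<close>.
  For \<open>ferm = False\<close> the matrix acts on the two occupation numbers without that sign.
  The two agree when \<open>p\<close> and \<open>q\<close> are neighbours.
\<close>

definition exchange_sign :: "nat \<Rightarrow> nat \<Rightarrow> nat set \<Rightarrow> complex" where
  "exchange_sign p q n = (-1) ^ card {k\<in>n. min p q < k \<and> k < max p q}"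

definition hop_gate :: "bool \<Rightarrow> real \<Rightarrow> nat \<Rightarrow> nat \<Rightarrow> operator" where
  "hop_gate ferm \<phi> p q \<psi> = (\<lambda>n. \<Sum>x\<in>UNIV.
     hop_matrix \<phi> $ (p \<in> n, q \<in> n) $ x *
     (if ferm \<and> x \<noteq> (p \<in> n, q \<in> n) then exchange_sign p q n else 1) *
     \<psi> (set_bit_to p (fst x) (set_bit_to q (snd x) n)))"

definition real_wavefunction :: "nat \<Rightarrow> nat \<Rightarrow> ket \<Rightarrow> bool" where
  "real_wavefunction M f \<psi> \<longleftrightarrow> \<psi> \<in> kets M \<and> (\<forall>n. \<psi> n \<noteq> 0 \<longrightarrow> card n = f) \<and>
     (\<forall>n. \<psi> n \<in> \<real>) \<and> (\<Sum>n\<in>Pow {..<M}. (norm (\<psi> n))\<^sup>2) = 1"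

text \<open>
  Any wavefunction of this kind is carried to any other, up to the unobservable global sign. (The
  sign is needed only when the fixed-number space is one-dimensional.)
\<close>

definition hop_universal :: "bool \<Rightarrow> nat \<Rightarrow> nat \<Rightarrow> bool" where
  "hop_universal ferm M f \<longleftrightarrow>
     (\<forall>\<psi> \<xi>. real_wavefunction M f \<psi> \<and> real_wavefunction M f \<xi> \<longrightarrow>
       (\<exists>hs. (\<forall>(\<phi>, p, q)\<in>set hs. p < M \<and> q < M \<and> p \<noteq> q) \<and>
         fold (\<lambda>(\<phi>, p, q). hop_gate ferm \<phi> p q) hs \<psi> \<in> {\<xi>, \<lambda>n. - \<xi> n}))"


subsection \<open>The Bravyi-Kitaev mapping\<close>

text \<open>
  The standard Fenwick tree: bit \<open>j\<close> is the parity of the \<open>2\<^sup>t\<close> modes ending with \<open>j\<close>, where \<open>2\<^sup>t\<close> is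
  the largest power of two dividing \<open>j + 1\<close>.
\<close>

definition bk_modes :: "nat \<Rightarrow> nat set" where
  "bk_modes j = {j + 1 - 2 ^ multiplicity 2 (j + 1)..j}"

definition bk :: "nat \<Rightarrow> nat set \<Rightarrow> nat set" where
  "bk M n = {j. j < M \<and> odd (card (n \<inter> bk_modes j))}"

text \<open>Products of Pauli operators over a set of bits.\<close>

definition pauli_X :: "nat set \<Rightarrow> operator" where
  "pauli_X A \<psi> = (\<lambda>s. \<psi> (sym_diff s A))"

definition pauli_Z :: "nat set \<Rightarrow> operator" where
  "pauli_Z B \<psi> = (\<lambda>s. (-1) ^ card (s \<inter> B) * \<psi> s)"

definition pauli_comb :: "nat \<Rightarrow> (nat set \<Rightarrow> nat set \<Rightarrow> complex) \<Rightarrow> operator" where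
  "pauli_comb M c \<psi> = (\<lambda>s. \<Sum>A\<in>Pow {..<M}. \<Sum>B\<in>Pow {..<M}.
     c A B * pauli_X A (pauli_Z B \<psi>) s)"


subsection \<open>The code\<close>

definition code_G :: "nat \<Rightarrow> nat \<Rightarrow> nat" where
  "code_G F M = (F + 4) * nat \<lceil>log 2 (real M + 1)\<rceil>"

definition code_L :: "nat \<Rightarrow> nat \<Rightarrow> nat \<Rightarrow> nat" where
  "code_L D F M = 2 * D * code_G F M + 1"

definition code_L' :: "nat \<Rightarrow> nat \<Rightarrow> nat \<Rightarrow> nat" where
  "code_L' D F M = (LEAST p. prime p \<and> code_L D F M \<le> p \<and> M \<le> p ^ (D + 1))"

definition num_qubits :: "nat \<Rightarrow> nat \<Rightarrow> nat \<Rightarrow> nat" where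
  "num_qubits D F M = code_L' D F M * code_L D F M"

text \<open>Residues modulo \<open>L'\<close> are represented by the numbers below \<open>L'\<close>.\<close>

definition code_polynomials :: "nat \<Rightarrow> nat \<Rightarrow> nat \<Rightarrow> (nat \<Rightarrow> nat \<Rightarrow> nat) \<Rightarrow> bool" where
  "code_polynomials D F M y \<longleftrightarrow>
     (\<forall>i<M. \<exists>a :: nat \<Rightarrow> nat. \<forall>x<code_L' D F M.
        y i x = (\<Sum>k\<le>D. a k * x ^ k) mod code_L' D F M) \<and>
     (\<forall>i<M. \<forall>j<M. i \<noteq> j \<longrightarrow> (\<exists>x<code_L' D F M. y i x \<noteq> y j x))"

text \<open>Position \<open>r\<close> of block \<open>x\<close> is the qubit \<open>x * L' + r\<close>.\<close>

definition codeword_support :: "nat \<Rightarrow> nat \<Rightarrow> nat \<Rightarrow> (nat \<Rightarrow> nat \<Rightarrow> nat) \<Rightarrow> nat \<Rightarrow> nat set" where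
  "codeword_support D F M y i = (\<lambda>x. x * code_L' D F M + y i x) ` {..<code_L D F M}"

definition codeword ::
  "nat \<Rightarrow> nat \<Rightarrow> nat \<Rightarrow> (nat \<Rightarrow> nat \<Rightarrow> nat) \<Rightarrow> nat set \<Rightarrow> nat set" where
  "codeword D F M y b =
     {r. r < num_qubits D F M \<and> odd (card {i\<in>b. r \<in> codeword_support D F M y i})}"

definition encode_state :: "nat \<Rightarrow> nat \<Rightarrow> nat \<Rightarrow> (nat \<Rightarrow> nat \<Rightarrow> nat) \<Rightarrow> ket \<Rightarrow> ket" where
  "encode_state D F M y \<psi> = linear_ext M (codeword D F M y) (linear_ext M (bk M) \<psi>)"

definition encoded_X :: "nat \<Rightarrow> nat \<Rightarrow> nat \<Rightarrow> (nat \<Rightarrow> nat \<Rightarrow> nat) \<Rightarrow> nat \<Rightarrow> operator" where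
  "encoded_X D F M y i = pauli_X (codeword_support D F M y i)"

definition encoded_Z :: "nat \<Rightarrow> nat \<Rightarrow> nat \<Rightarrow> (nat \<Rightarrow> nat \<Rightarrow> nat) \<Rightarrow> nat \<Rightarrow> operator" where
  "encoded_Z D F M y i \<psi> = (\<lambda>s.
     (if card (codeword_support D F M y i) < 2 * card (s \<inter> codeword_support D F M y i)
      then -1 else 1) * \<psi> s)"

definition encoded_pauli_comb ::
  "nat \<Rightarrow> nat \<Rightarrow> nat \<Rightarrow> (nat \<Rightarrow> nat \<Rightarrow> nat) \<Rightarrow> (nat set \<Rightarrow> nat set \<Rightarrow> complex) \<Rightarrow> operator" where
  "encoded_pauli_comb D F M y c \<psi> = (\<lambda>s. \<Sum>A\<in>Pow {..<M}. \<Sum>B\<in>Pow {..<M}.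
     c A B * fold (encoded_X D F M y) (sorted_list_of_set A)
               (fold (encoded_Z D F M y) (sorted_list_of_set B) \<psi>) s)"

text \<open>
  \<open>Op'\<close> encodes the fermionic operator \<open>Op\<close>: write \<open>Op\<close> on the Bravyi-Kitaev bits as a combination of
  Pauli products (the coefficients are unique), and encode each factor.
\<close>

definition encodes_operator ::
  "nat \<Rightarrow> nat \<Rightarrow> nat \<Rightarrow> (nat \<Rightarrow> nat \<Rightarrow> nat) \<Rightarrow> operator \<Rightarrow> operator \<Rightarrow> bool" where
  "encodes_operator D F M y Op Op' \<longleftrightarrow> (\<exists>c.
     (\<forall>\<psi>\<in>kets M. linear_ext M (bk M) (Op \<psi>) = pauli_comb M c (linear_ext M (bk M) \<psi>)) \<and>
     Op' = encoded_pauli_comb D F M y c)"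


subsection \<open>Circuits of doubly-controlled gates\<close>

definition unitary2 :: "complex ^ bool ^ bool \<Rightarrow> bool" where
  "unitary2 U \<longleftrightarrow> (\<chi> i j. cnj (U $ j $ i)) ** U = mat 1"

text \<open>
  \<open>CC (a, u) (b, v) t U\<close> applies the single-qubit unitary \<open>U\<close> to qubit \<open>t\<close> if the control qubits \<open>a\<close>
  and \<open>b\<close> have the values \<open>u\<close> and \<open>v\<close>. Controls on 0 are necessary: otherwise a vacuum state, with
  all qubits 0, would be fixed by every circuit. A gate with fewer controls is a product of two or
  four such gates.
\<close>

datatype cc_gate = CC "nat \<times> bool" "nat \<times> bool" nat "complex ^ bool ^ bool"

fun cc_valid :: "nat \<Rightarrow> cc_gate \<Rightarrow> bool" where
  "cc_valid m (CC (a, u) (b, v) t U) \<longleftrightarrow>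
     a < m \<and> b < m \<and> t < m \<and> a \<noteq> b \<and> a \<noteq> t \<and> b \<noteq> t \<and> unitary2 U"

fun cc_apply :: "cc_gate \<Rightarrow> operator" where
  "cc_apply (CC (a, u) (b, v) t U) \<psi> = (\<lambda>s.
     if (a \<in> s) = u \<and> (b \<in> s) = v
     then \<Sum>k\<in>UNIV. U $ (t \<in> s) $ k * \<psi> (set_bit_to t k s) else \<psi> s)"

text \<open>
  The encoding of \<open>Op\<close> is implemented by at most \<open>m\<close> doubly-controlled gates on the code qubits and
  one ancilla (qubit number \<open>num_qubits D F M\<close>), which starts and ends in the state 0. The code
  states concerned are those of up to \<open>F + 4\<close> fermions on which \<open>Op\<close> does not exceed \<open>F + 4\<close>
  fermions; they include the states of \<open>F\<close> fermions for all operators considered, and those reached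
  within a product of rotations on the same four modes.
\<close>

definition implementable ::
  "nat \<Rightarrow> nat \<Rightarrow> nat \<Rightarrow> (nat \<Rightarrow> nat \<Rightarrow> nat) \<Rightarrow> operator \<Rightarrow> nat \<Rightarrow> bool" where
  "implementable D F M y Op m \<longleftrightarrow> (\<exists>Op' gs.
     encodes_operator D F M y Op Op' \<and>
     length gs \<le> m \<and> (\<forall>g\<in>set gs. cc_valid (num_qubits D F M + 1) g) \<and>
     (\<forall>\<psi>\<in>fermions_upto M (F + 4). Op \<psi> \<in> fermions_upto M (F + 4) \<longrightarrow>
        fold cc_apply gs (encode_state D F M y \<psi>) = Op' (encode_state D F M y \<psi>) \<and>
        Op' (encode_state D F M y \<psi>) = encode_state D F M y (Op \<psi>)))"

text \<open>The limit \<open>M / F \<rightarrow> \<infinity>\<close>, for pairs \<open>(F, M)\<close>.\<close>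

definition many_modes :: "(nat \<times> nat) filter" where
  "many_modes = inf (filtercomap (\<lambda>(F, M). real M / real F) at_top) (principal {(F, M). F \<ge> 1})"

end

theory Submission
  imports Defs
begin

text \<open>
  Universality: the hop gate is a pair rotation times a controlled sign. Conjugation by controlled
  signs makes the rotations conditional on all other modes, and Givens rotations with these carry
  every real wavefunction to a basis state.

  Gates: by degree, two elementary codewords share at most \<open>D\<close> qubits, so on a code state the bit
  \<open>i\<close> is the majority of the \<open>L\<close> qubits of \<open>S\<^sub>i\<close>. One ancilla and \<open>L + 1\<close> borrowed code qubits suffice
  to compute a majority with \<open>O(L\<^sup>2)\<close> gates: shift the borrowed qubits cyclically by the weight on
  \<open>S\<^sub>i\<close>. Every sign that occurs is the parity of the modes in a combination of at most four
  prefixes, hence of \<open>O(log M)\<close> Bravyi-Kitaev bits, and is written to the ancilla with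
  \<open>O(L\<^sup>2 log M)\<close> gates. Both a hop gate and a rotation mix \<open>n\<close> only with \<open>n\<close> flipped on a fixed set of
  at most four modes, which encodes to a fixed set \<open>S\<close> of qubits. Conjugating by a fan-out from a
  pivot in \<open>S\<close> turns this into a one-qubit gate on the pivot, with signs on either side. It has to be
  one such block: a product of two Majorana rotations for the hop gate would leave the states of
  \<open>F + 4\<close> fermions, on which the code is correct.

  Degree: for \<open>D \<ge> log\<^sub>2 M\<close> the number of qubits increases with \<open>D\<close>, so the optimal degree is at most
  \<open>\<lceil>log\<^sub>2 (M + 1)\<rceil>\<close>.
\<close>

subsection \<open>Universality of the hop gates\<close>

text \<open>Two constraints shape the circuits: the code decodes correctly only up to
  \<open>F + 4\<close> fermions, and there is a single ancilla. With one ancilla there is no room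
  for a counter, so a weight is held as an offset among qubits whose unknown contents must cancel. A
  majority costs O(L^2) because each of its \<open>L\<close> qubits controls a shift over
  \<open>L + 1\<close> positions; with L = O(D F log M) and O(log M) majorities per sign this gives
  D^2 F^2 log^3 M. A sign is reliable only on basis states in range, so a mixing gate must pair
  states that are both in range. For a hop gate the partner has the same number of fermions. For a
  rotation it may have more, but the condition that the result stays in range then forces the
  amplitude sent there to vanish. Circuits are checked on encoded basis states and extended by
  linearity. Agreement with the encoded operator is separate and rests on an expansion into Pauli
  products: in each product the encoded \<open>Z\<close> factors act before the encoded
  \<open>X\<close> factors, hence on code states, where majorities are right.\<close>

abbreviation apply_hops :: "bool \<Rightarrow> (real \<times> nat \<times> nat) list \<Rightarrow> operator" where
  "apply_hops ferm hs \<equiv> fold (\<lambda>(\<phi>, p, q). hop_gate ferm \<phi> p q) hs"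

definition hop_ops :: "bool \<Rightarrow> nat \<Rightarrow> operator set" where
  "hop_ops ferm M = {apply_hops ferm hs | hs. \<forall>(\<phi>, p, q)\<in>set hs. p < M \<and> q < M \<and> p \<noteq> q}"

text \<open>Lets one argument cover the fermionic gate and the bare matrix. What matters is that
  this is a sign and that it does not change when \<open>p\<close> and \<open>q\<close> are
  flipped.\<close>

definition hop_sign :: "bool \<Rightarrow> nat \<Rightarrow> nat \<Rightarrow> nat set \<Rightarrow> complex" where
  "hop_sign ferm p q n = (if ferm then exchange_sign p q n else 1)"

lemma hop_sign_cases: "hop_sign ferm p q n = 1 \<or> hop_sign ferm p q n = -1"
  unfolding hop_sign_def exchange_sign_def by (auto simp: minus_one_power_iff)

lemma hop_sign_square [simp]: "hop_sign ferm p q n * hop_sign ferm p q n = 1"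
  using hop_sign_cases[of ferm p q n] by auto

lemma hop_sign_sym_diff [simp]: "hop_sign ferm p q (sym_diff n {p, q}) = hop_sign ferm p q n"
proof -
  have "{k \<in> sym_diff n {p, q}. min p q < k \<and> k < max p q} = {k \<in> n. min p q < k \<and> k < max p q}"
    by auto
  then show ?thesis
    by (simp add: hop_sign_def exchange_sign_def)
qed

text \<open>The angle depends on the basis state so that conditional rotations have the same form.
  It is a genuine rotation of each plane if \<open>f\<close> agrees on a state and its partner,
  which \<open>pair_rotation_add\<close> asks of the inner angle.\<close>

definition pair_rotation ::
  "bool \<Rightarrow> nat \<Rightarrow> nat \<Rightarrow> (nat set \<Rightarrow> real) \<Rightarrow> operator" where
  "pair_rotation ferm p q f \<psi> = (\<lambda>n.
     if (p \<in> n) \<noteq> (q \<in> n)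
     then of_real (cos (f n)) * \<psi> n
        + (if p \<in> n then 1 else -1) * of_real (sin (f n)) * hop_sign ferm p q n * \<psi> (sym_diff n {p, q})
     else \<psi> n)"

lemma hop_gate_eq:
  assumes "p \<noteq> q"
  shows "hop_gate ferm \<phi> p q \<psi> = (\<lambda>n.
    (if p \<in> n \<and> q \<in> n then -1 else 1) * pair_rotation ferm p q (\<lambda>_. \<phi>) \<psi> n)"
proof
  fix n
  have U: "(UNIV :: (bool \<times> bool) set) = {(False, False), (False, True), (True, False), (True, True)}"
    by auto
  have "sym_diff n {p, q} = set_bit_to p True (set_bit_to q False n)" if "p \<notin> n" "q \<in> n"
    using that assms by (auto simp: set_bit_to_def)
  moreover have "sym_diff n {p, q} = set_bit_to p False (set_bit_to q True n)" if "p \<in> n" "q \<notin> n"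
    using that assms by (auto simp: set_bit_to_def)
  moreover have "set_bit_to p (p \<in> n) (set_bit_to q (q \<in> n) n) = n"
    by (auto simp: set_bit_to_def)
  ultimately show "hop_gate ferm \<phi> p q \<psi> n =
      (if p \<in> n \<and> q \<in> n then -1 else 1) * pair_rotation ferm p q (\<lambda>_. \<phi>) \<psi> n"
    unfolding hop_gate_def U
    by (cases "p \<in> n"; cases "q \<in> n")
       (simp_all add: hop_matrix_def pair_rotation_def hop_sign_def)
qed

lemma pair_rotation_zero [simp]: "pair_rotation ferm p q (\<lambda>_. 0) \<psi> = \<psi>"
  by (auto simp: pair_rotation_def)

lemma hop_gate_zero:
  "p \<noteq> q \<Longrightarrow> hop_gate ferm 0 p q \<psi> = (\<lambda>n. (if p \<in> n \<and> q \<in> n then -1 else 1) * \<psi> n)"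
  by (simp add: hop_gate_eq)

lemma sym_diff_twice: "sym_diff (sym_diff n A) A = (n :: 'a set)"
  by auto

text \<open>The sine terms of the two partners have opposite signs and \<open>hop_sign\<close>
  squares to 1, so this is the addition theorem in each plane. The inner angle is evaluated at
  \<open>n\<close> and at its partner, the outer one only at \<open>n\<close>; hence the condition
  on \<open>g\<close>.\<close>

lemma pair_rotation_add:
  assumes "p \<noteq> q" and g: "\<And>n. g (sym_diff n {p, q}) = g n"
  shows "pair_rotation ferm p q f (pair_rotation ferm p q g \<psi>) =
         pair_rotation ferm p q (\<lambda>n. f n + g n) \<psi>"
proof
  fix n
  have mem: "p \<in> sym_diff n {p, q} \<longleftrightarrow> p \<notin> n" "q \<in> sym_diff n {p, q} \<longleftrightarrow> q \<notin> n"
    by auto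
  show "pair_rotation ferm p q f (pair_rotation ferm p q g \<psi>) n =
         pair_rotation ferm p q (\<lambda>n. f n + g n) \<psi> n"
    unfolding pair_rotation_def mem sym_diff_twice hop_sign_sym_diff g
    by (auto simp: cos_add sin_add algebra_simps)
qed

text \<open>The sign on doubly occupied states lives on a block that the rotation leaves alone, so
  it commutes with the rotation and squares to 1.\<close>

lemma hop_gate_inverse:
  assumes "p \<noteq> q"
  shows "hop_gate ferm (-\<phi>) p q (hop_gate ferm \<phi> p q \<psi>) = \<psi>"
proof -
  let ?s = "\<lambda>n. if p \<in> n \<and> q \<in> n then -1 else (1 :: complex)"
  have "pair_rotation ferm p q (\<lambda>_. -\<phi>) (\<lambda>n. ?s n * pair_rotation ferm p q (\<lambda>_. \<phi>) \<psi> n) =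
        (\<lambda>n. ?s n * pair_rotation ferm p q (\<lambda>_. -\<phi>) (pair_rotation ferm p q (\<lambda>_. \<phi>) \<psi>) n)"
    by (rule ext) (auto simp: pair_rotation_def)
  then show ?thesis
    using assms by (auto simp: hop_gate_eq pair_rotation_add)
qed

section \<open>Products of hop gates\<close>

lemma hop_ops_id: "(\<lambda>\<psi>. \<psi>) \<in> hop_ops ferm M"
  unfolding hop_ops_def by (rule CollectI, rule exI[of _ "[]"]) (simp add: id_def)

lemma hop_gate_in_hop_ops:
  "p < M \<Longrightarrow> q < M \<Longrightarrow> p \<noteq> q \<Longrightarrow> hop_gate ferm \<phi> p q \<in> hop_ops ferm M"
  unfolding hop_ops_def by (rule CollectI, rule exI[of _ "[(\<phi>, p, q)]"]) (simp add: fun_eq_iff)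

lemma hop_ops_comp:
  assumes "A \<in> hop_ops ferm M" "B \<in> hop_ops ferm M"
  shows "(\<lambda>\<psi>. A (B \<psi>)) \<in> hop_ops ferm M"
proof -
  obtain hs ks where "A = apply_hops ferm hs" "\<forall>(\<phi>, p, q)\<in>set hs. p < M \<and> q < M \<and> p \<noteq> q"
    "B = apply_hops ferm ks" "\<forall>(\<phi>, p, q)\<in>set ks. p < M \<and> q < M \<and> p \<noteq> q"
    using assms unfolding hop_ops_def by blast
  then show ?thesis
    unfolding hop_ops_def by (intro CollectI exI[of _ "ks @ hs"]) auto
qed

lemma hop_ops_induct [consumes 1, case_names id hop]:
  assumes "A \<in> hop_ops ferm M"
    and "P (\<lambda>\<psi>. \<psi>)"
    and "\<And>A \<phi> p q. A \<in> hop_ops ferm M \<Longrightarrow> P A \<Longrightarrow> p < M \<Longrightarrow> q < M \<Longrightarrow> p \<noteq> q \<Longrightarrow>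
           P (\<lambda>\<psi>. hop_gate ferm \<phi> p q (A \<psi>))"
  shows "P A"
proof -
  obtain hs where hs: "A = apply_hops ferm hs" "\<forall>(\<phi>, p, q)\<in>set hs. p < M \<and> q < M \<and> p \<noteq> q"
    using assms(1) unfolding hop_ops_def by blast
  from hs(2) have "apply_hops ferm hs \<in> hop_ops ferm M \<and> P (apply_hops ferm hs)"
  proof (induction hs rule: rev_induct)
    case Nil
    then show ?case using assms(2) hop_ops_id by (simp add: id_def)
  next
    case (snoc h hs)
    obtain \<phi> p q where h: "h = (\<phi>, p, q)" by (cases h)
    have pq: "p < M" "q < M" "p \<noteq> q" and IH: "apply_hops ferm hs \<in> hop_ops ferm M"
      "P (apply_hops ferm hs)"
      using snoc h by auto
    have "apply_hops ferm (hs @ [h]) = (\<lambda>\<psi>. hop_gate ferm \<phi> p q (apply_hops ferm hs \<psi>))"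
      by (simp add: h fun_eq_iff)
    then show ?case
      using assms(3)[OF IH pq] hop_ops_comp[OF hop_gate_in_hop_ops[OF pq] IH(1)] by simp
  qed
  then show ?thesis by (simp add: hs)
qed

lemma hop_ops_inverse:
  assumes "A \<in> hop_ops ferm M"
  shows "\<exists>B\<in>hop_ops ferm M. \<forall>\<psi>. B (A \<psi>) = \<psi>"
  using assms
proof (induction rule: hop_ops_induct)
  case id
  show ?case by (rule bexI[OF _ hop_ops_id]) simp
next
  case (hop A \<phi> p q)
  from hop.IH obtain B where B: "B \<in> hop_ops ferm M" "\<And>\<psi>. B (A \<psi>) = \<psi>" by metis
  have "(\<lambda>\<psi>. B (hop_gate ferm (-\<phi>) p q \<psi>)) \<in> hop_ops ferm M"
    by (rule hop_ops_comp[OF B(1) hop_gate_in_hop_ops[OF hop.hyps(2-4)]])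
  moreover have "B (hop_gate ferm (-\<phi>) p q (hop_gate ferm \<phi> p q (A \<psi>))) = \<psi>" for \<psi>
    by (simp add: B(2) hop_gate_inverse[OF hop.hyps(4)])
  ultimately show ?case by (intro bexI[of _ "\<lambda>\<psi>. B (hop_gate ferm (-\<phi>) p q \<psi>)"] allI)
qed

lemma hop_ops_scale:
  assumes "A \<in> hop_ops ferm M"
  shows "A (\<lambda>n. c * \<psi> n) = (\<lambda>n. c * A \<psi> n)"
  using assms
proof (induction rule: hop_ops_induct)
  case (hop A \<phi> p q)
  then show ?case
    by (auto simp: hop_gate_eq pair_rotation_def fun_eq_iff algebra_simps)
qed simp

text \<open>
  \<open>h(0)\<close> on the modes \<open>p, r\<close> is a controlled sign; conjugation by it reverses the rotation angle of
  the pair \<open>p, q\<close> whenever \<open>r\<close> is occupied. Adding or subtracting half angles makes the rotation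
  conditional on the occupation of \<open>r\<close>, and of all other modes in turn.
\<close>

lemma conditional_rotation_in_hop_ops:
  assumes "finite R" "R \<subseteq> {..<M} - {p, q}" "p < M" "q < M" "p \<noteq> q"
  shows "pair_rotation ferm p q (\<lambda>n. if n \<inter> R = c \<inter> R then \<phi> else 0) \<in> hop_ops ferm M"
  using assms
proof (induction R arbitrary: \<phi> rule: finite_induct)
  case empty
  \<comment> \<open>The gate with angle 0 is the bare sign on doubly occupied states; it cancels the
    one that comes with the rotation.\<close>
  have "(\<lambda>\<psi>. hop_gate ferm 0 p q (hop_gate ferm \<phi> p q \<psi>)) = pair_rotation ferm p q (\<lambda>_. \<phi>)"
    using empty by (auto simp: hop_gate_zero hop_gate_eq fun_eq_iff)
  then show ?case
    using hop_ops_comp[OF hop_gate_in_hop_ops hop_gate_in_hop_ops, of p M q p q ferm 0 \<phi>] empty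
    by simp
next
  case (insert r R)
  let ?f = "\<lambda>\<phi> n. if n \<inter> R = c \<inter> R then \<phi> else (0 :: real)"
  let ?z = "hop_gate ferm 0 p r"
  \<comment> \<open>Conjugation by \<open>?z\<close> turns the second angle into
    \<open>?\<beta>\<close> or \<open>- ?\<beta>\<close> according to \<open>r\<close>. With this
    choice of sign the two halves add up to \<phi> if \<open>r\<close> is as in \<open>c\<close>,
    and cancel otherwise.\<close>
  let ?\<beta> = "if r \<in> c then - \<phi> / 2 else \<phi> / 2"
  have r: "r < M" "r \<noteq> p" "r \<noteq> q" using insert by auto
  have A: "pair_rotation ferm p q (?f \<alpha>) \<in> hop_ops ferm M" for \<alpha>
    using insert by blast
  have z: "?z \<in> hop_ops ferm M"
    using hop_gate_in_hop_ops r insert by blast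
  have inv: "sym_diff n {p, q} \<inter> R = n \<inter> R" "r \<in> sym_diff n {p, q} \<longleftrightarrow> r \<in> n" for n
    using insert r by auto
  have conj: "?z (pair_rotation ferm p q (?f ?\<beta>) (?z \<psi>)) =
      pair_rotation ferm p q (\<lambda>n. if r \<in> n then - ?f ?\<beta> n else ?f ?\<beta> n) \<psi>" for \<psi>
  proof
    fix n
    have mem: "p \<in> sym_diff n {p, q} \<longleftrightarrow> p \<notin> n" by auto
    show "?z (pair_rotation ferm p q (?f ?\<beta>) (?z \<psi>)) n =
      pair_rotation ferm p q (\<lambda>n. if r \<in> n then - ?f ?\<beta> n else ?f ?\<beta> n) \<psi> n"
      unfolding hop_gate_zero[OF r(2)[symmetric]] pair_rotation_def mem inv
      by (cases "r \<in> n"; cases "p \<in> n"; simp)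
  qed
  have "(\<lambda>\<psi>. pair_rotation ferm p q (?f (\<phi> / 2)) (?z (pair_rotation ferm p q (?f ?\<beta>) (?z \<psi>)))) =
    (\<lambda>\<psi>. pair_rotation ferm p q (\<lambda>n. ?f (\<phi> / 2) n + (if r \<in> n then - ?f ?\<beta> n else ?f ?\<beta> n)) \<psi>)"
    unfolding conj by (rule ext, rule pair_rotation_add) (simp_all only: inv insert not_False_eq_True)
  also have "(\<lambda>n. ?f (\<phi> / 2) n + (if r \<in> n then - ?f ?\<beta> n else ?f ?\<beta> n)) =
    (\<lambda>n. if n \<inter> insert r R = c \<inter> insert r R then \<phi> else 0)"
    using insert.hyps(2) by (auto simp: fun_eq_iff)
  finally show ?case
    using hop_ops_comp[OF A[of "\<phi> / 2"] hop_ops_comp[OF z hop_ops_comp[OF A[of ?\<beta>] z]]]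
    by (simp only:)
qed

section \<open>Givens elimination\<close>

lemma ex_angle: "\<exists>\<phi>. cos \<phi> * x + sin \<phi> * y = (0 :: real)"
proof (cases "y = 0")
  case True
  then show ?thesis by (intro exI[of _ "pi / 2"]) simp
next
  case False
  have "cos (arctan (- x / y)) * (x + tan (arctan (- x / y)) * y) = 0"
    using False by (simp add: tan_arctan)
  moreover have "cos (arctan (- x / y)) * tan (arctan (- x / y)) = sin (arctan (- x / y))"
    using cos_arctan_not_zero by (simp add: tan_def)
  ultimately show ?thesis
    by (intro exI[of _ "arctan (- x / y)"]) (simp add: algebra_simps)
qed

text \<open>The weight \<open>card (n - n0)\<close>, summed over the support, decreases in every
  step: a rotation conditional on all other modes empties \<open>n\<close> in favour of
  \<open>n'\<close>, which has one mode fewer outside \<open>n0\<close>, and leaves all other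
  amplitudes alone. Since amplitudes and signs are real, a real angle suffices.\<close>

lemma real_wavefunction_reaches_basis:
  assumes "n0 \<subseteq> {..<M}" "card n0 = f" "real_wavefunction M f \<psi>"
  shows "\<exists>A\<in>hop_ops ferm M. \<exists>\<epsilon>\<in>{1, -1}. A \<psi> = (\<lambda>n. if n = n0 then \<epsilon> else 0)"
  using assms(3)
proof (induction "\<Sum>n | n \<subseteq> {..<M} \<and> \<psi> n \<noteq> 0. card (n - n0)" arbitrary: \<psi> rule: less_induct)
  case less
  have supp: "\<And>n. \<psi> n \<noteq> 0 \<Longrightarrow> n \<subseteq> {..<M}" and num: "\<And>n. \<psi> n \<noteq> 0 \<Longrightarrow> card n = f"
    and real: "\<And>n. \<psi> n \<in> \<real>" and norm: "(\<Sum>n\<in>Pow {..<M}. (norm (\<psi> n))\<^sup>2) = 1"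
    using less.prems by (auto simp: real_wavefunction_def kets_def)
  have fin: "finite n0" using assms(1) finite_subset by blast
  show ?case
  proof (cases "\<exists>n. \<psi> n \<noteq> 0 \<and> n \<noteq> n0")
    case False
    then have z: "\<psi> n = (if n = n0 then \<psi> n0 else 0)" for n by auto
    have "(\<Sum>n\<in>Pow {..<M}. (norm (\<psi> n))\<^sup>2) = (\<Sum>n\<in>{n0}. (norm (\<psi> n))\<^sup>2)"
      using assms(1) False by (intro sum.mono_neutral_right) auto
    then have "(norm (\<psi> n0))\<^sup>2 = 1" using norm by simp
    moreover obtain x where "\<psi> n0 = of_real x" using real[of n0] by (auto elim: Reals_cases)
    ultimately have "\<psi> n0 \<in> {1, -1}" by (auto simp: power2_eq_1_iff)
    moreover have "\<psi> = (\<lambda>n. if n = n0 then \<psi> n0 else 0)"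
      using z by (rule ext)
    ultimately show ?thesis
      using hop_ops_id[of ferm M] by (intro bexI[of _ "\<lambda>\<psi>. \<psi>"] bexI[of _ "\<psi> n0"])
  next
    case True
    then obtain n where n: "\<psi> n \<noteq> 0" "n \<noteq> n0" by metis
    have nM: "n \<subseteq> {..<M}" and cn: "card n = f" using supp[OF n(1)] num[OF n(1)] by simp_all
    have fn: "finite n" using nM finite_subset by blast
    obtain p where p: "p \<in> n" "p \<notin> n0"
      using card_subset_eq[OF fin, of n] n(2) cn assms(2) by auto
    obtain q where q: "q \<in> n0" "q \<notin> n"
      using card_subset_eq[OF fn, of n0] n(2) cn assms(2) by auto
    have pq: "p < M" "q < M" "p \<noteq> q" using p q nM assms(1) by auto
    define n' where "n' = sym_diff n {p, q}"
    define R where "R = {..<M} - {p, q}"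
    obtain x where x: "\<psi> n = of_real x" using real[of n] by (auto elim: Reals_cases)
    obtain x' where x': "\<psi> n' = of_real x'" using real[of n'] by (auto elim: Reals_cases)
    obtain e where e: "hop_sign ferm p q n = of_real e" "e * e = 1"
      using hop_sign_cases[of ferm p q n] that[of 1] that[of "-1"] by auto
    obtain \<phi> where \<phi>: "cos \<phi> * x + sin \<phi> * (e * x') = 0" using ex_angle by blast
    define A where "A = pair_rotation ferm p q (\<lambda>m. if m \<inter> R = n \<inter> R then \<phi> else 0)"
    have A: "A \<in> hop_ops ferm M"
      unfolding A_def R_def using pq by (intro conditional_rotation_in_hop_ops) auto
    have n'n: "n' \<noteq> n" "n' \<subseteq> {..<M}" "n' \<inter> R = n \<inter> R" "p \<notin> n'" "q \<in> n'" "sym_diff n' {p, q} = n"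
      unfolding n'_def R_def using p q nM pq by auto
    have n'_eq: "n' = insert q (n - {p})" unfolding n'_def using p q by auto
    have "card n > 0" using p(1) fn by (auto simp: card_gt_0_iff)
    then have cn': "card n' = f" using n'_eq cn fn p q by simp
    have hn': "hop_sign ferm p q n' = of_real e" unfolding n'_def hop_sign_sym_diff e ..
    have An: "A \<psi> n = 0"
    proof -
      have "A \<psi> n = of_real (cos \<phi> * x + sin \<phi> * (e * x'))"
        unfolding A_def pair_rotation_def n'_def[symmetric] using p q x x' e by simp
      then show ?thesis using \<phi> by simp
    qed
    have An': "A \<psi> n' = of_real (cos \<phi> * x' - sin \<phi> * (e * x))"
      unfolding A_def pair_rotation_def n'n(6) using n'n x x' hn' by simp
    have Ao: "A \<psi> m = \<psi> m" if m: "m \<noteq> n" "m \<noteq> n'" for m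
    proof (cases "(p \<in> m) \<noteq> (q \<in> m) \<and> m \<inter> R = n \<inter> R")
      case True
      \<comment> \<open>The condition on \<open>R\<close> says nothing about positions from
        \<open>M\<close> on, so the rotation also acts on basis states outside the register. Those
        carry no amplitude.\<close>
      have "\<not> m \<subseteq> {..<M}"
      proof
        assume M: "m \<subseteq> {..<M}"
        have "m = n" if "p \<in> m"
        proof -
          have "q \<notin> m" using True that by auto
          moreover have "(m \<inter> R) \<union> {p} = (n \<inter> R) \<union> {p}" using True by simp
          ultimately show ?thesis using M nM p q that by (auto simp: R_def)
        qed
        moreover have "m = n'" if "p \<notin> m"
        proof -
          have "q \<in> m" using True that by auto
          moreover have "(m \<inter> R) \<union> {q} = (n' \<inter> R) \<union> {q}" using True n'n by simp
          ultimately show ?thesis using M n'n that by (auto simp: R_def)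
        qed
        ultimately show False using m by blast
      qed
      then have "\<not> m \<subseteq> {..<M}" "\<not> sym_diff m {p, q} \<subseteq> {..<M}" using pq by auto
      then have "\<psi> m = 0" "\<psi> (sym_diff m {p, q}) = 0" using supp by blast+
      then show ?thesis by (simp add: A_def pair_rotation_def)
    next
      case False
      then show ?thesis by (auto simp: A_def pair_rotation_def)
    qed
    have supp': "m \<noteq> n \<and> (m = n' \<or> \<psi> m \<noteq> 0)" if "A \<psi> m \<noteq> 0" for m
      using that An Ao[of m] by (cases "m = n"; cases "m = n'") simp_all
    have wf: "real_wavefunction M f (A \<psi>)"
      unfolding real_wavefunction_def kets_def
    proof (intro conjI CollectI allI impI)
      fix m assume "A \<psi> m \<noteq> 0"
      then show "m \<subseteq> {..<M}" "card m = f"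
        using supp'[of m] n'n(2) cn' supp[of m] num[of m] by (cases "m = n'"; simp)+
    next
      fix m show "A \<psi> m \<in> \<real>" using An An' Ao[of m] real[of m] by (cases "m = n"; cases "m = n'") simp_all
    next
      have P: "Pow {..<M} = insert n (insert n' (Pow {..<M} - {n, n'}))"
        using nM n'n by auto
      \<comment> \<open>The rotation preserves the norm of the pair, and the other component is 0 by
        the choice of \<phi>.\<close>
      have eq: "(cos \<phi> * x' - sin \<phi> * (e * x))\<^sup>2 = x\<^sup>2 + x'\<^sup>2"
      proof -
        have "(cos \<phi> * x' - sin \<phi> * (e * x))\<^sup>2 + (cos \<phi> * x + sin \<phi> * (e * x'))\<^sup>2 =
          ((cos \<phi>)\<^sup>2 + (sin \<phi>)\<^sup>2 * (e * e)) * (x\<^sup>2 + x'\<^sup>2)"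
          by (simp add: power2_eq_square algebra_simps)
        then show ?thesis using \<phi> e by simp
      qed
      have "(\<Sum>m\<in>Pow {..<M}. (norm (A \<psi> m))\<^sup>2) =
        (norm (A \<psi> n))\<^sup>2 + (norm (A \<psi> n'))\<^sup>2 + (\<Sum>m\<in>Pow {..<M} - {n, n'}. (norm (A \<psi> m))\<^sup>2)"
        by (subst P) (use n'n in simp)
      also have "\<dots> = (norm (\<psi> n))\<^sup>2 + (norm (\<psi> n'))\<^sup>2 + (\<Sum>m\<in>Pow {..<M} - {n, n'}. (norm (\<psi> m))\<^sup>2)"
        unfolding An An' x x' norm_of_real power2_abs eq
        using Ao by (auto intro!: sum.cong)
      also have "\<dots> = (\<Sum>m\<in>Pow {..<M}. (norm (\<psi> m))\<^sup>2)"
        using n'n(1) by (simp add: P[THEN arg_cong, of "sum (\<lambda>m. (norm (\<psi> m))\<^sup>2)"])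
      finally show "(\<Sum>m\<in>Pow {..<M}. (norm (A \<psi> m))\<^sup>2) = 1" using norm by simp
    qed
    let ?S = "{m. m \<subseteq> {..<M} \<and> \<psi> m \<noteq> 0}"
    have "(\<Sum>m | m \<subseteq> {..<M} \<and> A \<psi> m \<noteq> 0. card (m - n0)) \<le>
      (\<Sum>m\<in>insert n' (?S - {n, n'}). card (m - n0))"
      using supp' by (intro sum_mono2) auto
    also have "\<dots> = card (n' - n0) + (\<Sum>m\<in>?S - {n, n'}. card (m - n0))"
      by simp
    also have "card (n' - n0) < card (n - n0)"
      unfolding n'_eq using p q fn by (intro psubset_card_mono) auto
    also have "card (n - n0) + (\<Sum>m\<in>?S - {n, n'}. card (m - n0)) =
      (\<Sum>m\<in>insert n (?S - {n, n'}). card (m - n0))"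
      by simp
    also have "\<dots> \<le> (\<Sum>m | m \<subseteq> {..<M} \<and> \<psi> m \<noteq> 0. card (m - n0))"
      using n nM by (intro sum_mono2) auto
    finally obtain B \<epsilon> where B: "B \<in> hop_ops ferm M" "\<epsilon> \<in> {1, -1}"
      "B (A \<psi>) = (\<lambda>n. if n = n0 then \<epsilon> else 0)"
      using less.hyps[OF _ wf] by auto
    then show ?thesis
      using hop_ops_comp[OF B(1) A] by (intro bexI[of _ "\<lambda>\<psi>. B (A \<psi>)"] bexI[of _ \<epsilon>])
  qed
qed

text \<open>Both wavefunctions are brought to the same basis state, taken from the support of the
  initial one, and the second route is run backwards. The signs picked up on the two routes combine
  to the global sign.\<close>

lemma hop_gates_universal: "hop_universal ferm M f"
  unfolding hop_universal_def
proof (intro allI impI, elim conjE)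
  fix \<psi> \<xi> assume wf: "real_wavefunction M f \<psi>" "real_wavefunction M f \<xi>"
  have "\<exists>n\<in>Pow {..<M}. \<psi> n \<noteq> 0"
  proof (rule ccontr)
    assume "\<not> ?thesis"
    then have "(\<Sum>n\<in>Pow {..<M}. (norm (\<psi> n))\<^sup>2) = 0" by simp
    then show False using wf(1) by (simp add: real_wavefunction_def)
  qed
  then obtain n0 where n0: "n0 \<subseteq> {..<M}" "card n0 = f"
    using wf(1) by (auto simp: real_wavefunction_def)
  let ?\<delta> = "\<lambda>\<epsilon> n. if n = n0 then \<epsilon> else (0 :: complex)"
  obtain A \<epsilon> where A: "A \<in> hop_ops ferm M" "\<epsilon> \<in> {1, -1}" "A \<psi> = ?\<delta> \<epsilon>"
    using real_wavefunction_reaches_basis[OF n0 wf(1)] by blast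
  obtain B \<epsilon>' where B: "B \<in> hop_ops ferm M" "\<epsilon>' \<in> {1, -1}" "B \<xi> = ?\<delta> \<epsilon>'"
    using real_wavefunction_reaches_basis[OF n0 wf(2)] by blast
  obtain C where C: "C \<in> hop_ops ferm M" "\<And>\<psi>. C (B \<psi>) = \<psi>"
    using hop_ops_inverse[OF B(1)] by blast
  have "A \<psi> = (\<lambda>n. \<epsilon> * \<epsilon>' * B \<xi> n)"
    using A B by (auto simp: fun_eq_iff)
  then have "C (A \<psi>) = (\<lambda>n. \<epsilon> * \<epsilon>' * \<xi> n)"
    using hop_ops_scale[OF C(1)] C(2) by simp
  moreover have "\<dots> \<in> {\<xi>, \<lambda>n. - \<xi> n}"
    using A(2) B(2) by auto
  ultimately have mem: "C (A \<psi>) \<in> {\<xi>, \<lambda>n. - \<xi> n}" by simp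
  obtain hs where hs: "(\<lambda>\<psi>. C (A \<psi>)) = apply_hops ferm hs"
    "\<forall>(\<phi>, p, q)\<in>set hs. p < M \<and> q < M \<and> p \<noteq> q"
    using hop_ops_comp[OF C(1) A(1)] unfolding hop_ops_def by auto
  have "apply_hops ferm hs \<psi> \<in> {\<xi>, \<lambda>n. - \<xi> n}"
    using mem fun_cong[OF hs(1), of \<psi>] by simp
  then show "\<exists>hs. (\<forall>(\<phi>, p, q)\<in>set hs. p < M \<and> q < M \<and> p \<noteq> q) \<and>
         apply_hops ferm hs \<psi> \<in> {\<xi>, \<lambda>n. - \<xi> n}"
    using hs(2) by (intro exI[of _ hs] conjI)
qed

subsection \<open>Parities and Pauli operators\<close>

lemma odd_card_sym_diff:
  assumes "finite A" "finite B"
  shows "odd (card (sym_diff A B)) \<longleftrightarrow> odd (card A) \<noteq> odd (card B)"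
proof -
  have "card A = card (A - B) + card (A \<inter> B)" "card B = card (B - A) + card (A \<inter> B)"
    using card_Int_Diff[of A B] card_Int_Diff[of B A] assms by (simp_all add: Int_commute)
  moreover have "card (sym_diff A B) = card (A - B) + card (B - A)"
    using assms by (intro card_Un_disjoint) auto
  ultimately show ?thesis by presburger
qed

lemma odd_card_sym_diff_Int:
  assumes "finite X"
  shows "odd (card (sym_diff A B \<inter> X)) \<longleftrightarrow> odd (card (A \<inter> X)) \<noteq> odd (card (B \<inter> X))"
proof -
  have "sym_diff A B \<inter> X = sym_diff (A \<inter> X) (B \<inter> X)" by auto
  then show ?thesis using assms by (simp add: odd_card_sym_diff)
qed

lemma odd_card_nonempty: "odd (card A) \<Longrightarrow> A \<noteq> {}"
  by auto

text \<open>The character, for the mask \<open>X\<close>, of the group of sets under symmetric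
  difference. For finite masks it is multiplicative both in the state and in the mask.\<close>

definition parity_sign :: "nat set \<Rightarrow> nat set \<Rightarrow> complex" where
  "parity_sign X n = (if odd (card (n \<inter> X)) then -1 else 1)"

lemma pauli_Z_eq: "pauli_Z X \<psi> = (\<lambda>s. parity_sign X s * \<psi> s)"
  by (auto simp: pauli_Z_def parity_sign_def minus_one_power_iff)

lemma parity_sign_square [simp]: "parity_sign X n * parity_sign X n = 1"
  by (simp add: parity_sign_def)

lemma cnj_parity_sign [simp]: "cnj (parity_sign X n) = parity_sign X n"
  by (simp add: parity_sign_def)

lemma parity_sign_sym_diff:
  "finite X \<Longrightarrow> parity_sign X (sym_diff n m) = parity_sign X n * parity_sign X m"
  by (auto simp: parity_sign_def odd_card_sym_diff_Int)

lemma parity_sign_sym_diff_mask: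
  assumes "finite X" "finite Y"
  shows "parity_sign (sym_diff X Y) n = parity_sign X n * parity_sign Y n"
proof -
  have "n \<inter> sym_diff X Y = sym_diff (n \<inter> X) (n \<inter> Y)" by auto
  then show ?thesis using assms by (auto simp: parity_sign_def odd_card_sym_diff)
qed

lemma parity_sign_empty [simp]: "parity_sign {} n = 1" "parity_sign X {} = 1"
  by (simp_all add: parity_sign_def)

lemma parity_sign_singleton: "parity_sign {p} n = (if p \<in> n then -1 else 1)"
  by (simp add: parity_sign_def)

lemma card_sym_diff_le: "finite A \<Longrightarrow> finite B \<Longrightarrow> card (sym_diff A B) \<le> card A + card B"
  by (rule order_trans[OF card_mono card_Un_le]) auto

subsection \<open>The Fenwick tree\<close>

text \<open>The number of binary digits of \<open>M\<close>; also the factor of \<open>F + 4\<close>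
  in \<open>code_G\<close>.\<close>

definition bk_depth :: "nat \<Rightarrow> nat" where
  "bk_depth M = nat \<lceil>log 2 (real M + 1)\<rceil>"

lemma power_le_imp_le_bk_depth:
  assumes "2 ^ t \<le> M + 1"
  shows "t \<le> bk_depth M"
proof -
  have "real t \<le> log 2 (real M + 1)"
    using of_nat_mono[OF assms, where 'a = real] by (subst le_log_iff) (simp_all add: powr_realpow)
  also have "\<dots> \<le> of_int \<lceil>log 2 (real M + 1)\<rceil>" by (rule le_of_int_ceiling)
  finally show ?thesis unfolding bk_depth_def by linarith
qed

lemma power_le_imp_less_bk_depth:
  assumes "2 ^ t \<le> M"
  shows "t < bk_depth M"
proof -
  have "real (2 ^ t) < real (M + 1)" using assms by (simp only: of_nat_less_iff)
  then have "real t < log 2 (real M + 1)"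
    by (subst less_log_iff) (simp_all add: powr_realpow)
  also have "\<dots> \<le> of_int \<lceil>log 2 (real M + 1)\<rceil>" by (rule le_of_int_ceiling)
  finally show ?thesis unfolding bk_depth_def by linarith
qed

lemma bk_depth_ge_1: "M \<ge> 1 \<Longrightarrow> bk_depth M \<ge> 1"
  using power_le_imp_less_bk_depth[of 0 M] by simp

lemma bk_subset: "bk M n \<subseteq> {..<M}"
  by (auto simp: bk_def)

lemma finite_bk [simp]: "finite (bk M n)"
  using bk_subset finite_subset by blast

lemma bk_sym_diff: "bk M (sym_diff a b) = sym_diff (bk M a) (bk M b)"
  by (auto simp: bk_def odd_card_sym_diff_Int bk_modes_def)

text \<open>If bit \<open>i\<close> covers mode \<open>j\<close> and its node has size 2^t, then
  \<open>i + 1\<close> is the only multiple of 2^t among j + 1, ..., j + 2^t. So \<open>t\<close>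
  determines \<open>i\<close>, and 2^t <= i + 1 <= M bounds the number of values of
  \<open>t\<close>.\<close>

lemma card_bk_update_le: "card {i. i < M \<and> j \<in> bk_modes i} \<le> bk_depth M"
proof -
  let ?U = "{i. i < M \<and> j \<in> bk_modes i}" and ?t = "\<lambda>i. multiplicity 2 (i + 1)"
  have aux: "x = P * Suc (j div P)" if "P dvd x" "x - P \<le> j" "j < x" for x P :: nat
  proof -
    obtain a where a: "x = P * a" using \<open>P dvd x\<close> by (rule dvdE)
    moreover have "a \<noteq> 0" "P > 0" using a \<open>j < x\<close> by (auto intro!: gr0I)
    moreover obtain b where b: "a = Suc b" using \<open>a \<noteq> 0\<close> not0_implies_Suc by blast
    moreover have "j div P = b"
      using that(2,3) a b by (intro div_nat_eqI) (simp_all add: mult.commute)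
    ultimately show ?thesis by simp
  qed
  have div: "i + 1 = 2 ^ ?t i * Suc (j div 2 ^ ?t i)" if "i \<in> ?U" for i
    using that by (intro aux multiplicity_dvd) (auto simp: bk_modes_def)
  have "inj_on ?t ?U"
  proof (rule inj_onI)
    fix i i' assume *: "i \<in> ?U" "i' \<in> ?U" "?t i = ?t i'"
    have "i + 1 = 2 ^ ?t i * Suc (j div 2 ^ ?t i)" by (rule div[OF *(1)])
    also have "\<dots> = i' + 1" unfolding *(3) by (rule div[OF *(2), symmetric])
    finally have "i + 1 = i' + 1" .
    then show "i = i'" by simp
  qed
  moreover have "?t ` ?U \<subseteq> {..<bk_depth M}"
  proof
    fix t assume "t \<in> ?t ` ?U"
    then obtain i where "i < M" "t = ?t i" by auto
    then have "2 ^ t \<le> i + 1" using multiplicity_dvd[of 2 "i + 1"] by (intro dvd_imp_le) auto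
    then have "2 ^ t \<le> M" using \<open>i < M\<close> by simp
    then show "t \<in> {..<bk_depth M}" using power_le_imp_less_bk_depth by simp
  qed
  ultimately show ?thesis using card_inj_on_le[of ?t ?U "{..<bk_depth M}"] by simp
qed

lemma card_bk_le:
  assumes "finite n"
  shows "card (bk M n) \<le> card n * bk_depth M"
proof -
  have "bk M n \<subseteq> (\<Union>j\<in>n. {i. i < M \<and> j \<in> bk_modes i})"
  proof
    fix i assume i: "i \<in> bk M n"
    then have "n \<inter> bk_modes i \<noteq> {}" by (auto simp: bk_def)
    then show "i \<in> (\<Union>j\<in>n. {i. i < M \<and> j \<in> bk_modes i})" using i by (auto simp: bk_def)
  qed
  then have "card (bk M n) \<le> card (\<Union>j\<in>n. {i. i < M \<and> j \<in> bk_modes i})"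
    using assms by (intro card_mono) auto
  also have "\<dots> \<le> (\<Sum>j\<in>n. card {i. i < M \<and> j \<in> bk_modes i})"
    using assms by (rule card_UN_le)
  also have "\<dots> \<le> (\<Sum>j\<in>n. bk_depth M)"
    by (intro sum_mono card_bk_update_le)
  finally show ?thesis by simp
qed

text \<open>Taking the node that ends the prefix clears the lowest 1 in the binary expansion of
  \<open>j\<close>, so the \<open>B\<close> constructed has as many elements as \<open>j\<close> has
  ones. The size claim says that a multiple \<open>j\<close> of 2^s is at least 2^s (2^card B - 1),
  the least number with that many ones from position \<open>s\<close> on. The case
  \<open>s = 0\<close> is the bound wanted; the induction needs all \<open>s\<close>.\<close>

lemma prefix_decomposition:
  "\<exists>B\<subseteq>{..<j}. (\<forall>s. 2 ^ s dvd j \<longrightarrow> 2 ^ s * 2 ^ card B \<le> j + 2 ^ s) \<and>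
     (\<forall>n. odd (card (n \<inter> {..<j})) \<longleftrightarrow> odd (card {i\<in>B. odd (card (n \<inter> bk_modes i))}))"
proof (induction j rule: less_induct)
  case (less j)
  show ?case
  proof (cases "j = 0")
    case False
    define t where "t = multiplicity 2 j"
    obtain a where a: "j = 2 ^ t * a" and "odd a"
      unfolding t_def using multiplicity_decompose'[of j 2] False by auto
    from \<open>odd a\<close> obtain b where b: "a = Suc (2 * b)" by (auto elim!: oddE)
    let ?j' = "j - 2 ^ t"
    have j': "?j' = 2 ^ Suc t * b" "?j' + 2 ^ t = j" unfolding a b by simp_all
    have "?j' < j" using j'(2) using False by simp
    from less.IH[OF this] obtain B where B: "B \<subseteq> {..<?j'}"
      "\<And>s. 2 ^ s dvd ?j' \<Longrightarrow> 2 ^ s * 2 ^ card B \<le> ?j' + 2 ^ s"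
      "\<And>n. odd (card (n \<inter> {..<?j'})) \<longleftrightarrow> odd (card {i\<in>B. odd (card (n \<inter> bk_modes i))})"
      by (elim exE conjE) auto
    have fB: "finite B" and nB: "j - 1 \<notin> B"
      using finite_subset[OF B(1)] subsetD[OF B(1), of "j - 1"] diff_le_mono2[of 1 "2 ^ t" j] by auto
    let ?B = "insert (j - 1) B"
    \<comment> \<open>Removing the lowest 1 leaves a multiple of twice the node size, so the
      hypothesis applies with \<open>Suc t\<close>. The extra factor 2 pays for the new
      node.\<close>
    have "2 ^ Suc t * 2 ^ card B \<le> ?j' + 2 ^ Suc t"
      by (rule B(2)) (simp add: j'(1))
    then have t: "2 ^ t * 2 ^ card ?B \<le> j + 2 ^ t"
      using j'(2) fB nB by simp
    have size: "2 ^ s * 2 ^ card ?B \<le> j + 2 ^ s" if "2 ^ s dvd j" for s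
    proof -
      have "s \<le> t" unfolding t_def using that False by (intro multiplicity_geI) auto
      then have "2 ^ s \<le> (2 :: nat) ^ t" by simp
      then have "2 ^ s * (2 ^ card ?B - 1) \<le> 2 ^ t * (2 ^ card ?B - 1 :: nat)" by simp
      also have "\<dots> \<le> j" using t by (simp add: diff_mult_distrib2)
      finally show ?thesis by (simp add: diff_mult_distrib2)
    qed
    have parity: "odd (card (n \<inter> {..<j})) \<longleftrightarrow> odd (card {i\<in>?B. odd (card (n \<inter> bk_modes i))})" for n
    proof -
      have "bk_modes (j - 1) = {?j'..<j}"
        using False by (auto simp: bk_modes_def t_def)
      then have "n \<inter> {..<j} = (n \<inter> {..<?j'}) \<union> (n \<inter> bk_modes (j - 1))"
        by auto
      moreover have "(n \<inter> {..<?j'}) \<inter> (n \<inter> bk_modes (j - 1)) = {}"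
        using \<open>bk_modes (j - 1) = {?j'..<j}\<close> by auto
      ultimately have c: "card (n \<inter> {..<j}) = card (n \<inter> {..<?j'}) + card (n \<inter> bk_modes (j - 1))"
        by (metis card_Un_disjoint finite_Int finite_lessThan finite_Un)
      have "{i\<in>?B. odd (card (n \<inter> bk_modes i))} =
        (if odd (card (n \<inter> bk_modes (j - 1))) then insert (j - 1) {i\<in>B. odd (card (n \<inter> bk_modes i))}
         else {i\<in>B. odd (card (n \<inter> bk_modes i))})"
        by auto
      then show ?thesis using c B(3)[of n] fB nB by auto
    qed
    have "?B \<subseteq> {..<j}" using B(1) False by auto
    with size parity show ?thesis by (intro exI[of _ ?B]) auto
  qed (intro exI[of _ "{}"]; simp)
qed

definition bk_mask :: "nat \<Rightarrow> nat set \<Rightarrow> nat set \<Rightarrow> bool" where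
  "bk_mask M X B \<longleftrightarrow> finite X \<and> B \<subseteq> {..<M} \<and> (\<forall>n. parity_sign X n = parity_sign B (bk M n))"

lemma ex_bk_mask_lessThan:
  assumes "j \<le> M"
  shows "\<exists>B. bk_mask M {..<j} B \<and> card B \<le> bk_depth M"
proof -
  obtain B where B: "B \<subseteq> {..<j}" "\<And>s. 2 ^ s dvd j \<Longrightarrow> 2 ^ s * 2 ^ card B \<le> j + 2 ^ s"
    "\<And>n. odd (card (n \<inter> {..<j})) \<longleftrightarrow> odd (card {i\<in>B. odd (card (n \<inter> bk_modes i))})"
    using prefix_decomposition[of j] by (elim exE conjE) auto
  have "{i\<in>B. odd (card (n \<inter> bk_modes i))} = bk M n \<inter> B" for n
    using B(1) assms by (auto simp: bk_def)
  then have "bk_mask M {..<j} B"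
    using B assms by (auto simp: bk_mask_def parity_sign_def)
  moreover have "card B \<le> bk_depth M"
    using B(2)[of 0] assms by (intro power_le_imp_le_bk_depth) simp
  ultimately show ?thesis by blast
qed

lemma bk_mask_finite: "bk_mask M X B \<Longrightarrow> finite B"
  unfolding bk_mask_def using finite_subset by blast

lemma bk_mask_sym_diff:
  assumes "bk_mask M X B" "bk_mask M Y C"
  shows "bk_mask M (sym_diff X Y) (sym_diff B C)"
  using assms bk_mask_finite[OF assms(1)] bk_mask_finite[OF assms(2)]
  unfolding bk_mask_def by (auto simp: parity_sign_sym_diff_mask)

text \<open>The weight is counted on the Bravyi-Kitaev bits because each of them costs one majority
  in the circuits.\<close>

definition bk_weight_le :: "nat \<Rightarrow> nat set \<Rightarrow> nat \<Rightarrow> bool" where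
  "bk_weight_le M X k \<longleftrightarrow> (\<exists>B. bk_mask M X B \<and> card B \<le> k)"

lemma bk_weight_le_lessThan: "j \<le> M \<Longrightarrow> bk_weight_le M {..<j} (bk_depth M)"
  unfolding bk_weight_le_def by (rule ex_bk_mask_lessThan)

lemma bk_weight_le_sym_diff:
  "bk_weight_le M X k \<Longrightarrow> bk_weight_le M Y l \<Longrightarrow> bk_weight_le M (sym_diff X Y) (k + l)"
  unfolding bk_weight_le_def
  by (meson bk_mask_sym_diff bk_mask_finite card_sym_diff_le add_mono order_trans)

lemma bk_weight_le_singleton:
  assumes "j < M"
  shows "bk_weight_le M {j} (2 * bk_depth M)"
proof -
  have "{j} = sym_diff {..<Suc j} {..<j}" by auto
  then show ?thesis
    using bk_weight_le_sym_diff[OF bk_weight_le_lessThan[of "Suc j" M] bk_weight_le_lessThan[of j M]] assms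
    by (simp add: mult_2)
qed

text \<open>The occupation of a single mode is a parity of Bravyi-Kitaev bits, so the map has
  trivial kernel. Together with \<open>cw_nonempty\<close> this provides the pivot of the
  fan-out.\<close>

lemma bk_nonempty:
  assumes "n \<subseteq> {..<M}" "n \<noteq> {}"
  shows "bk M n \<noteq> {}"
proof
  assume e: "bk M n = {}"
  obtain j where j: "j \<in> n" "j < M" using assms by auto
  then obtain B where "bk_mask M {j} B" using bk_weight_le_singleton unfolding bk_weight_le_def by blast
  then have "parity_sign {j} n = parity_sign B (bk M n)" by (auto simp: bk_mask_def)
  then show False using e j by (simp add: parity_sign_singleton)
qed

definition basis_ket :: "nat set \<Rightarrow> ket" where
  "basis_ket s = (\<lambda>r. if r = s then 1 else 0)"

subsection \<open>Circuits\<close>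

definition circuit :: "nat \<Rightarrow> nat \<Rightarrow> operator \<Rightarrow> bool" where
  "circuit m k A \<longleftrightarrow>
     (\<exists>gs. length gs \<le> k \<and> (\<forall>g\<in>set gs. cc_valid m g) \<and> fold cc_apply gs = A)"

lemma circuit_id: "circuit m 0 (\<lambda>\<psi>. \<psi>)"
  unfolding circuit_def by (rule exI[of _ "[]"]) (simp add: id_def)

lemma circuit_comp:
  assumes "circuit m k A" "circuit m l B"
  shows "circuit m (k + l) (\<lambda>\<psi>. B (A \<psi>))"
proof -
  obtain gs where gs: "length gs \<le> k" "\<forall>g\<in>set gs. cc_valid m g" "fold cc_apply gs = A"
    using assms(1) unfolding circuit_def by (elim exE conjE)
  obtain hs where hs: "length hs \<le> l" "\<forall>g\<in>set hs. cc_valid m g" "fold cc_apply hs = B"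
    using assms(2) unfolding circuit_def by (elim exE conjE)
  have "fold cc_apply (gs @ hs) = (\<lambda>\<psi>. B (A \<psi>))"
    by (simp add: gs(3) hs(3) fun_eq_iff)
  then show ?thesis
    unfolding circuit_def using gs hs by (intro exI[of _ "gs @ hs"]) auto
qed

lemma circuit_mono: "circuit m k A \<Longrightarrow> k \<le> l \<Longrightarrow> circuit m l A"
  unfolding circuit_def by (elim exE) (rule exI, auto)

lemma circuit_gate: "cc_valid m g \<Longrightarrow> circuit m 1 (cc_apply g)"
  unfolding circuit_def by (rule exI[of _ "[g]"]) (simp add: fun_eq_iff)

lemma cc_apply_linear:
  "cc_apply g (\<lambda>s. \<Sum>i\<in>I. c i * f i s) = (\<lambda>s. \<Sum>i\<in>I. c i * cc_apply g (f i) s)"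
proof (cases g)
  case (CC p q t U)
  obtain a u b v where "p = (a, u)" "q = (b, v)" by (cases p, cases q)
  then show ?thesis
    unfolding CC
    by (auto simp: fun_eq_iff sum_distrib_left UNIV_bool sum.distrib algebra_simps)
qed

lemma circuit_linear:
  assumes "circuit m k A"
  shows "A (\<lambda>s. \<Sum>i\<in>I. c i * f i s) = (\<lambda>s. \<Sum>i\<in>I. c i * A (f i) s)"
proof -
  obtain gs where gs: "fold cc_apply gs = A"
    using assms unfolding circuit_def by (elim exE conjE)
  have "fold cc_apply gs (\<lambda>s. \<Sum>i\<in>I. c i * f i s) = (\<lambda>s. \<Sum>i\<in>I. c i * fold cc_apply gs (f i) s)"
    by (induction gs arbitrary: f) (simp_all add: cc_apply_linear)
  then show ?thesis by (simp add: gs)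
qed

lemma circuit_scale: "circuit m k A \<Longrightarrow> A (\<lambda>s. c * f s) = (\<lambda>s. c * A f s)"
  using circuit_linear[of m k A "\<lambda>_. c" "\<lambda>_. f" "{()}"] by simp

lemma circuit_add:
  "circuit m k A \<Longrightarrow> A (\<lambda>s. c * f s + d * g s) = (\<lambda>s. c * A f s + d * A g s)"
  using circuit_linear[of m k A "\<lambda>b. if b then c else d" "\<lambda>b. if b then f else g" UNIV]
  by (simp add: UNIV_bool add.commute)

text \<open>An arbitrary predicate lets gates with two, one or no controls share one form. It
  describes a controlled gate when \<open>P\<close> does not depend on the bit
  \<open>t\<close>.\<close>

definition controlled :: "(nat set \<Rightarrow> bool) \<Rightarrow> nat \<Rightarrow> complex ^ bool ^ bool \<Rightarrow> operator" where
  "controlled P t U \<psi> = (\<lambda>s.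
     if P s then \<Sum>k\<in>UNIV. U $ (t \<in> s) $ k * \<psi> (set_bit_to t k s) else \<psi> s)"

lemma circuit_controlled2:
  assumes "a < m" "b < m" "t < m" "a \<noteq> b" "a \<noteq> t" "b \<noteq> t" "unitary2 U"
  shows "circuit m 1 (controlled (\<lambda>s. (a \<in> s) = u \<and> (b \<in> s) = v) t U)"
proof -
  have "cc_apply (CC (a, u) (b, v) t U) = controlled (\<lambda>s. (a \<in> s) = u \<and> (b \<in> s) = v) t U"
    by (auto simp: fun_eq_iff controlled_def)
  then show ?thesis using circuit_gate[of m "CC (a, u) (b, v) t U"] assms by simp
qed

lemma circuit_controlled_split:
  assumes "circuit m k (controlled (\<lambda>s. P s \<and> (b \<in> s) = True) t U)"
    and "circuit m l (controlled (\<lambda>s. P s \<and> (b \<in> s) = False) t U)"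
    and "b \<noteq> t" "\<And>s k. P (set_bit_to t k s) = P s"
  shows "circuit m (k + l) (controlled P t U)"
proof -
  have b: "b \<in> set_bit_to t k s \<longleftrightarrow> b \<in> s" for k s
    using assms(3) by (simp add: set_bit_to_def)
  have "(\<lambda>\<psi>. controlled (\<lambda>s. P s \<and> (b \<in> s) = False) t U
      (controlled (\<lambda>s. P s \<and> (b \<in> s) = True) t U \<psi>)) = controlled P t U"
    by (rule ext, rule ext) (simp add: controlled_def b assms(4))
  then show ?thesis using circuit_comp[OF assms(1,2)] by simp
qed

lemma ex_spare_qubit:
  fixes m a t :: nat
  assumes "m \<ge> 3"
  shows "\<exists>b<m. b \<noteq> a \<and> b \<noteq> t"
proof -
  have "card {..<m} \<le> card {a, t}" if "{..<m} \<subseteq> {a, t}" using that by (intro card_mono) auto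
  moreover have "card {a, t} \<le> 2" by (simp add: card_insert_if)
  ultimately have "\<not> {..<m} \<subseteq> {a, t}" using assms by auto
  then show ?thesis by auto
qed

lemma circuit_controlled1:
  assumes "m \<ge> 3" "a < m" "t < m" "a \<noteq> t" "unitary2 U"
  shows "circuit m 2 (controlled (\<lambda>s. (a \<in> s) = u) t U)"
proof -
  obtain b where "b < m" "b \<noteq> a" "b \<noteq> t" using ex_spare_qubit[OF assms(1)] by auto
  then have "circuit m (1 + 1) (controlled (\<lambda>s. (a \<in> s) = u) t U)"
    using assms by (intro circuit_controlled_split[where b = b] circuit_controlled2)
      (auto simp: set_bit_to_def)
  then show ?thesis by (simp add: numeral_2_eq_2)
qed

lemma circuit_controlled0:
  assumes "m \<ge> 3" "t < m" "unitary2 U"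
  shows "circuit m 4 (controlled (\<lambda>_. True) t U)"
proof -
  obtain b where "b < m" "b \<noteq> t" using ex_spare_qubit[OF assms(1)] by auto
  then have "circuit m (2 + 2) (controlled (\<lambda>_. True) t U)"
    using assms circuit_controlled1[of m b t U True] circuit_controlled1[of m b t U False]
    by (intro circuit_controlled_split[where b = b]) simp_all
  then show ?thesis by simp
qed

definition matrix2 :: "complex \<Rightarrow> complex \<Rightarrow> complex \<Rightarrow> complex \<Rightarrow> complex ^ bool ^ bool" where
  "matrix2 a b c d = (\<chi> i j. if i then (if j then d else c) else (if j then b else a))"

lemma unitary2_matrix2:
  "unitary2 (matrix2 a b c d) \<longleftrightarrow> cnj a * a + cnj c * c = 1 \<and> cnj b * b + cnj d * d = 1 \<and>
     cnj a * b + cnj c * d = 0 \<and> cnj b * a + cnj d * c = 0"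
  unfolding unitary2_def matrix2_def
  by (auto simp: vec_eq_iff matrix_matrix_mult_def mat_def UNIV_bool all_bool_eq add.commute)

lemma sum_bool: "(\<Sum>k\<in>UNIV. f k) = f (b :: bool) + f (\<not> b)"
  by (cases b) (simp_all add: UNIV_bool add.commute)

lemma controlled_basis_ket:
  assumes P: "\<And>s k. P (set_bit_to t k s) = P s"
  shows "controlled P t U (basis_ket s) =
    (if P s then \<lambda>r. U $ (t \<in> s) $ (t \<in> s) * basis_ket s r
                  + U $ (t \<notin> s) $ (t \<in> s) * basis_ket (sym_diff s {t}) r
     else basis_ket s)"
proof
  fix r
  have eq: "set_bit_to t k r = s \<longleftrightarrow> k = (t \<in> s) \<and> (r = s \<or> r = sym_diff s {t})" for k
    by (auto simp: set_bit_to_def)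
  have ne: "s \<noteq> sym_diff s {t}" by blast
  have Pr: "P r = P s" if "r = s \<or> r = sym_diff s {t}"
    using that eq[of "t \<in> s"] P[of "t \<in> s" r] by simp
  have mem: "t \<in> sym_diff s {t} \<longleftrightarrow> t \<notin> s" by blast
  show "controlled P t U (basis_ket s) r =
    (if P s then \<lambda>r. U $ (t \<in> s) $ (t \<in> s) * basis_ket s r
                  + U $ (t \<notin> s) $ (t \<in> s) * basis_ket (sym_diff s {t}) r
     else basis_ket s) r"
  proof (cases "r = s \<or> r = sym_diff s {t}")
    case True
    then have PP: "P r = P s" by (rule Pr)
    have "controlled P t U (basis_ket s) r =
      (if P s then U $ (t \<in> r) $ (t \<in> s) else basis_ket s r)"
      unfolding controlled_def PP sum_bool[of _ "t \<in> s"] using eq True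
      by (simp add: basis_ket_def)
    then show ?thesis using True ne mem by (auto simp: basis_ket_def)
  next
    case False
    then show ?thesis
      unfolding controlled_def by (simp add: basis_ket_def eq)
  qed
qed

subsection \<open>Reversible circuits\<close>

text \<open>States are amplitude functions, so the circuit of \<pi> pulls back along \<pi>: it sends
  the basis state of \<open>s\<close> to that of \<open>inv \<pi> s\<close>, and in a composition
  the circuit of the left factor runs first. The inverse is carried along because shifts, unlike
  toggles, are in general not involutions.\<close>

definition reversible :: "nat \<Rightarrow> nat \<Rightarrow> (nat set \<Rightarrow> nat set) \<Rightarrow> bool" where
  "reversible m k \<pi> \<longleftrightarrow> bij \<pi> \<and> circuit m k (\<lambda>\<psi> s. \<psi> (\<pi> s)) \<and> circuit m k (\<lambda>\<psi> s. \<psi> (inv \<pi> s))"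

lemma reversible_comp:
  assumes "reversible m k \<pi>" "reversible m l \<rho>"
  shows "reversible m (k + l) (\<pi> \<circ> \<rho>)"
proof -
  have b: "bij \<pi>" "bij \<rho>" using assms by (simp_all add: reversible_def)
  have "circuit m (k + l) (\<lambda>\<psi> s. \<psi> ((\<pi> \<circ> \<rho>) s))"
    using circuit_comp[of m k "\<lambda>\<psi> s. \<psi> (\<pi> s)" l "\<lambda>\<psi> s. \<psi> (\<rho> s)"] assms
    by (simp add: reversible_def)
  moreover have "circuit m (k + l) (\<lambda>\<psi> s. \<psi> (inv (\<pi> \<circ> \<rho>) s))"
    using circuit_comp[of m l "\<lambda>\<psi> s. \<psi> (inv \<rho> s)" k "\<lambda>\<psi> s. \<psi> (inv \<pi> s)"] assms
    by (simp add: reversible_def o_inv_distrib b add.commute)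
  ultimately show ?thesis using b by (simp add: reversible_def bij_comp)
qed

lemma reversible_inv: "reversible m k \<pi> \<Longrightarrow> reversible m k (inv \<pi>)"
  by (simp add: reversible_def bij_imp_bij_inv inv_inv_eq)

lemma reversible_mono: "reversible m k \<pi> \<Longrightarrow> k \<le> l \<Longrightarrow> reversible m l \<pi>"
  unfolding reversible_def by (auto intro: circuit_mono)

lemma reversible_involution:
  assumes "circuit m k (\<lambda>\<psi> s. \<psi> (\<pi> s))" "\<And>s. \<pi> (\<pi> s) = s"
  shows "reversible m k \<pi>"
proof -
  have "bij \<pi>" using assms(2) by (rule involuntory_imp_bij)
  moreover have "inv \<pi> = \<pi>" using assms(2) by (intro inv_equality)
  ultimately show ?thesis using assms(1) by (simp add: reversible_def)
qed

lemma reversible_id: "reversible m 0 (\<lambda>s. s)"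
  by (rule reversible_involution[OF circuit_id]) simp

definition toggle :: "nat \<Rightarrow> (nat set \<Rightarrow> bool) \<Rightarrow> nat set \<Rightarrow> nat set" where
  "toggle t P s = (if P s then sym_diff s {t} else s)"

definition ignores :: "(nat set \<Rightarrow> bool) \<Rightarrow> nat \<Rightarrow> bool" where
  "ignores P t \<longleftrightarrow> (\<forall>s. P (sym_diff s {t}) = P s)"

lemma toggle_involution: "ignores P t \<Longrightarrow> toggle t P (toggle t P s) = s"
  by (auto simp: toggle_def ignores_def)

lemma toggle_comp:
  "ignores P t \<Longrightarrow> toggle t P \<circ> toggle t R = toggle t (\<lambda>s. P s \<noteq> R s)"
  by (rule ext) (auto simp: toggle_def ignores_def)

lemma controlled_not:
  "controlled P t (matrix2 0 1 1 0) = (\<lambda>\<psi> s. \<psi> (toggle t P s))"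
proof (rule ext, rule ext)
  fix \<psi> s
  have "set_bit_to t (t \<notin> s) s = sym_diff s {t}" by (auto simp: set_bit_to_def)
  then show "controlled P t (matrix2 0 1 1 0) \<psi> s = \<psi> (toggle t P s)"
    unfolding controlled_def sum_bool[of _ "t \<in> s"] by (simp add: matrix2_def toggle_def)
qed

lemma reversible_toggle2:
  assumes "a < m" "b < m" "t < m" "a \<noteq> b" "a \<noteq> t" "b \<noteq> t"
  shows "reversible m 1 (toggle t (\<lambda>s. a \<in> s \<and> b \<in> s))"
proof (rule reversible_involution)
  have "unitary2 (matrix2 0 1 1 0)" by (simp add: unitary2_matrix2)
  from circuit_controlled2[OF assms this, of True True]
  show "circuit m 1 (\<lambda>\<psi> s. \<psi> (toggle t (\<lambda>s. a \<in> s \<and> b \<in> s) s))"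
    by (simp add: controlled_not)
qed (use assms in \<open>auto intro!: toggle_involution simp: ignores_def\<close>)

lemma reversible_toggle1:
  assumes "m \<ge> 3" "a < m" "t < m" "a \<noteq> t"
  shows "reversible m 2 (toggle t (\<lambda>s. a \<in> s))"
proof (rule reversible_involution)
  have "unitary2 (matrix2 0 1 1 0)" by (simp add: unitary2_matrix2)
  from circuit_controlled1[OF assms this, of True]
  show "circuit m 2 (\<lambda>\<psi> s. \<psi> (toggle t (\<lambda>s. a \<in> s) s))"
    by (simp add: controlled_not)
qed (use assms in \<open>auto intro!: toggle_involution simp: ignores_def\<close>)

lemma reversible_toggle0:
  assumes "m \<ge> 3" "t < m"
  shows "reversible m 4 (toggle t (\<lambda>_. True))"
proof (rule reversible_involution)
  have "unitary2 (matrix2 0 1 1 0)" by (simp add: unitary2_matrix2)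
  from circuit_controlled0[OF assms this]
  show "circuit m 4 (\<lambda>\<psi> s. \<psi> (toggle t (\<lambda>_. True) s))"
    by (simp add: controlled_not)
qed (auto intro!: toggle_involution simp: ignores_def)

text \<open>A swap is a product of three controlled nots; the control \<open>c\<close> on each of
  them makes three doubly-controlled gates.\<close>

lemma reversible_controlled_swap:
  assumes "c < m" "x < m" "z < m" "c \<noteq> x" "c \<noteq> z" "x \<noteq> z"
  shows "reversible m 3 (\<lambda>s. if c \<in> s then Transposition.transpose x z ` s else s)"
proof -
  have mem: "r \<in> Transposition.transpose x z ` s \<longleftrightarrow> Transposition.transpose x z r \<in> s" for r s
    by (metis image_iff transpose_involutory)
  have "toggle z (\<lambda>s. c \<in> s \<and> x \<in> s) \<circ> toggle x (\<lambda>s. c \<in> s \<and> z \<in> s) \<circ> toggle z (\<lambda>s. c \<in> s \<and> x \<in> s) =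
    (\<lambda>s. if c \<in> s then Transposition.transpose x z ` s else s)"
  proof (rule ext, rule set_eqI)
    fix s r
    show "r \<in> (toggle z (\<lambda>s. c \<in> s \<and> x \<in> s) \<circ> toggle x (\<lambda>s. c \<in> s \<and> z \<in> s) \<circ>
        toggle z (\<lambda>s. c \<in> s \<and> x \<in> s)) s \<longleftrightarrow>
      r \<in> (if c \<in> s then Transposition.transpose x z ` s else s)"
      using assms(4-6)
      by (cases "c \<in> s"; cases "x \<in> s"; cases "z \<in> s"; cases "r = x"; cases "r = z")
         (simp_all add: toggle_def mem)
  qed
  moreover have "reversible m (1 + 1 + 1) (toggle z (\<lambda>s. c \<in> s \<and> x \<in> s) \<circ>
      toggle x (\<lambda>s. c \<in> s \<and> z \<in> s) \<circ> toggle z (\<lambda>s. c \<in> s \<and> x \<in> s))"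
    using assms by (intro reversible_comp reversible_toggle2) auto
  ultimately show ?thesis by (simp add: numeral_3_eq_3)
qed

section \<open>Cyclic shifts controlled by a weight\<close>

lemma bij_fixed_mem_image_iff: "bij \<rho> \<Longrightarrow> \<rho> r = r \<Longrightarrow> r \<in> \<rho> ` s \<longleftrightarrow> r \<in> s"
  by (metis bij_is_inj inj_image_mem_iff)

text \<open>For injective \<open>d\<close> this is the cycle d 0 -> d 1 -> ... -> d n -> d 0.
  Written with \<open>n\<close> transpositions, it becomes \<open>n\<close> controlled swaps when a
  control is added.\<close>

fun shift_perm :: "(nat \<Rightarrow> nat) \<Rightarrow> nat \<Rightarrow> nat \<Rightarrow> nat" where
  "shift_perm d 0 = id"
| "shift_perm d (Suc n) = Transposition.transpose (d 0) (d (Suc n)) \<circ> shift_perm d n"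

lemma bij_shift_perm: "bij (shift_perm d n)"
  by (induction n) (simp_all only: shift_perm.simps bij_id bij_comp bij_transpose)

lemma shift_perm_fixed: "r \<notin> d ` {..n} \<Longrightarrow> shift_perm d n r = r"
proof (induction n)
  case (Suc n)
  then have "r \<notin> d ` {..n}" "r \<noteq> d 0" "r \<noteq> d (Suc n)" by auto
  then show ?case using Suc.IH by simp
qed simp

lemma shift_perm_step:
  assumes "inj_on d {..n}" "k < n"
  shows "shift_perm d n (d k) = d (Suc k)"
  using assms
proof (induction n)
  case (Suc n)
  have inj: "inj_on d {..n}" using Suc.prems(1) by (rule inj_on_subset) auto
  have ne: "d (Suc j) \<noteq> d 0" "j < n \<Longrightarrow> d (Suc j) \<noteq> d (Suc n)" if "j \<le> n" for j
    using Suc.prems(1) that by (auto simp: inj_on_def)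
  \<comment> \<open>The cycle built so far sends its end back to \<open>d 0\<close>; the next
    transposition redirects it to the new end.\<close>
  have last: "shift_perm d j (d j) = d 0" if "j \<le> n" for j
    using that
  proof (induction j)
    case (Suc j)
    have "d (Suc j) \<notin> d ` {..j}"
      using Suc.prems by (auto dest!: inj_onD[OF inj])
    then show ?case by (simp add: shift_perm_fixed)
  qed simp
  show ?case
  proof (cases "k = n")
    case True
    then show ?thesis using last[of n] by simp
  next
    case False
    then have "shift_perm d n (d k) = d (Suc k)" using Suc inj by simp
    then show ?thesis using ne[of k] False Suc.prems(2) by simp
  qed
qed simp

lemma shift_perm_power:
  "inj_on d {..n} \<Longrightarrow> k \<le> n \<Longrightarrow> (shift_perm d n ^^ k) (d 0) = d k"
  by (induction k) (simp_all add: shift_perm_step)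

lemma reversible_controlled_shift:
  assumes "inj_on d {..n}" "d ` {..n} \<subseteq> {..<m}" "c < m" "c \<notin> d ` {..n}"
  shows "reversible m (3 * n) (\<lambda>s. if c \<in> s then shift_perm d n ` s else s)"
  using assms
proof (induction n)
  case 0
  then show ?case using reversible_id by (simp cong: if_cong)
next
  case (Suc n)
  let ?\<tau> = "Transposition.transpose (d 0) (d (Suc n))"
  have c: "c \<noteq> d 0" "c \<noteq> d (Suc n)" "c \<notin> d ` {..n}" using Suc.prems(4) by auto
  have d: "d 0 < m" "d (Suc n) < m" "d 0 \<noteq> d (Suc n)"
    using Suc.prems by (auto simp: inj_on_def)
  have "inj_on d {..n}" using Suc.prems(1) by (rule inj_on_subset) auto
  then have IH: "reversible m (3 * n) (\<lambda>s. if c \<in> s then shift_perm d n ` s else s)"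
    using Suc.prems(2,3) c(3) by (intro Suc.IH) (auto simp: image_subset_iff)
  have "reversible m (3 + 3 * n)
      ((\<lambda>s. if c \<in> s then ?\<tau> ` s else s) \<circ> (\<lambda>s. if c \<in> s then shift_perm d n ` s else s))"
    using Suc.prems c d by (intro reversible_comp IH reversible_controlled_swap) auto
  moreover have "c \<in> shift_perm d n ` s \<longleftrightarrow> c \<in> s" for s
    using c by (intro bij_fixed_mem_image_iff bij_shift_perm shift_perm_fixed)
  then have "(\<lambda>s. if c \<in> s then ?\<tau> ` s else s) \<circ> (\<lambda>s. if c \<in> s then shift_perm d n ` s else s) =
      (\<lambda>s. if c \<in> s then shift_perm d (Suc n) ` s else s)"
    by (auto simp: fun_eq_iff image_comp)
  ultimately show ?case by simp
qed

lemma shift_perm_power_fixed: "r \<notin> d ` {..n} \<Longrightarrow> (shift_perm d n ^^ k) r = r"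
  by (induction k) (simp_all add: shift_perm_fixed)

text \<open>Every qubit of \<open>C\<close> that is 1 triggers one shift, so the weight appears as
  the number of shifts and is never written down. The controls lie off the cycle and stay in
  place.\<close>

lemma reversible_counting_shift:
  assumes "inj_on d {..n}" "d ` {..n} \<subseteq> {..<m}" and "finite C" "C \<subseteq> {..<m}" "C \<inter> d ` {..n} = {}"
  shows "reversible m (3 * n * card C) (\<lambda>s. (shift_perm d n ^^ card (s \<inter> C)) ` s)"
  using assms(3-5)
proof (induction C rule: finite_induct)
  case empty
  then show ?case using reversible_id by simp
next
  case (insert c C)
  let ?\<rho> = "shift_perm d n"
  have c: "c < m" "c \<notin> d ` {..n}" using insert.prems by auto
  have mem: "c \<in> (?\<rho> ^^ k) ` s \<longleftrightarrow> c \<in> s" for k s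
    using c by (intro bij_fixed_mem_image_iff bij_fn bij_shift_perm shift_perm_power_fixed)
  have "reversible m (3 * n + 3 * n * card C)
     ((\<lambda>s. if c \<in> s then ?\<rho> ` s else s) \<circ> (\<lambda>s. (?\<rho> ^^ card (s \<inter> C)) ` s))"
    using insert c by (intro reversible_comp reversible_controlled_shift assms(1,2) insert.IH) auto
  moreover have "((\<lambda>s. if c \<in> s then ?\<rho> ` s else s) \<circ> (\<lambda>s. (?\<rho> ^^ card (s \<inter> C)) ` s)) s =
     (?\<rho> ^^ card (s \<inter> insert c C)) ` s" for s
  proof (cases "c \<in> s")
    case True
    then have "card (s \<inter> insert c C) = Suc (card (s \<inter> C))" using insert.hyps by simp
    then show ?thesis using True by (simp add: mem image_comp)
  qed (simp add: mem)
  ultimately show ?case using insert.hyps by (simp add: fun_eq_iff comp_def)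
qed

lemma reversible_toggle_parity:
  assumes "m \<ge> 3" "a < m" "finite Y" "Y \<subseteq> {..<m}" "a \<notin> Y"
  shows "reversible m (2 * card Y) (toggle a (\<lambda>s. odd (card (s \<inter> Y))))"
  using assms(3-5)
proof (induction Y rule: finite_induct)
  case empty
  then show ?case using reversible_id by (simp add: toggle_def[abs_def])
next
  case (insert x Y)
  have "reversible m (2 + 2 * card Y) (toggle a (\<lambda>s. x \<in> s) \<circ> toggle a (\<lambda>s. odd (card (s \<inter> Y))))"
    using insert assms(1,2) by (intro reversible_comp reversible_toggle1) auto
  also have "toggle a (\<lambda>s. x \<in> s) \<circ> toggle a (\<lambda>s. odd (card (s \<inter> Y))) =
      toggle a (\<lambda>s. (x \<in> s) \<noteq> odd (card (s \<inter> Y)))"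
    using insert.prems by (intro toggle_comp) (auto simp: ignores_def)
  also have "(\<lambda>s. (x \<in> s) \<noteq> odd (card (s \<inter> Y))) = (\<lambda>s. odd (card (s \<inter> insert x Y)))"
    using insert.hyps by (auto simp: fun_eq_iff Int_insert_right)
  finally show ?case using insert.hyps by simp
qed

text \<open>
  The borrowed qubits \<open>d 0, \<dots>, d n\<close> may be in any state. Shifting them cyclically by the weight \<open>w\<close> of
  \<open>s\<close> on \<open>S\<close> and adding the parity of the positions in \<open>K\<close> to the ancilla is linear in their bits;
  doing it once more after flipping \<open>d 0\<close> leaves only the contribution of \<open>d w\<close>, which is \<open>1\<close> iff
  \<open>w \<in> K\<close>.
\<close>

lemma reversible_symmetric_function:
  assumes m: "m \<ge> 3" and S: "S \<subseteq> {..<m}" "card S = n" and a: "a < m" "a \<notin> S"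
    and d: "inj_on d {..n}" "d ` {..n} \<subseteq> {..<m} - S - {a}" and K: "K \<subseteq> {..n}"
  shows "reversible m (12 * n\<^sup>2 + 4 * n + 12) (toggle a (\<lambda>s. card (s \<inter> S) \<in> K))"
proof -
  let ?\<rho> = "shift_perm d n"
  let ?w = "\<lambda>s. card (s \<inter> S)"
  define \<sigma> where "\<sigma> s = (?\<rho> ^^ ?w s) ` s" for s
  define f where "f s \<longleftrightarrow> odd (card (\<sigma> s \<inter> d ` K))" for s
  let ?\<chi> = "toggle a (\<lambda>s. odd (card (s \<inter> d ` K)))"
  let ?\<phi> = "toggle (d 0) (\<lambda>_. True)"
  have fS: "finite S" using S(1) finite_subset by blast
  have fK: "finite K" using K finite_subset by blast
  have dK: "d ` K \<subseteq> d ` {..n}" using K by blast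
  have a': "a \<notin> d ` {..n}" "a \<notin> d ` K" using d(2) dK by blast+
  have dKm: "d ` K \<subseteq> {..<m}" using d(2) dK by blast
  have d0: "d 0 < m" "d 0 \<notin> S" using d(2) by auto
  have \<sigma>: "reversible m (3 * n * n) \<sigma>"
    unfolding \<sigma>_def[abs_def]
    by (rule reversible_counting_shift[OF d(1) _ fS S(1), unfolded S(2)]) (use d(2) in auto)
  then have bij: "bij \<sigma>" by (simp add: reversible_def)
  have inj: "inj (?\<rho> ^^ k)" for k by (intro bij_is_inj bij_fn bij_shift_perm)
  \<comment> \<open>A flip outside \<open>S\<close> does not change the weight and is merely carried
    along by the shift. This is the linearity in the borrowed bits.\<close>
  have \<sigma>_flip: "\<sigma> (sym_diff s {r}) = sym_diff (\<sigma> s) {(?\<rho> ^^ ?w s) r}" if "r \<notin> S" for r s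
  proof -
    have "sym_diff s {r} \<inter> S = s \<inter> S" using that by auto
    then show ?thesis unfolding \<sigma>_def by (simp add: image_Un image_set_diff[OF inj])
  qed
  have \<sigma>_a: "\<sigma> (sym_diff s {a}) = sym_diff (\<sigma> s) {a}" for s
    using \<sigma>_flip[OF a(2)] shift_perm_power_fixed[OF a'(1)] by simp
  have f_a: "f (sym_diff s {a}) = f s" for s
  proof -
    have "sym_diff (\<sigma> s) {a} \<inter> d ` K = \<sigma> s \<inter> d ` K" using a'(2) by blast
    then show ?thesis unfolding f_def \<sigma>_a by simp
  qed
  have f_d: "f (sym_diff s {d 0}) \<longleftrightarrow> f s \<noteq> (?w s \<in> K)" for s
  proof -
    have w: "?w s \<le> n" using fS S(2) card_mono[of S "s \<inter> S"] by auto
    have eq: "\<sigma> (sym_diff s {d 0}) = sym_diff (\<sigma> s) {d (?w s)}"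
      using \<sigma>_flip[OF d0(2)] shift_perm_power[OF d(1) w] by simp
    have "d (?w s) \<in> d ` K \<longleftrightarrow> ?w s \<in> K"
      using inj_on_image_mem_iff[OF d(1), of "?w s" K] K w by simp
    then have "odd (card ({d (?w s)} \<inter> d ` K)) \<longleftrightarrow> ?w s \<in> K" by auto
    then show ?thesis
      unfolding f_def eq using odd_card_sym_diff_Int[of "d ` K" "\<sigma> s" "{d (?w s)}"] fK by simp
  qed
  \<comment> \<open>The ancilla lies outside \<open>S\<close> and the cycle, so the shift commutes
    with flipping it. Undoing the shift restores the borrowed qubits, while the ancilla has received
    \<open>f\<close>, which still depends on their contents.\<close>
  have \<Omega>: "inv \<sigma> \<circ> ?\<chi> \<circ> \<sigma> = toggle a f"
  proof
    fix s
    have "?\<chi> (\<sigma> s) = \<sigma> (toggle a f s)" by (simp add: toggle_def f_def \<sigma>_a)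
    then show "(inv \<sigma> \<circ> ?\<chi> \<circ> \<sigma>) s = toggle a f s"
      using bij by (simp add: bij_is_inj)
  qed
  have "reversible m (3 * n * n + 2 * card (d ` K) + 3 * n * n) (inv \<sigma> \<circ> ?\<chi> \<circ> \<sigma>)"
    using m a(1) a'(2) fK dKm
    by (intro reversible_comp reversible_toggle_parity reversible_inv \<sigma>) simp_all
  moreover have "card (d ` K) \<le> Suc n"
    using card_image_le[OF fK, of d] card_mono[OF _ K] by simp
  ultimately have \<Omega>_rev: "reversible m (6 * n * n + 2 * n + 2) (toggle a f)"
    unfolding \<Omega> by (elim reversible_mono) simp
  have "toggle a f \<circ> ?\<phi> \<circ> toggle a f \<circ> ?\<phi> = toggle a (\<lambda>s. ?w s \<in> K)"
  proof
    fix s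
    have fl: "?\<phi> s = sym_diff s {d 0}" for s by (simp add: toggle_def)
    have comm: "sym_diff (sym_diff (sym_diff s {d 0}) {a}) {d 0} = sym_diff s {a}"
      "sym_diff (sym_diff s {d 0}) {d 0} = s" "sym_diff (sym_diff s {a}) {a} = s" by auto
    show "(toggle a f \<circ> ?\<phi> \<circ> toggle a f \<circ> ?\<phi>) s = toggle a (\<lambda>s. ?w s \<in> K) s"
    proof (cases "f (sym_diff s {d 0})")
      case True
      then have "(toggle a f \<circ> ?\<phi> \<circ> toggle a f \<circ> ?\<phi>) s = toggle a f (sym_diff s {a})"
        unfolding comp_apply fl toggle_def[of a f "sym_diff s {d 0}"] by (simp only: if_True comm)
      also have "\<dots> = toggle a (\<lambda>s. ?w s \<in> K) s"
        using True unfolding toggle_def f_a f_d comm by auto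
      finally show ?thesis .
    next
      case False
      then have "(toggle a f \<circ> ?\<phi> \<circ> toggle a f \<circ> ?\<phi>) s = toggle a f s"
        unfolding comp_apply fl toggle_def[of a f "sym_diff s {d 0}"] by (simp only: if_False comm)
      also have "\<dots> = toggle a (\<lambda>s. ?w s \<in> K) s"
        using False unfolding toggle_def f_d by auto
      finally show ?thesis .
    qed
  qed
  moreover have "reversible m (6 * n * n + 2 * n + 2 + 4 + (6 * n * n + 2 * n + 2) + 4)
      (toggle a f \<circ> ?\<phi> \<circ> toggle a f \<circ> ?\<phi>)"
    using m d0 by (intro reversible_comp \<Omega>_rev reversible_toggle0)
  ultimately show ?thesis
    by (simp add: power2_eq_square algebra_simps)
qed

text \<open>Toggles of the same target add up modulo 2, so the predicates are written to
  \<open>a\<close> one after the other, without scratch space for the sum.\<close>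

lemma reversible_toggle_parity_of:
  assumes "finite B" "\<And>i. i \<in> B \<Longrightarrow> reversible m k (toggle a (P i))" "\<And>i. i \<in> B \<Longrightarrow> ignores (P i) a"
  shows "reversible m (card B * k) (toggle a (\<lambda>s. odd (card {i\<in>B. P i s})))"
  using assms
proof (induction B rule: finite_induct)
  case empty
  then show ?case using reversible_id by (simp add: toggle_def[abs_def])
next
  case (insert i B)
  have "reversible m (k + card B * k) (toggle a (P i) \<circ> toggle a (\<lambda>s. odd (card {j\<in>B. P j s})))"
    using insert by (intro reversible_comp) auto
  also have "toggle a (P i) \<circ> toggle a (\<lambda>s. odd (card {j\<in>B. P j s})) =
      toggle a (\<lambda>s. P i s \<noteq> odd (card {j\<in>B. P j s}))"
    using insert.prems by (intro toggle_comp) auto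
  also have "(\<lambda>s. P i s \<noteq> odd (card {j\<in>B. P j s})) = (\<lambda>s. odd (card {j\<in>insert i B. P j s}))"
  proof
    fix s
    have "{j\<in>insert i B. P j s} = (if P i s then insert i {j\<in>B. P j s} else {j\<in>B. P j s})" by auto
    then show "(P i s \<noteq> odd (card {j\<in>B. P j s})) = odd (card {j\<in>insert i B. P j s})"
      using insert.hyps by auto
  qed
  finally show ?case using insert.hyps by simp
qed

lemma reversible_fan_out:
  assumes "m \<ge> 3" "t < m" "finite T" "T \<subseteq> {..<m}" "t \<notin> T"
  shows "reversible m (2 * card T) (\<lambda>s. if t \<in> s then sym_diff s T else s)"
  using assms(3-5)
proof (induction T rule: finite_induct)
  case empty
  have "(\<lambda>s. if t \<in> s then sym_diff s {} else s) = (\<lambda>s. s)" by (simp add: fun_eq_iff)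
  then show ?case using reversible_id by simp
next
  case (insert x T)
  have "reversible m (2 + 2 * card T) (toggle x (\<lambda>s. t \<in> s) \<circ> (\<lambda>s. if t \<in> s then sym_diff s T else s))"
    using insert assms(1,2) by (intro reversible_comp reversible_toggle1) auto
  also have "toggle x (\<lambda>s. t \<in> s) \<circ> (\<lambda>s. if t \<in> s then sym_diff s T else s) =
      (\<lambda>s. if t \<in> s then sym_diff s (insert x T) else s)"
  proof
    fix s
    show "(toggle x (\<lambda>s. t \<in> s) \<circ> (\<lambda>s. if t \<in> s then sym_diff s T else s)) s =
        (if t \<in> s then sym_diff s (insert x T) else s)"
    proof (cases "t \<in> s")
      case True
      then have "t \<in> sym_diff s T" using insert.prems by auto
      moreover have "sym_diff (sym_diff s T) {x} = sym_diff s (insert x T)" using insert.hyps by auto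
      ultimately show ?thesis using True by (simp only: comp_apply toggle_def if_True)
    qed (simp add: toggle_def)
  qed
  finally show ?case using insert.hyps by simp
qed

subsection \<open>Gates controlled by a predicate\<close>

lemma basis_ket_involution:
  assumes "\<And>s. \<pi> (\<pi> s) = s"
  shows "(\<lambda>r. basis_ket s (\<pi> r)) = basis_ket (\<pi> s)"
proof
  fix r
  have "\<pi> r = s \<longleftrightarrow> r = \<pi> s" using assms by metis
  then show "basis_ket s (\<pi> r) = basis_ket (\<pi> s) r" by (simp add: basis_ket_def)
qed

lemma basis_ket_toggle:
  "ignores P t \<Longrightarrow> (\<lambda>r. basis_ket s (toggle t P r)) = basis_ket (toggle t P s)"
  by (intro basis_ket_involution toggle_involution)

lemma toggle_mem: "a \<notin> s \<Longrightarrow> a \<in> toggle a P s \<longleftrightarrow> P s"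
  by (simp add: toggle_def)

lemma toggle_mem_other: "t \<noteq> a \<Longrightarrow> t \<in> toggle a P s \<longleftrightarrow> t \<in> s"
  by (simp add: toggle_def)

text \<open>A gate that only multiplies the toggled basis state by a phase leaves it in place, so
  the second toggle clears the ancilla and the phase remains.\<close>

lemma circuit_conjugate:
  assumes "circuit m k C" "reversible m l (toggle a \<mu>)" "ignores \<mu> a"
    and "C (basis_ket (toggle a \<mu> s)) = (\<lambda>r. c * basis_ket (toggle a \<mu> s) r)"
  shows "(\<lambda>r. C (\<lambda>r. basis_ket s (toggle a \<mu> r)) (toggle a \<mu> r)) = (\<lambda>r. c * basis_ket s r)"
proof -
  have "basis_ket (toggle a \<mu> s) (toggle a \<mu> r) = basis_ket s r" for r
    using fun_cong[OF basis_ket_toggle[OF assms(3), of "toggle a \<mu> s"], of r]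
    by (simp add: toggle_involution[OF assms(3)])
  then show ?thesis unfolding basis_ket_toggle[OF assms(3)] assms(4) by simp
qed

lemma circuit_phase:
  assumes "m \<ge> 3" "a < m" "reversible m k (toggle a \<mu>)" "ignores \<mu> a"
    and "norm u = 1" "norm v = 1"
  shows "\<exists>A. circuit m (2 * k + 4) A \<and>
    (\<forall>s. a \<notin> s \<longrightarrow> A (basis_ket s) = (\<lambda>r. (if \<mu> s then v else u) * basis_ket s r))"
proof -
  let ?C = "controlled (\<lambda>_. True) a (matrix2 u 0 0 v)"
  have "cnj u * u = 1" "cnj v * v = 1"
    using complex_norm_square[of u] complex_norm_square[of v] assms(5,6) by (simp_all add: mult.commute)
  then have C: "circuit m 4 ?C"
    using assms(1,2) by (intro circuit_controlled0) (simp_all add: unitary2_matrix2)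
  let ?A = "\<lambda>\<psi> r. ?C (\<lambda>r. \<psi> (toggle a \<mu> r)) (toggle a \<mu> r)"
  have t: "circuit m k (\<lambda>\<psi> s. \<psi> (toggle a \<mu> s))" using assms(3) by (simp add: reversible_def)
  have "circuit m (k + 4 + k) ?A"
    by (rule circuit_comp[OF circuit_comp[OF t C] t])
  then have A: "circuit m (2 * k + 4) ?A" by (rule circuit_mono) simp
  have C_basis: "?C (basis_ket s) = (\<lambda>r. (if a \<in> s then v else u) * basis_ket s r)" for s
    by (subst controlled_basis_ket) (simp_all add: matrix2_def)
  have B: "?A (basis_ket s) = (\<lambda>r. (if \<mu> s then v else u) * basis_ket s r)" if "a \<notin> s" for s
    by (rule circuit_conjugate[OF C assms(3,4)]) (simp add: C_basis toggle_mem[OF that])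
  show ?thesis by (rule exI[of _ ?A], intro conjI allI impI) (rule A B; assumption)+
qed

lemma circuit_controlled_sign:
  assumes "m \<ge> 3" "a < m" "t < m" "a \<noteq> t" "reversible m k (toggle a \<mu>)" "ignores \<mu> a"
  shows "\<exists>A. circuit m (2 * k + 2) A \<and>
    (\<forall>s. a \<notin> s \<longrightarrow> A (basis_ket s) = (\<lambda>r. (if \<mu> s \<and> t \<in> s then -1 else 1) * basis_ket s r))"
proof -
  let ?C = "controlled (\<lambda>s. (a \<in> s) = True) t (matrix2 1 0 0 (-1))"
  have C: "circuit m 2 ?C"
    using assms(1-4) by (intro circuit_controlled1) (simp_all add: unitary2_matrix2)
  let ?A = "\<lambda>\<psi> r. ?C (\<lambda>r. \<psi> (toggle a \<mu> r)) (toggle a \<mu> r)"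
  have t: "circuit m k (\<lambda>\<psi> s. \<psi> (toggle a \<mu> s))" using assms(5) by (simp add: reversible_def)
  have "circuit m (k + 2 + k) ?A"
    by (rule circuit_comp[OF circuit_comp[OF t C] t])
  then have A: "circuit m (2 * k + 2) ?A" by (rule circuit_mono) simp
  have C_basis: "?C (basis_ket s) = (\<lambda>r. (if a \<in> s \<and> t \<in> s then -1 else 1) * basis_ket s r)" for s
    using assms(4) by (subst controlled_basis_ket) (auto simp: matrix2_def set_bit_to_def)
  have B: "?A (basis_ket s) = (\<lambda>r. (if \<mu> s \<and> t \<in> s then -1 else 1) * basis_ket s r)"
    if "a \<notin> s" for s
    using assms(4) by (intro circuit_conjugate[OF C assms(5,6)])
      (unfold C_basis, simp add: toggle_mem[OF that] toggle_mem_other)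
  show ?thesis by (rule exI[of _ ?A], intro conjI allI impI) (rule A B; assumption)+
qed

text \<open>
  The fan-out from the pivot \<open>t \<in> S\<close> turns a gate on the qubit \<open>t\<close> into one that mixes \<open>s\<close> with
  \<open>sym_diff s S\<close>. The ancilla can be reset afterwards because the two agree on \<open>\<nu>\<close>.
\<close>

lemma circuit_controlled_mixing:
  assumes "m \<ge> 3" "a < m" "S \<subseteq> {..<m}" "t \<in> S" "a \<notin> S" "unitary2 U"
    and "reversible m k (toggle a \<nu>)" "ignores \<nu> a"
  shows "\<exists>A. circuit m (2 * k + 4 * card S + 2) A \<and>
    (\<forall>s. a \<notin> s \<longrightarrow> \<nu> s \<noteq> u \<longrightarrow> A (basis_ket s) = basis_ket s) \<and>
    (\<forall>s. a \<notin> s \<longrightarrow> \<nu> s = u \<longrightarrow> \<nu> (sym_diff s S) = u \<longrightarrow> A (basis_ket s) =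
      (\<lambda>r. U $ (t \<in> s) $ (t \<in> s) * basis_ket s r +
           U $ (t \<notin> s) $ (t \<in> s) * basis_ket (sym_diff s S) r))"
proof -
  define T where "T = S - {t}"
  define \<phi> where "\<phi> s = (if t \<in> s then sym_diff s T else s)" for s
  let ?C = "controlled (\<lambda>s. (a \<in> s) = u) t U"
  let ?A = "\<lambda>\<psi> r. ?C (\<lambda>r. \<psi> (toggle a \<nu> (\<phi> r))) (\<phi> (toggle a \<nu> r))"
  have tm: "t < m" "a \<noteq> t" using assms by auto
  have fS: "finite S" using assms(3) finite_subset by blast
  have "reversible m (2 * card T) \<phi>"
    unfolding \<phi>_def[abs_def] using assms tm fS by (intro reversible_fan_out) (auto simp: T_def)
  then have fan: "circuit m (2 * card T) (\<lambda>\<psi> s. \<psi> (\<phi> s))" by (simp add: reversible_def)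
  have t: "circuit m k (\<lambda>\<psi> s. \<psi> (toggle a \<nu> s))" using assms(7) by (simp add: reversible_def)
  have C: "circuit m 2 ?C" using assms tm by (intro circuit_controlled1) auto
  have "circuit m (k + 2 * card T + 2 + 2 * card T + k) ?A"
    by (rule circuit_comp[OF circuit_comp[OF circuit_comp[OF circuit_comp[OF t fan] C] fan] t])
  moreover have "card T \<le> card S" unfolding T_def using fS by (intro card_mono) auto
  ultimately have A: "circuit m (2 * k + 4 * card S + 2) ?A"
    by (elim circuit_mono) simp
  have tT: "t \<notin> T" "a \<notin> T" using assms by (auto simp: T_def)
  have \<phi>\<phi>: "\<phi> (\<phi> s) = s" for s using tT by (auto simp: \<phi>_def)
  have \<phi>_mem: "a \<in> \<phi> s \<longleftrightarrow> a \<in> s" "t \<in> \<phi> s \<longleftrightarrow> t \<in> s" for s using tT by (auto simp: \<phi>_def)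
  \<comment> \<open>Exactly one of the two fan-outs acts, the one before or the one after the flip
    of the pivot, whichever value the pivot had.\<close>
  have mix: "\<phi> (sym_diff (\<phi> s) {t}) = sym_diff s S" for s
    using assms(4) by (auto simp: \<phi>_def T_def)
  have step: "(\<lambda>r. basis_ket s (toggle a \<nu> (\<phi> r))) = basis_ket (\<phi> (toggle a \<nu> s))"
    "(\<lambda>r. basis_ket s (\<phi> (toggle a \<nu> r))) = basis_ket (toggle a \<nu> (\<phi> s))" for s
    using basis_ket_involution[of \<phi>, OF \<phi>\<phi>] basis_ket_toggle[OF assms(8)]
    by (simp_all add: fun_eq_iff)
  have C_basis: "?C (basis_ket s) =
    (if (a \<in> s) = u then \<lambda>r. U $ (t \<in> s) $ (t \<in> s) * basis_ket s r
                  + U $ (t \<notin> s) $ (t \<in> s) * basis_ket (sym_diff s {t}) r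
     else basis_ket s)" for s
    using tm by (intro controlled_basis_ket) (simp add: set_bit_to_def)
  have undo: "toggle a \<nu> (\<phi> (\<phi> (toggle a \<nu> s))) = s" for s
    by (simp add: \<phi>\<phi> toggle_involution[OF assms(8)])
  have ign: "\<nu> (sym_diff s {a}) = \<nu> s" for s using assms(8) by (simp add: ignores_def)
  have B: "?A (basis_ket s) = basis_ket s" if "a \<notin> s" "\<nu> s \<noteq> u" for s
  proof -
    have "?C (basis_ket (\<phi> (toggle a \<nu> s))) = basis_ket (\<phi> (toggle a \<nu> s))"
      unfolding C_basis using that by (simp add: \<phi>_mem toggle_mem)
    then show ?thesis unfolding step by (simp add: step undo)
  qed
  have B': "?A (basis_ket s) =
      (\<lambda>r. U $ (t \<in> s) $ (t \<in> s) * basis_ket s r +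
           U $ (t \<notin> s) $ (t \<in> s) * basis_ket (sym_diff s S) r)"
    if "a \<notin> s" "\<nu> s = u" "\<nu> (sym_diff s S) = u" for s
  proof -
    let ?s = "\<phi> (toggle a \<nu> s)"
    have "sym_diff (sym_diff (sym_diff s {a}) S) {a} = sym_diff s S" by auto
    moreover have "sym_diff (sym_diff s {a}) S = sym_diff (sym_diff s S) {a}" by auto
    ultimately have "toggle a \<nu> (sym_diff (toggle a \<nu> s) S) = sym_diff s S"
      unfolding toggle_def using that ign[of "sym_diff s S"] by (cases u) (simp_all only: if_True if_False)
    then have mixed: "toggle a \<nu> (\<phi> (sym_diff ?s {t})) = sym_diff s S" unfolding mix .
    have eq: "?C (basis_ket ?s) = (\<lambda>r. U $ (t \<in> s) $ (t \<in> s) * basis_ket ?s r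
                  + U $ (t \<notin> s) $ (t \<in> s) * basis_ket (sym_diff ?s {t}) r)"
      unfolding C_basis using that tm by (simp add: \<phi>_mem toggle_mem toggle_mem_other)
    have st: "basis_ket s' (\<phi> (toggle a \<nu> r)) = basis_ket (toggle a \<nu> (\<phi> s')) r" for s' r
      using fun_cong[OF step(2)] .
    show ?thesis unfolding step(1) eq unfolding st mixed undo ..
  qed
  show ?thesis by (rule exI[of _ ?A], intro conjI allI impI) (rule A B B'; assumption)+
qed

text \<open>
  Conjugating by the sign \<open>(-1)\<close> on \<open>\<mu> s \<and> t \<in> s\<close> multiplies the off-diagonal entries between \<open>s\<close> and
  \<open>sym_diff s S\<close> by the sign of \<open>\<mu>\<close> at the one that contains the pivot \<open>t\<close>.
\<close>

lemma circuit_signed_mixing: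
  assumes "m \<ge> 3" "a < m" "S \<subseteq> {..<m}" "t \<in> S" "a \<notin> S" "unitary2 U"
    and "reversible m k (toggle a \<mu>)" "ignores \<mu> a"
    and "reversible m l (toggle a \<nu>)" "ignores \<nu> a"
  defines "g \<equiv> \<lambda>s. if \<mu> s \<and> t \<in> s then -1 else 1"
  shows "\<exists>A. circuit m (4 * k + 2 * l + 4 * card S + 6) A \<and>
    (\<forall>s. a \<notin> s \<longrightarrow> \<nu> s \<noteq> u \<longrightarrow> A (basis_ket s) = basis_ket s) \<and>
    (\<forall>s. a \<notin> s \<longrightarrow> \<nu> s = u \<longrightarrow> \<nu> (sym_diff s S) = u \<longrightarrow> A (basis_ket s) =
      (\<lambda>r. U $ (t \<in> s) $ (t \<in> s) * basis_ket s r +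
           g s * g (sym_diff s S) * U $ (t \<notin> s) $ (t \<in> s) * basis_ket (sym_diff s S) r))"
proof -
  have tm: "t < m" "a \<noteq> t" using assms by auto
  obtain D where D: "circuit m (2 * k + 2) D"
    "\<And>s. a \<notin> s \<Longrightarrow> D (basis_ket s) = (\<lambda>r. g s * basis_ket s r)"
    using circuit_controlled_sign[OF assms(1,2) tm assms(7,8)] unfolding g_def by (elim exE conjE) simp
  obtain V where V: "circuit m (2 * l + 4 * card S + 2) V"
    "\<And>s. a \<notin> s \<Longrightarrow> \<nu> s \<noteq> u \<Longrightarrow> V (basis_ket s) = basis_ket s"
    "\<And>s. a \<notin> s \<Longrightarrow> \<nu> s = u \<Longrightarrow> \<nu> (sym_diff s S) = u \<Longrightarrow> V (basis_ket s) =
      (\<lambda>r. U $ (t \<in> s) $ (t \<in> s) * basis_ket s r +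
           U $ (t \<notin> s) $ (t \<in> s) * basis_ket (sym_diff s S) r)"
    using circuit_controlled_mixing[OF assms(1-6) assms(9,10), of u] by (elim exE conjE) simp
  let ?A = "\<lambda>\<psi>. D (V (D \<psi>))"
  have g: "g s * g s = 1" for s by (simp add: g_def)
  have "circuit m (2 * k + 2 + (2 * l + 4 * card S + 2) + (2 * k + 2)) ?A"
    by (intro circuit_comp D V)
  then have A: "circuit m (4 * k + 2 * l + 4 * card S + 6) ?A" by (rule circuit_mono) simp
  have B: "?A (basis_ket s) = basis_ket s" if "a \<notin> s" "\<nu> s \<noteq> u" for s
    by (simp add: D(2)[OF that(1)] V(2)[OF that] circuit_scale[OF V(1)] circuit_scale[OF D(1)] g
        flip: mult.assoc)
  have B': "?A (basis_ket s) = (\<lambda>r. U $ (t \<in> s) $ (t \<in> s) * basis_ket s r +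
           g s * g (sym_diff s S) * U $ (t \<notin> s) $ (t \<in> s) * basis_ket (sym_diff s S) r)"
    if "a \<notin> s" "\<nu> s = u" "\<nu> (sym_diff s S) = u" for s
  proof -
    have a: "a \<notin> sym_diff s S" using that(1) assms(5) by blast
    have "?A (basis_ket s) = (\<lambda>r. g s * (U $ (t \<in> s) $ (t \<in> s) * (g s * basis_ket s r) +
        U $ (t \<notin> s) $ (t \<in> s) * (g (sym_diff s S) * basis_ket (sym_diff s S) r)))"
      unfolding D(2)[OF that(1)] circuit_scale[OF V(1)] circuit_scale[OF D(1)] V(3)[OF that]
        circuit_add[OF D(1)] D(2)[OF a] ..
    also have "\<dots> = (\<lambda>r. g s * g s * U $ (t \<in> s) $ (t \<in> s) * basis_ket s r +
           g s * g (sym_diff s S) * U $ (t \<notin> s) $ (t \<in> s) * basis_ket (sym_diff s S) r)"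
      by (simp add: distrib_left mult_ac)
    finally show ?thesis unfolding g by simp
  qed
  show ?thesis by (rule exI[of _ ?A], intro conjI allI impI) (rule A B B'; assumption)+
qed

subsection \<open>Encoding of states and operators\<close>

lemma linear_ext_comp:
  assumes "\<And>b. b \<subseteq> {..<m} \<Longrightarrow> f b \<subseteq> {..<k}"
  shows "linear_ext k g (linear_ext m f \<psi>) = linear_ext m (\<lambda>b. g (f b)) \<psi>"
proof
  fix s
  have "linear_ext k g (linear_ext m f \<psi>) s =
    (\<Sum>c | c \<subseteq> {..<k} \<and> g c = s. \<Sum>b | b \<in> {b. b \<subseteq> {..<m} \<and> g (f b) = s} \<and> f b = c. \<psi> b)"
    unfolding linear_ext_def by (intro sum.cong) auto
  also have "\<dots> = (\<Sum>b | b \<subseteq> {..<m} \<and> g (f b) = s. \<psi> b)"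
    using assms by (intro sum.group) auto
  finally show "linear_ext k g (linear_ext m f \<psi>) s = linear_ext m (\<lambda>b. g (f b)) \<psi> s"
    by (simp add: linear_ext_def)
qed

lemma linear_ext_sum:
  "linear_ext m f (\<lambda>s. \<Sum>i\<in>I. c i * \<phi> i s) = (\<lambda>s. \<Sum>i\<in>I. c i * linear_ext m f (\<phi> i) s)"
proof
  fix s
  show "linear_ext m f (\<lambda>s. \<Sum>i\<in>I. c i * \<phi> i s) s = (\<Sum>i\<in>I. c i * linear_ext m f (\<phi> i) s)"
    unfolding linear_ext_def sum_distrib_left by (rule sum.swap)
qed

text \<open>The factor has to be readable from \<open>f b\<close> only on the support of \<psi>.
  Majorities are right only for bitstrings of bounded weight, so this restriction is essential for
  the encoded \<open>Z\<close>.\<close>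

lemma linear_ext_diagonal:
  assumes "\<And>b. b \<subseteq> {..<m} \<Longrightarrow> \<psi> b \<noteq> 0 \<Longrightarrow> g b = h (f b)"
  shows "linear_ext m f (\<lambda>b. g b * \<psi> b) = (\<lambda>s. h s * linear_ext m f \<psi> s)"
proof
  fix s
  have "g b * \<psi> b = h s * \<psi> b" if "b \<subseteq> {..<m}" "f b = s" for b
    using assms[of b] that by (cases "\<psi> b = 0") auto
  then show "linear_ext m f (\<lambda>b. g b * \<psi> b) s = h s * linear_ext m f \<psi> s"
    unfolding linear_ext_def sum_distrib_left by (intro sum.cong) auto
qed

lemma linear_ext_pauli_X:
  assumes "a \<subseteq> {..<m}" and f: "\<And>b. b \<subseteq> {..<m} \<Longrightarrow> f (sym_diff b a) = sym_diff (f b) a'"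
  shows "linear_ext m f (pauli_X a \<psi>) = pauli_X a' (linear_ext m f \<psi>)"
proof
  fix s
  have inv: "sym_diff (sym_diff x y) y = x" for x y :: "nat set" by auto
  have sub: "sym_diff b a \<subseteq> {..<m}" if "b \<subseteq> {..<m}" for b using that assms(1) by auto
  have "(\<Sum>b | b \<subseteq> {..<m} \<and> f b = s. \<psi> (sym_diff b a)) =
        (\<Sum>b | b \<subseteq> {..<m} \<and> f b = sym_diff s a'. \<psi> b)"
  proof (rule sum.reindex_bij_witness[of _ "\<lambda>b. sym_diff b a" "\<lambda>b. sym_diff b a"])
    fix b assume b: "b \<in> {b. b \<subseteq> {..<m} \<and> f b = s}"
    then have *: "b \<subseteq> {..<m}" "f b = s" by simp_all
    show "sym_diff b a \<in> {b. b \<subseteq> {..<m} \<and> f b = sym_diff s a'}"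
      using sub[OF *(1)] f[OF *(1)] unfolding *(2) by (intro CollectI conjI)
  next
    fix b assume b: "b \<in> {b. b \<subseteq> {..<m} \<and> f b = sym_diff s a'}"
    then have *: "b \<subseteq> {..<m}" "f b = sym_diff s a'" by simp_all
    show "sym_diff b a \<in> {b. b \<subseteq> {..<m} \<and> f b = s}"
      using sub[OF *(1)] f[OF *(1)] unfolding *(2) inv by (intro CollectI conjI)
  qed (simp_all only: inv)
  then show "linear_ext m f (pauli_X a \<psi>) s = pauli_X a' (linear_ext m f \<psi>) s"
    by (simp add: linear_ext_def pauli_X_def)
qed

lemma linear_ext_bk_pauli:
  assumes "bk_mask M X B" "Y \<subseteq> {..<M}"
  shows "linear_ext M (bk M) (pauli_X Y (pauli_Z X \<psi>)) =
         pauli_X (bk M Y) (pauli_Z B (linear_ext M (bk M) \<psi>))"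
proof -
  have "linear_ext M (bk M) (pauli_Z X \<psi>) = pauli_Z B (linear_ext M (bk M) \<psi>)"
    unfolding pauli_Z_eq using assms(1) by (intro linear_ext_diagonal) (simp add: bk_mask_def)
  moreover have "linear_ext M (bk M) (pauli_X Y (pauli_Z X \<psi>)) =
      pauli_X (bk M Y) (linear_ext M (bk M) (pauli_Z X \<psi>))"
    by (intro linear_ext_pauli_X assms bk_sym_diff)
  ultimately show ?thesis by simp
qed

lemma linear_ext_nonzero:
  assumes "linear_ext m f \<psi> s \<noteq> 0"
  obtains b where "b \<subseteq> {..<m}" "f b = s" "\<psi> b \<noteq> 0"
proof -
  obtain b where "b \<in> {b. b \<subseteq> {..<m} \<and> f b = s}" "\<psi> b \<noteq> 0"
    using assms unfolding linear_ext_def by (rule sum.not_neutral_contains_not_neutral)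
  then show ?thesis using that by auto
qed

lemma linear_ext_basis_kets:
  "linear_ext m f \<psi> = (\<lambda>s. \<Sum>b | b \<subseteq> {..<m}. \<psi> b * basis_ket (f b) s)"
proof
  fix s
  have "(\<Sum>b | b \<subseteq> {..<m}. \<psi> b * basis_ket (f b) s) =
    (\<Sum>b | b \<in> {b. b \<subseteq> {..<m}} \<and> f b = s. \<psi> b)"
    by (subst sum.inter_filter) (auto simp: basis_ket_def intro!: sum.cong)
  then show "linear_ext m f \<psi> s = (\<Sum>b | b \<subseteq> {..<m}. \<psi> b * basis_ket (f b) s)"
    by (simp add: linear_ext_def)
qed

subsection \<open>The code\<close>

text \<open>Lagrange's bound on the number of roots over the field of \<open>p\<close> elements,
  with integer polynomials and divisibility in place of residues. Synthetic division by a root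
  \<open>r\<close> lowers the degree, and every other root is a root of the quotient because
  \<open>p\<close> is prime and does not divide x - r.\<close>

lemma card_roots_mod_prime:
  fixes f :: "int poly" and p :: nat
  assumes "prime p" "degree f \<le> d" "d < card {x. x < p \<and> int p dvd poly f (int x)}"
  shows "int p dvd poly f z"
  using assms(2,3)
proof (induction d arbitrary: f z)
  case 0
  then obtain c where f: "f = [:c:]" by (auto elim: degree_eq_zeroE)
  have "{x. x < p \<and> int p dvd poly f (int x)} \<noteq> {}" using 0(2) by (metis card.empty less_irrefl)
  then show ?case using f by simp
next
  case (Suc d)
  let ?R = "\<lambda>f. {x. x < p \<and> int p dvd poly f (int x)}"
  have fin: "finite (?R g)" for g by simp
  have "?R f \<noteq> {}" using Suc.prems(2) by (metis card.empty not_less_zero)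
  then obtain r where r: "r < p" "int p dvd poly f (int r)" by auto
  let ?g = "synthetic_div f (int r)"
  have eq: "poly f x = (x - int r) * poly ?g x + poly f (int r)" for x
    using arg_cong[OF synthetic_div_correct'[of "int r" f], of "\<lambda>q. poly q x"]
    by (simp add: algebra_simps)
  have "?R f - {r} \<subseteq> ?R ?g"
  proof
    fix x assume x: "x \<in> ?R f - {r}"
    then have "int p dvd (int x - int r) * poly ?g (int x) + poly f (int r)"
      using eq[of "int x"] by simp
    then have "int p dvd (int x - int r) * poly ?g (int x)"
      using r(2) by (simp only: dvd_add_left_iff)
    moreover have "\<not> int p dvd int x - int r"
    proof
      assume "int p dvd int x - int r"
      then have "int x mod int p = int r mod int p" by (simp add: mod_eq_dvd_iff)
      then show False using x r by simp
    qed
    ultimately show "x \<in> ?R ?g"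
      using x assms(1) by (auto simp: prime_dvd_mult_iff)
  qed
  then have "card (?R f - {r}) \<le> card (?R ?g)" using fin by (rule card_mono[rotated])
  moreover have "card (?R f - {r}) = card (?R f) - 1" using r by simp
  ultimately have "d < card (?R ?g)" using Suc.prems(2) by linarith
  moreover have "degree ?g \<le> d" using Suc.prems(1) by (simp add: degree_synthetic_div)
  ultimately have "int p dvd poly ?g z" by (intro Suc.IH)
  then show ?case using r eq[of z] by simp
qed

text \<open>The difference has degree at most \<open>D\<close> and does not vanish modulo
  \<open>p\<close> at \<open>x0\<close>. As in \<open>code_polynomials\<close>, the polynomials are
  distinguished by a value, not by their coefficients.\<close>

lemma card_agreement_le:
  fixes a b :: "nat \<Rightarrow> nat"
  assumes "prime p" "x0 < p"
    and "(\<Sum>k\<le>D. a k * x0 ^ k) mod p \<noteq> (\<Sum>k\<le>D. b k * x0 ^ k) mod p"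
  shows "card {x. x < p \<and> (\<Sum>k\<le>D. a k * x ^ k) mod p = (\<Sum>k\<le>D. b k * x ^ k) mod p} \<le> D"
proof (rule ccontr)
  define f where "f = (\<Sum>k\<le>D. monom (int (a k) - int (b k)) k)"
  have f: "poly f (int x) = int (\<Sum>k\<le>D. a k * x ^ k) - int (\<Sum>k\<le>D. b k * x ^ k)" for x
    by (simp add: f_def poly_sum poly_monom left_diff_distrib sum_subtractf)
  have deg: "degree f \<le> D"
    unfolding f_def by (intro degree_sum_le order_trans[OF degree_monom_le]) auto
  have iff: "int p dvd poly f (int x) \<longleftrightarrow>
      (\<Sum>k\<le>D. a k * x ^ k) mod p = (\<Sum>k\<le>D. b k * x ^ k) mod p" for x
    unfolding f mod_eq_dvd_iff[symmetric] zmod_int[symmetric] of_nat_eq_iff ..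
  assume "\<not> ?thesis"
  then have "D < card {x. x < p \<and> int p dvd poly f (int x)}" unfolding iff by simp
  from card_roots_mod_prime[OF assms(1) deg this, of "int x0"] show False
    using assms(3) iff by simp
qed

text \<open>A witness for the minimum: any prime p above both \<open>code_L D F M\<close> and
  \<open>M\<close>, as p <= p^(D + 1).\<close>

lemma code_L'_properties:
  "prime (code_L' D F M) \<and> code_L D F M \<le> code_L' D F M \<and> M \<le> code_L' D F M ^ (D + 1)"
proof -
  obtain p where p: "prime p" "p > max (code_L D F M) M" using bigger_prime by blast
  have "p \<le> p ^ (D + 1)"
    using power_increasing[of 1 "D + 1" p] prime_gt_0_nat[OF p(1)] by simp
  then have "M \<le> p ^ (D + 1)" using p(2) by linarith
  then have "prime p \<and> code_L D F M \<le> p \<and> M \<le> p ^ (D + 1)" using p by simp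
  then show ?thesis unfolding code_L'_def by (rule LeastI)
qed

lemma prime_code_L': "prime (code_L' D F M)"
  and code_L_le_code_L': "code_L D F M \<le> code_L' D F M"
  using code_L'_properties by blast+

section \<open>Overlaps of codewords and majority decoding\<close>

locale degree_code =
  fixes D F M :: nat and y :: "nat \<Rightarrow> nat \<Rightarrow> nat"
  assumes D: "D \<ge> 1" and F: "F \<ge> 1" and M: "M \<ge> 1" and y: "code_polynomials D F M y"
begin

abbreviation "G \<equiv> code_G F M"
abbreviation "L \<equiv> code_L D F M"
abbreviation "L' \<equiv> code_L' D F M"
abbreviation "Q \<equiv> num_qubits D F M"
abbreviation "S \<equiv> codeword_support D F M y"
abbreviation "cw \<equiv> codeword D F M y"
abbreviation "maj i s \<equiv> card (S i) < 2 * card (s \<inter> S i)"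

lemma G_eq: "G = (F + 4) * bk_depth M"
  by (simp add: code_G_def bk_depth_def)

text \<open>The value 11 is attained at \<open>D = F = M = 1\<close>. The bound lets the square of
  \<open>L\<close> absorb lower-order terms and guarantees enough qubits outside \<open>S i\<close>
  to borrow.\<close>

lemma L_ge: "L \<ge> 11"
proof -
  have "5 * 1 \<le> G" unfolding G_eq using F bk_depth_ge_1[OF M] by (intro mult_le_mono) auto
  then have "2 * 1 * 5 \<le> 2 * D * G" using D by (intro mult_le_mono) auto
  then show ?thesis by (simp add: code_L_def)
qed

lemma L': "prime L'" "L \<le> L'"
  by (fact prime_code_L' code_L_le_code_L')+

lemma y_polynomial:
  "i < M \<Longrightarrow> \<exists>a :: nat \<Rightarrow> nat. \<forall>x<L'. y i x = (\<Sum>k\<le>D. a k * x ^ k) mod L'"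
  using y by (simp add: code_polynomials_def)

lemma y_less:
  assumes "i < M" "x < L'"
  shows "y i x < L'"
proof -
  obtain a where "\<forall>x<L'. y i x = (\<Sum>k\<le>D. a k * x ^ k) mod L'"
    using y_polynomial[OF assms(1)] by (elim exE)
  then show ?thesis using assms(2) L'(1) prime_gt_0_nat by simp
qed

lemma card_y_agree_le:
  assumes "i < M" "j < M" "i \<noteq> j"
  shows "card {x. x < L \<and> y i x = y j x} \<le> D"
proof -
  obtain a where a: "\<forall>x<L'. y i x = (\<Sum>k\<le>D. a k * x ^ k) mod L'"
    using y_polynomial[OF assms(1)] by (elim exE)
  obtain b where b: "\<forall>x<L'. y j x = (\<Sum>k\<le>D. b k * x ^ k) mod L'"
    using y_polynomial[OF assms(2)] by (elim exE)
  have "\<exists>x<L'. y i x \<noteq> y j x"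
    by (rule y[unfolded code_polynomials_def, THEN conjunct2, rule_format, OF assms])
  then obtain x0 where x0: "x0 < L'" "y i x0 \<noteq> y j x0" by (elim exE conjE)
  let ?A = "{x. x < L' \<and> (\<Sum>k\<le>D. a k * x ^ k) mod L' = (\<Sum>k\<le>D. b k * x ^ k) mod L'}"
  have "{x. x < L \<and> y i x = y j x} \<subseteq> ?A"
  proof
    fix x assume "x \<in> {x. x < L \<and> y i x = y j x}"
    then have x: "x < L'" "y i x = y j x" using L'(2) by auto
    then show "x \<in> ?A" using a[rule_format, OF x(1)] b[rule_format, OF x(1)] by simp
  qed
  then have "card {x. x < L \<and> y i x = y j x} \<le> card ?A"
    by (intro card_mono) simp_all
  also have "\<dots> \<le> D"
    using x0(2) a[rule_format, OF x0(1)] b[rule_format, OF x0(1)]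
    by (intro card_agreement_le[OF L'(1) x0(1)]) simp
  finally show ?thesis .
qed

lemma position_inject:
  assumes "i < M" "j < M" "x < L" "x' < L" "x * L' + y i x = x' * L' + y j x'"
  shows "x = x' \<and> y i x = y j x"
proof -
  have "y i x < L'" "y j x' < L'" using assms L'(2) by (auto intro!: y_less)
  then have "x = (x * L' + y i x) div L'" "x' = (x' * L' + y j x') div L'" by simp_all
  then show ?thesis using assms(5) by simp
qed

lemma finite_S [simp]: "finite (S i)"
  by (simp add: codeword_support_def)

lemma card_S: "i < M \<Longrightarrow> card (S i) = L"
  unfolding codeword_support_def
  by (subst card_image) (auto intro!: inj_onI dest: position_inject)

lemma S_subset: "i < M \<Longrightarrow> S i \<subseteq> {..<Q}"
proof
  fix r assume "i < M" "r \<in> S i"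
  then obtain x where x: "x < L" "r = x * L' + y i x" by (auto simp: codeword_support_def)
  have "y i x < L'" using x \<open>i < M\<close> L'(2) by (intro y_less) auto
  then have "r < Suc x * L'" using x by simp
  also have "\<dots> \<le> L * L'" using x by (intro mult_le_mono) auto
  finally show "r \<in> {..<Q}" by (simp add: num_qubits_def mult.commute)
qed

lemma card_S_Int_le:
  assumes "i < M" "j < M" "i \<noteq> j"
  shows "card (S i \<inter> S j) \<le> D"
proof -
  have "S i \<inter> S j \<subseteq> (\<lambda>x. x * L' + y i x) ` {x. x < L \<and> y i x = y j x}"
    using position_inject[OF assms(1,2)] by (auto simp: codeword_support_def)
  then have "card (S i \<inter> S j) \<le> card ((\<lambda>x. x * L' + y i x) ` {x. x < L \<and> y i x = y j x})"
    by (intro card_mono) auto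
  also have "\<dots> \<le> card {x. x < L \<and> y i x = y j x}" by (intro card_image_le) auto
  also have "\<dots> \<le> D" using card_y_agree_le assms by blast
  finally show ?thesis .
qed

lemma cw_subset: "cw b \<subseteq> {..<Q}"
  by (auto simp: codeword_def)

lemma finite_cw [simp]: "finite (cw b)"
  using cw_subset finite_subset by blast

lemma cw_sym_diff:
  assumes "finite a" "finite b"
  shows "cw (sym_diff a b) = sym_diff (cw a) (cw b)"
proof -
  have "odd (card {i \<in> sym_diff a b. P i}) \<longleftrightarrow> odd (card {i \<in> a. P i}) \<noteq> odd (card {i \<in> b. P i})" for P
  proof -
    have "{i \<in> sym_diff a b. P i} = sym_diff {i \<in> a. P i} {i \<in> b. P i}" by auto
    then show ?thesis using assms by (simp add: odd_card_sym_diff)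
  qed
  then show ?thesis by (auto simp: codeword_def)
qed

lemma cw_singleton: "i < M \<Longrightarrow> cw {i} = S i"
proof -
  assume "i < M"
  have "{j \<in> {i}. r \<in> S j} = (if r \<in> S i then {i} else {})" for r by auto
  then show ?thesis using S_subset[OF \<open>i < M\<close>] by (auto simp: codeword_def)
qed

lemma card_overlap_le:
  assumes "b \<subseteq> {..<M}" "card b \<le> G" "i < M" "i \<notin> b"
  shows "card (S i \<inter> (\<Union>j\<in>b. S j)) \<le> D * G"
proof -
  have fb: "finite b" using assms finite_subset by blast
  have "card (S i \<inter> (\<Union>j\<in>b. S j)) = card (\<Union>j\<in>b. S i \<inter> S j)" by (simp only: Int_UN_distrib)
  also have "\<dots> \<le> (\<Sum>j\<in>b. card (S i \<inter> S j))" using fb by (rule card_UN_le)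
  also have "\<dots> \<le> (\<Sum>j\<in>b. D)" using assms by (intro sum_mono card_S_Int_le) auto
  also have "\<dots> \<le> D * G" using assms by simp
  finally show ?thesis .
qed

text \<open>This is the reason for \<open>L = 2 * D * G + 1\<close>. The other codewords of
  \<open>b\<close> meet \<open>S i\<close> in at most \<open>D * G\<close> qubits, fewer than half.
  Only these can be 1 if \<open>i\<close> is not in \<open>b\<close>, and only these can be 0 if it
  is.\<close>

lemma maj_cw_iff:
  assumes b: "b \<subseteq> {..<M}" "card b \<le> G" and i: "i < M"
  shows "maj i (cw b) \<longleftrightarrow> i \<in> b"
proof (cases "i \<in> b")
  case False
  have "cw b \<inter> S i \<subseteq> S i \<inter> (\<Union>j\<in>b. S j)"
  proof
    fix r assume r: "r \<in> cw b \<inter> S i"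
    then have "{j \<in> b. r \<in> S j} \<noteq> {}" by (intro odd_card_nonempty) (auto simp: codeword_def)
    then show "r \<in> S i \<inter> (\<Union>j\<in>b. S j)" using r by auto
  qed
  then have "card (cw b \<inter> S i) \<le> card (S i \<inter> (\<Union>j\<in>b. S j))" by (intro card_mono) auto
  also have "\<dots> \<le> D * G" using card_overlap_le assms False by blast
  finally have "2 * card (cw b \<inter> S i) < L" by (simp add: code_L_def)
  then show ?thesis using False card_S[OF i] by simp
next
  case True
  have fb: "finite b" using b finite_subset by blast
  have "S i - cw b \<subseteq> S i \<inter> (\<Union>j\<in>b - {i}. S j)"
  proof
    fix r assume r: "r \<in> S i - cw b"
    then have "even (card {j \<in> b. r \<in> S j})" using S_subset[OF i] by (auto simp: codeword_def)
    moreover have "{j \<in> b. r \<in> S j} = insert i {j \<in> b - {i}. r \<in> S j}" using True r by auto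
    ultimately have "odd (card {j \<in> b - {i}. r \<in> S j})" using fb by simp
    then have "{j \<in> b - {i}. r \<in> S j} \<noteq> {}" by (rule odd_card_nonempty)
    then show "r \<in> S i \<inter> (\<Union>j\<in>b - {i}. S j)" using r by auto
  qed
  then have "card (S i - cw b) \<le> card (S i \<inter> (\<Union>j\<in>b - {i}. S j))" using fb by (intro card_mono) auto
  also have "\<dots> \<le> D * G"
    using b i card_Diff1_le[of b i] by (intro card_overlap_le) auto
  finally have "card (S i - cw b) \<le> D * G" .
  moreover have "card (S i) = card (cw b \<inter> S i) + card (S i - cw b)"
    using card_Int_Diff[of "S i" "cw b"] by (simp add: Int_commute)
  ultimately show ?thesis using card_S[OF i] True by (simp add: code_L_def)
qed

lemma cw_nonempty:
  assumes "b \<subseteq> {..<M}" "card b \<le> G" "b \<noteq> {}"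
  shows "cw b \<noteq> {}"
proof
  assume e: "cw b = {}"
  obtain i where i: "i \<in> b" "i < M" using assms by auto
  then have "maj i (cw b)" using maj_cw_iff assms by blast
  then show False by (simp add: e)
qed

lemma card_cw_le:
  assumes "b \<subseteq> {..<M}"
  shows "card (cw b) \<le> card b * L"
proof -
  have fb: "finite b" using assms finite_subset by blast
  have "cw b \<subseteq> (\<Union>i\<in>b. S i)"
  proof
    fix r assume "r \<in> cw b"
    then have "{j \<in> b. r \<in> S j} \<noteq> {}" by (intro odd_card_nonempty) (auto simp: codeword_def)
    then show "r \<in> (\<Union>i\<in>b. S i)" by auto
  qed
  then have "card (cw b) \<le> card (\<Union>i\<in>b. S i)" using fb by (intro card_mono) auto
  also have "\<dots> \<le> (\<Sum>i\<in>b. card (S i))" using fb by (rule card_UN_le)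
  also have "\<dots> \<le> (\<Sum>i\<in>b. L)" using assms by (intro sum_mono) (auto simp: card_S)
  finally show ?thesis by simp
qed

end

subsection \<open>Operators expressible by Pauli products on the Bravyi-Kitaev bits\<close>

text \<open>The condition in \<open>encodes_operator\<close> with the coefficients forgotten. Once
  they exist they determine the encoded operator, whose action on code states is then the same
  argument for all operators.\<close>

definition bk_expressible :: "nat \<Rightarrow> operator \<Rightarrow> bool" where
  "bk_expressible M Op \<longleftrightarrow> (\<exists>c. \<forall>\<psi>\<in>kets M.
     linear_ext M (bk M) (Op \<psi>) = pauli_comb M c (linear_ext M (bk M) \<psi>))"

definition masked :: "nat \<Rightarrow> nat set \<Rightarrow> bool" where
  "masked M X \<longleftrightarrow> (\<exists>B. bk_mask M X B)"

lemma masked_weight: "bk_weight_le M X k \<Longrightarrow> masked M X"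
  by (auto simp: bk_weight_le_def masked_def)

lemma masked_sym_diff: "masked M X \<Longrightarrow> masked M Y \<Longrightarrow> masked M (sym_diff X Y)"
  unfolding masked_def using bk_mask_sym_diff by (elim exE) (rule exI)

lemma masked_empty: "masked M {}"
  unfolding masked_def bk_mask_def by (intro exI[of _ "{}"]) simp

lemma bk_expressible_pauli:
  assumes "masked M X" "Y \<subseteq> {..<M}"
  shows "bk_expressible M (\<lambda>\<psi>. pauli_X Y (pauli_Z X \<psi>))"
proof -
  obtain B where B: "bk_mask M X B" using assms(1) unfolding masked_def by (elim exE)
  let ?c = "\<lambda>A' B'. if B' = B then if A' = bk M Y then 1 else 0 else (0 :: complex)"
  have "B \<in> Pow {..<M}" "bk M Y \<in> Pow {..<M}" using B bk_subset by (auto simp: bk_mask_def)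
  then have "pauli_comb M ?c \<phi> = pauli_X (bk M Y) (pauli_Z B \<phi>)" for \<phi>
    unfolding pauli_comb_def
    by (simp add: if_distrib[where f = "\<lambda>x. x * _"] cong: if_cong)
  then show ?thesis
    unfolding bk_expressible_def using linear_ext_bk_pauli[OF B assms(2)]
    by (intro exI[of _ ?c]) simp
qed

lemma bk_expressible_add:
  assumes "bk_expressible M f" "bk_expressible M g"
  shows "bk_expressible M (\<lambda>\<psi> n. a * f \<psi> n + b * g \<psi> n)"
proof -
  obtain c where c: "\<forall>\<psi>\<in>kets M. linear_ext M (bk M) (f \<psi>) = pauli_comb M c (linear_ext M (bk M) \<psi>)"
    using assms(1) unfolding bk_expressible_def by (elim exE)
  obtain d where d: "\<forall>\<psi>\<in>kets M. linear_ext M (bk M) (g \<psi>) = pauli_comb M d (linear_ext M (bk M) \<psi>)"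
    using assms(2) unfolding bk_expressible_def by (elim exE)
  have "linear_ext M (bk M) (\<lambda>n. a * f \<psi> n + b * g \<psi> n) =
      (\<lambda>s. a * linear_ext M (bk M) (f \<psi>) s + b * linear_ext M (bk M) (g \<psi>) s)" for \<psi>
    by (simp add: linear_ext_def sum.distrib sum_distrib_left)
  moreover have "pauli_comb M (\<lambda>A B. a * c A B + b * d A B) \<phi> =
      (\<lambda>s. a * pauli_comb M c \<phi> s + b * pauli_comb M d \<phi> s)" for \<phi>
    by (simp add: pauli_comb_def sum.distrib sum_distrib_left distrib_right mult.assoc)
  ultimately show ?thesis
    unfolding bk_expressible_def using c d
    by (intro exI[of _ "\<lambda>A B. a * c A B + b * d A B"]) simp
qed

context degree_code
begin

abbreviation "encode \<equiv> encode_state D F M y"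
abbreviation "enc n \<equiv> cw (bk M n)"

lemma encode_eq: "encode \<psi> = linear_ext M enc \<psi>"
  unfolding encode_state_def by (rule linear_ext_comp[OF bk_subset])

lemma enc_sym_diff: "enc (sym_diff a b) = sym_diff (enc a) (enc b)"
  by (simp only: bk_sym_diff cw_sym_diff finite_bk)

lemma card_bk_le_G: "n \<subseteq> {..<M} \<Longrightarrow> card n \<le> F + 4 \<Longrightarrow> card (bk M n) \<le> G"
  unfolding G_eq by (rule order_trans[OF card_bk_le mult_le_mono1]) (auto dest: finite_subset)

text \<open>Each factor is diagonal and does not enlarge the support, so the bound \<open>G\<close>
  that makes majorities right persists through the product.\<close>

lemma fold_encoded_Z:
  assumes "distinct bs" "set bs \<subseteq> {..<M}" "\<And>b. \<phi> b \<noteq> 0 \<Longrightarrow> b \<subseteq> {..<M} \<and> card b \<le> G"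
  shows "fold (encoded_Z D F M y) bs (linear_ext M cw \<phi>) = linear_ext M cw (pauli_Z (set bs) \<phi>)"
  using assms
proof (induction bs arbitrary: \<phi>)
  case Nil
  then show ?case by (simp add: pauli_Z_def)
next
  case (Cons i bs)
  have "parity_sign {i} b = (if maj i (cw b) then -1 else 1)" if "\<phi> b \<noteq> 0" for b
    using maj_cw_iff[of b i] Cons.prems(2) Cons.prems(3)[OF that] by (simp add: parity_sign_singleton)
  then have Z: "linear_ext M cw (pauli_Z {i} \<phi>) = encoded_Z D F M y i (linear_ext M cw \<phi>)"
    unfolding pauli_Z_eq encoded_Z_def by (intro linear_ext_diagonal) simp
  have "fold (encoded_Z D F M y) (i # bs) (linear_ext M cw \<phi>) =
      linear_ext M cw (pauli_Z (set bs) (pauli_Z {i} \<phi>))"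
    using Cons.prems by (simp flip: Z) (rule Cons.IH, auto simp: pauli_Z_eq)
  also have "pauli_Z (set bs) (pauli_Z {i} \<phi>) = pauli_Z (set (i # bs)) \<phi>"
  proof -
    have "set (i # bs) = sym_diff (set bs) {i}" using Cons.prems(1) by auto
    then show ?thesis
      using parity_sign_sym_diff_mask[of "set bs" "{i}"] by (simp add: pauli_Z_eq mult.assoc)
  qed
  finally show ?case .
qed

text \<open>By linearity of the code, flipping bit \<open>i\<close> adds the codeword
  \<open>S i\<close> whatever the weight of the bitstring. So it does no harm if the flips lead out
  of the range of correct decoding.\<close>

lemma fold_encoded_X:
  assumes "distinct as" "set as \<subseteq> {..<M}"
  shows "fold (encoded_X D F M y) as (linear_ext M cw \<phi>) = linear_ext M cw (pauli_X (set as) \<phi>)"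
  using assms
proof (induction as arbitrary: \<phi>)
  case Nil
  then show ?case by (simp add: pauli_X_def)
next
  case (Cons i as)
  have i: "i < M" using Cons.prems by simp
  have "cw (sym_diff b {i}) = sym_diff (cw b) (S i)" if "b \<subseteq> {..<M}" for b
    using cw_sym_diff[of b "{i}"] cw_singleton[OF i] finite_subset[OF that] by simp
  then have X: "linear_ext M cw (pauli_X {i} \<phi>) = encoded_X D F M y i (linear_ext M cw \<phi>)"
    unfolding encoded_X_def using i by (intro linear_ext_pauli_X) simp_all
  have "fold (encoded_X D F M y) (i # as) (linear_ext M cw \<phi>) =
      linear_ext M cw (pauli_X (set as) (pauli_X {i} \<phi>))"
    using Cons.prems by (simp flip: X) (rule Cons.IH, auto)
  also have "pauli_X (set as) (pauli_X {i} \<phi>) = pauli_X (set (i # as)) \<phi>"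
  proof -
    have "sym_diff (sym_diff s (set as)) {i} = sym_diff s (set (i # as))" for s
      using Cons.prems(1) by auto
    then show ?thesis by (simp only: pauli_X_def)
  qed
  finally show ?case .
qed

lemma encoded_pauli_comb_encode:
  assumes "\<psi> \<in> fermions_upto M (F + 4)"
  shows "encoded_pauli_comb D F M y c (encode \<psi>) =
    linear_ext M cw (pauli_comb M c (linear_ext M (bk M) \<psi>))"
proof -
  let ?\<phi> = "linear_ext M (bk M) \<psi>"
  have supp: "b \<subseteq> {..<M} \<and> card b \<le> G" if nz: "?\<phi> b \<noteq> 0" for b
  proof -
    obtain n where "n \<subseteq> {..<M}" "bk M n = b" "\<psi> n \<noteq> 0" using nz by (rule linear_ext_nonzero)
    moreover have "card n \<le> F + 4" using assms \<open>\<psi> n \<noteq> 0\<close> by (simp add: fermions_upto_def)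
    ultimately show ?thesis using card_bk_le_G[of n] bk_subset by auto
  qed
  have pauli: "fold (encoded_X D F M y) (sorted_list_of_set A)
        (fold (encoded_Z D F M y) (sorted_list_of_set B) (encode \<psi>)) =
      linear_ext M cw (pauli_X A (pauli_Z B ?\<phi>))" if "A \<in> Pow {..<M}" "B \<in> Pow {..<M}" for A B
  proof -
    have fin: "finite A" "finite B" using that finite_subset by auto
    then have "fold (encoded_Z D F M y) (sorted_list_of_set B) (encode \<psi>) =
        linear_ext M cw (pauli_Z B ?\<phi>)"
      unfolding encode_state_def using fold_encoded_Z[of "sorted_list_of_set B" ?\<phi>] supp that by auto
    then show ?thesis
      using fold_encoded_X[of "sorted_list_of_set A" "pauli_Z B ?\<phi>"] that fin by auto
  qed
  have "encoded_pauli_comb D F M y c (encode \<psi>) = (\<lambda>s. \<Sum>A\<in>Pow {..<M}. \<Sum>B\<in>Pow {..<M}.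
      c A B * linear_ext M cw (pauli_X A (pauli_Z B ?\<phi>)) s)"
    unfolding encoded_pauli_comb_def by (intro ext sum.cong refl) (simp only: pauli)
  also have "\<dots> = linear_ext M cw (\<lambda>s. \<Sum>A\<in>Pow {..<M}. 1 * (\<Sum>B\<in>Pow {..<M}.
      c A B * pauli_X A (pauli_Z B ?\<phi>) s))"
    unfolding linear_ext_sum by simp
  finally show ?thesis by (simp add: pauli_comb_def)
qed

text \<open>For an expressible operator the encoded operator agrees with it on all code states in
  range; only the circuit remains to be checked.\<close>

lemma implementableI:
  assumes "bk_expressible M Op" "circuit (Q + 1) N A"
    and "\<And>\<psi>. \<psi> \<in> fermions_upto M (F + 4) \<Longrightarrow> Op \<psi> \<in> fermions_upto M (F + 4) \<Longrightarrow>
      A (encode \<psi>) = encode (Op \<psi>)"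
  shows "implementable D F M y Op N"
proof -
  obtain c where c: "\<And>\<psi>. \<psi> \<in> kets M \<Longrightarrow>
      linear_ext M (bk M) (Op \<psi>) = pauli_comb M c (linear_ext M (bk M) \<psi>)"
    using assms(1) unfolding bk_expressible_def by (elim exE) simp
  let ?Op' = "encoded_pauli_comb D F M y c"
  obtain gs where gs: "length gs \<le> N" "\<forall>g\<in>set gs. cc_valid (Q + 1) g" "fold cc_apply gs = A"
    using assms(2) unfolding circuit_def by (elim exE conjE)
  have "?Op' (encode \<psi>) = encode (Op \<psi>)" if "\<psi> \<in> fermions_upto M (F + 4)" for \<psi>
  proof -
    have kets: "\<psi> \<in> kets M" using that by (simp add: fermions_upto_def)
    show ?thesis
      unfolding encoded_pauli_comb_encode[OF that] c[OF kets, symmetric] unfolding encode_state_def ..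
  qed
  moreover have "encodes_operator D F M y Op ?Op'"
    unfolding encodes_operator_def using c by (intro exI[of _ c]) simp
  ultimately show ?thesis
    unfolding implementable_def using gs assms(3)
    by (intro exI[of _ ?Op'] exI[of _ gs]) simp
qed

text \<open>The column of \<open>n\<close> has the entries \<open>\<delta> n\<close> at
  \<open>n\<close> and \<open>\<omega> n\<close> at its partner. If the partner has more than
  \<open>F + 4\<close> fermions, \<psi> vanishes there, so \<open>Op \<psi>\<close> has the
  amplitude \<open>\<omega> n * \<psi> n\<close> at it, which is 0 because \<open>Op \<psi>\<close>
  is in range. Hence such a column with \<open>\<omega> n \<noteq> 0\<close> never occurs in \<psi>,
  and the circuit is not constrained on it.\<close>

lemma implementable_two_term:
  assumes Op: "\<And>\<psi> n. Op \<psi> n = \<delta> n * \<psi> n + \<omega> (sym_diff n Y) * \<psi> (sym_diff n Y)"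
    and "bk_expressible M Op" "Y \<subseteq> {..<M}" and A: "circuit (Q + 1) N A"
    and basis: "\<And>n. n \<subseteq> {..<M} \<Longrightarrow> card n \<le> F + 4 \<Longrightarrow> \<omega> n = 0 \<or> card (sym_diff n Y) \<le> F + 4 \<Longrightarrow>
      A (basis_ket (enc n)) = (\<lambda>r. \<delta> n * basis_ket (enc n) r + \<omega> n * basis_ket (enc (sym_diff n Y)) r)"
  shows "implementable D F M y Op N"
proof (rule implementableI[OF assms(2) A])
  fix \<psi> assume \<psi>: "\<psi> \<in> fermions_upto M (F + 4)" and Op\<psi>: "Op \<psi> \<in> fermions_upto M (F + 4)"
  let ?N = "{n. n \<subseteq> {..<M}}"
  have inv: "sym_diff (sym_diff n Y) Y = n" for n by auto
  have summand: "\<psi> n * A (basis_ket (enc n)) r =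
      \<psi> n * (\<delta> n * basis_ket (enc n) r + \<omega> n * basis_ket (enc (sym_diff n Y)) r)" for n r
  proof (cases "\<psi> n = 0")
    case False
    then have n: "n \<subseteq> {..<M}" "card n \<le> F + 4" using \<psi> by (auto simp: fermions_upto_def kets_def)
    have "\<omega> n = 0 \<or> card (sym_diff n Y) \<le> F + 4"
    proof (rule ccontr)
      assume *: "\<not> ?thesis"
      then have "\<psi> (sym_diff n Y) = 0" using \<psi> by (auto simp: fermions_upto_def)
      then have "Op \<psi> (sym_diff n Y) = \<omega> n * \<psi> n" unfolding Op inv by simp
      then have "Op \<psi> (sym_diff n Y) \<noteq> 0" using * False by simp
      then have "card (sym_diff n Y) \<le> F + 4" using Op\<psi> unfolding fermions_upto_def by blast
      then show False using * by blast
    qed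
    then show ?thesis using basis n by simp
  qed simp
  have "A (encode \<psi>) = (\<lambda>r. \<Sum>n\<in>?N. \<psi> n * A (basis_ket (enc n)) r)"
    unfolding encode_eq linear_ext_basis_kets by (rule circuit_linear[OF A])
  also have "\<dots> = (\<lambda>r. (\<Sum>n\<in>?N. \<delta> n * \<psi> n * basis_ket (enc n) r) +
      (\<Sum>n\<in>?N. \<omega> n * \<psi> n * basis_ket (enc (sym_diff n Y)) r))"
    unfolding summand by (simp add: algebra_simps sum.distrib)
  also have "(\<lambda>r. \<Sum>n\<in>?N. \<omega> n * \<psi> n * basis_ket (enc (sym_diff n Y)) r) =
      (\<lambda>r. \<Sum>n\<in>?N. \<omega> (sym_diff n Y) * \<psi> (sym_diff n Y) * basis_ket (enc n) r)"
  proof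
    fix r
    have "sym_diff n Y \<in> ?N" if "n \<in> ?N" for n using that assms(3) by auto
    then show "(\<Sum>n\<in>?N. \<omega> n * \<psi> n * basis_ket (enc (sym_diff n Y)) r) =
      (\<Sum>n\<in>?N. \<omega> (sym_diff n Y) * \<psi> (sym_diff n Y) * basis_ket (enc n) r)"
      by (intro sum.reindex_bij_witness[of _ "\<lambda>n. sym_diff n Y" "\<lambda>n. sym_diff n Y"]) (simp_all only: inv)
  qed
  finally show "A (encode \<psi>) = encode (Op \<psi>)"
    unfolding encode_eq linear_ext_basis_kets Op
    by (simp add: sum.distrib distrib_right fun_eq_iff)
qed

subsection \<open>Circuits on the code\<close>

lemma ignores_maj: "i < M \<Longrightarrow> ignores (maj i) Q"
proof -
  assume "i < M"
  then have "sym_diff s {Q} \<inter> S i = s \<inter> S i" for s using S_subset[of i] by auto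
  then show ?thesis by (simp add: ignores_def)
qed

text \<open>\<open>?K\<close> consists of the weights above one half. At least \<open>10 * L\<close>
  qubits lie outside \<open>S i\<close>, enough for the \<open>L + 1\<close> borrowed ones, and
  \<open>L \<ge> 11\<close> turns the lower-order terms into one more square of
  \<open>L\<close>.\<close>

lemma reversible_maj:
  assumes "i < M"
  shows "reversible (Q + 1) (13 * L\<^sup>2) (toggle Q (maj i))"
proof -
  let ?K = "{k. k \<le> L \<and> L < 2 * k}"
  have "11 * L \<le> L' * L" using L_ge L'(2) by (intro mult_le_mono) auto
  then have Q: "11 * L \<le> Q" by (simp add: num_qubits_def)
  have "card ({..<Q} - S i) = Q - L"
    using S_subset[OF assms] card_S[OF assms] by (simp add: card_Diff_subset)
  then have "card {..L} \<le> card ({..<Q} - S i)" using Q L_ge by simp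
  then obtain d where d: "d ` {..L} \<subseteq> {..<Q} - S i" "inj_on d {..L}"
    using card_le_inj[of "{..L}" "{..<Q} - S i"] by auto
  have "card (s \<inter> S i) \<le> L" for s
    using card_mono[OF finite_S, of "s \<inter> S i" i] card_S[OF assms] by simp
  then have "(\<lambda>s. card (s \<inter> S i) \<in> ?K) = maj i" using card_S[OF assms] by auto
  moreover have rev: "reversible (Q + 1) (12 * L\<^sup>2 + 4 * L + 12) (toggle Q (\<lambda>s. card (s \<inter> S i) \<in> ?K))"
    using S_subset[OF assms] card_S[OF assms] d Q L_ge
    by (intro reversible_symmetric_function[where d = d]) auto
  moreover have "12 * L\<^sup>2 + 4 * L + 12 \<le> 13 * L\<^sup>2"
  proof -
    have "4 * L + 12 \<le> 11 * L" using L_ge by simp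
    also have "\<dots> \<le> L * L" using L_ge by (intro mult_le_mono1)
    finally show ?thesis by (simp add: power2_eq_square)
  qed
  ultimately show ?thesis using reversible_mono[OF rev] by simp
qed

definition maj_parity :: "nat set \<Rightarrow> nat set \<Rightarrow> bool" where
  "maj_parity B s \<longleftrightarrow> odd (card {i\<in>B. maj i s})"

lemma reversible_maj_parity:
  "B \<subseteq> {..<M} \<Longrightarrow> reversible (Q + 1) (card B * (13 * L\<^sup>2)) (toggle Q (maj_parity B))"
  unfolding maj_parity_def[abs_def]
  by (intro reversible_toggle_parity_of reversible_maj ignores_maj) (auto dest: finite_subset)

lemma ignores_maj_parity: "B \<subseteq> {..<M} \<Longrightarrow> ignores (maj_parity B) Q"
proof -
  assume "B \<subseteq> {..<M}"
  then have "{i\<in>B. maj i (sym_diff s {Q})} = {i\<in>B. maj i s}" for s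
    using ignores_maj by (auto simp: ignores_def)
  then show ?thesis by (simp add: ignores_def maj_parity_def)
qed

lemma maj_parity_enc:
  assumes "bk_mask M X B" "n \<subseteq> {..<M}" "card n \<le> F + 4"
  shows "maj_parity B (enc n) \<longleftrightarrow> odd (card (n \<inter> X))"
proof -
  have B: "B \<subseteq> {..<M}" "parity_sign X n = parity_sign B (bk M n)"
    using assms(1) by (auto simp: bk_mask_def)
  have "{i\<in>B. maj i (enc n)} = bk M n \<inter> B"
    using maj_cw_iff[OF bk_subset card_bk_le_G[OF assms(2,3)]] B(1) by auto
  then have "maj_parity B (enc n) \<longleftrightarrow> odd (card (bk M n \<inter> B))" by (simp add: maj_parity_def)
  also have "\<dots> \<longleftrightarrow> odd (card (n \<inter> X))" using B(2) by (auto simp: parity_sign_def split: if_splits)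
  finally show ?thesis .
qed

lemma Q_notin_enc: "Q \<notin> enc n"
  using cw_subset by auto

lemma Q_ge: "Q + 1 \<ge> 3"
proof -
  have "11 * 11 \<le> L' * L" using L_ge L'(2) by (intro mult_le_mono) auto
  then show ?thesis by (simp add: num_qubits_def)
qed

lemma phase_circuit:
  assumes "bk_mask M X B" "norm u = 1" "norm v = 1"
  shows "\<exists>A. circuit (Q + 1) (2 * (card B * (13 * L\<^sup>2)) + 4) A \<and>
    (\<forall>n. n \<subseteq> {..<M} \<longrightarrow> card n \<le> F + 4 \<longrightarrow>
      A (basis_ket (enc n)) = (\<lambda>r. (if odd (card (n \<inter> X)) then v else u) * basis_ket (enc n) r))"
proof -
  have B: "B \<subseteq> {..<M}" using assms(1) by (simp add: bk_mask_def)
  obtain A where A: "circuit (Q + 1) (2 * (card B * (13 * L\<^sup>2)) + 4) A"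
    "\<And>s. Q \<notin> s \<Longrightarrow> A (basis_ket s) = (\<lambda>r. (if maj_parity B s then v else u) * basis_ket s r)"
    using circuit_phase[OF Q_ge less_add_one reversible_maj_parity[OF B] ignores_maj_parity[OF B] assms(2,3)]
    by (elim exE conjE) simp_all
  have "A (basis_ket (enc n)) = (\<lambda>r. (if odd (card (n \<inter> X)) then v else u) * basis_ket (enc n) r)"
    if "n \<subseteq> {..<M}" "card n \<le> F + 4" for n
    unfolding A(2)[OF Q_notin_enc] maj_parity_enc[OF assms(1) that] ..
  then show ?thesis using A(1) by (intro exI[of _ A]) simp
qed

text \<open>Off the diagonal the signed circuit supplies the sign of whichever partner contains the
  pivot: that of \<open>n\<close>, or that of \<open>sym_diff n Y\<close>, which differs by the
  constant \<open>parity_sign X Y\<close>. This constant in one matrix entry makes the result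
  independent of which of the two it is. Beyond \<open>F + 4\<close> fermions majorities say nothing
  about the partner; the alternative \<open>\<kappa> = 0\<close> without control bits covers
  rotations that do not mix, where sin \<theta> = 0.\<close>

lemma mixing_circuit:
  assumes Y: "Y \<subseteq> {..<M}" "Y \<noteq> {}" "card Y \<le> 4"
    and X: "bk_mask M X B" and X1: "bk_mask M X1 B1"
    and U: "unitary2 (matrix2 c \<kappa> (\<kappa> * parity_sign X Y) c)"
  shows "\<exists>A. circuit (Q + 1) (4 * (card B * (13 * L\<^sup>2)) + 2 * (card B1 * (13 * L\<^sup>2)) +
      4 * (card Y * bk_depth M * L) + 6) A \<and>
    (\<forall>n. n \<subseteq> {..<M} \<longrightarrow> card n \<le> F + 4 \<longrightarrow>
      (odd (card (n \<inter> X1)) \<noteq> u \<longrightarrow> A (basis_ket (enc n)) = basis_ket (enc n)) \<and>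
      (odd (card (n \<inter> X1)) = u \<longrightarrow> odd (card (sym_diff n Y \<inter> X1)) = u \<longrightarrow>
        card (sym_diff n Y) \<le> F + 4 \<or> \<kappa> = 0 \<and> B1 = {} \<longrightarrow>
        A (basis_ket (enc n)) =
          (\<lambda>r. c * basis_ket (enc n) r + \<kappa> * parity_sign X n * basis_ket (enc (sym_diff n Y)) r)))"
proof -
  have B: "B \<subseteq> {..<M}" and fX: "finite X" using X by (simp_all add: bk_mask_def)
  have B1: "B1 \<subseteq> {..<M}" using X1 by (simp add: bk_mask_def)
  let ?U = "matrix2 c \<kappa> (\<kappa> * parity_sign X Y) c"
  let ?S = "enc Y"
  have S: "?S \<subseteq> {..<Q + 1}" "Q \<notin> ?S" using cw_subset[of "bk M Y"] by auto
  \<comment> \<open>As \<open>4 \<le> F + 4\<close>, the set \<open>Y\<close> is itself in range, so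
    it encodes to a nonzero word and a pivot exists.\<close>
  have "card (bk M Y) \<le> G" using Y(1,3) by (intro card_bk_le_G) auto
  then have "?S \<noteq> {}" using bk_nonempty[OF Y(1,2)] bk_subset by (intro cw_nonempty) auto
  then obtain t where t: "t \<in> ?S" by auto
  define g where "g s = (if maj_parity B s \<and> t \<in> s then -1 else 1 :: complex)" for s
  obtain A where A: "circuit (Q + 1) (4 * (card B * (13 * L\<^sup>2)) + 2 * (card B1 * (13 * L\<^sup>2)) + 4 * card ?S + 6) A"
    "\<And>s. Q \<notin> s \<Longrightarrow> maj_parity B1 s \<noteq> u \<Longrightarrow> A (basis_ket s) = basis_ket s"
    "\<And>s. Q \<notin> s \<Longrightarrow> maj_parity B1 s = u \<Longrightarrow> maj_parity B1 (sym_diff s ?S) = u \<Longrightarrow> A (basis_ket s) =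
      (\<lambda>r. ?U $ (t \<in> s) $ (t \<in> s) * basis_ket s r +
           g s * g (sym_diff s ?S) * ?U $ (t \<notin> s) $ (t \<in> s) * basis_ket (sym_diff s ?S) r)"
    using circuit_signed_mixing[OF Q_ge less_add_one S(1) t S(2) U reversible_maj_parity[OF B]
      ignores_maj_parity[OF B] reversible_maj_parity[OF B1] ignores_maj_parity[OF B1], of u]
    unfolding g_def by (elim exE conjE) simp_all
  have "finite Y" using Y(1) finite_subset by blast
  then have "card ?S \<le> card Y * bk_depth M * L"
    using card_cw_le[OF bk_subset, of Y] card_bk_le[of Y M]
    by (meson le_trans mult_le_mono1)
  then have circ: "circuit (Q + 1) (4 * (card B * (13 * L\<^sup>2)) + 2 * (card B1 * (13 * L\<^sup>2)) +
      4 * (card Y * bk_depth M * L) + 6) A"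
    by (intro circuit_mono[OF A(1)]) simp
  have A0: "A (basis_ket (enc n)) = basis_ket (enc n)"
    if "n \<subseteq> {..<M}" "card n \<le> F + 4" "odd (card (n \<inter> X1)) \<noteq> u" for n
    using A(2)[OF Q_notin_enc] maj_parity_enc[OF X1 that(1,2)] that(3) by simp
  have A1: "A (basis_ket (enc n)) =
      (\<lambda>r. c * basis_ket (enc n) r + \<kappa> * parity_sign X n * basis_ket (enc (sym_diff n Y)) r)"
    if n: "n \<subseteq> {..<M}" "card n \<le> F + 4" and u: "odd (card (n \<inter> X1)) = u"
      "odd (card (sym_diff n Y \<inter> X1)) = u"
      and disj: "card (sym_diff n Y) \<le> F + 4 \<or> \<kappa> = 0 \<and> B1 = {}" for n
  proof -
    have n': "sym_diff n Y \<subseteq> {..<M}" using n(1) Y(1) by auto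
    have m: "maj_parity B1 (enc n) = u" using maj_parity_enc[OF X1 n] u(1) by simp
    have m': "maj_parity B1 (sym_diff (enc n) ?S) = u"
    proof (cases "card (sym_diff n Y) \<le> F + 4")
      case True
      then show ?thesis using maj_parity_enc[OF X1 n'] u(2) by (simp flip: enc_sym_diff)
    next
      case False
      then have "B1 = {}" using disj by blast
      then show ?thesis using m by (simp add: maj_parity_def)
    qed
    have off: "g (enc n) * g (sym_diff (enc n) ?S) * ?U $ (t \<notin> enc n) $ (t \<in> enc n) = \<kappa> * parity_sign X n"
    proof (cases "\<kappa> = 0")
      case True
      then show ?thesis by (simp add: matrix2_def)
    next
      case False
      then have "card (sym_diff n Y) \<le> F + 4" using disj by blast
      then have *: "maj_parity B (sym_diff (enc n) ?S) = odd (card (sym_diff n Y \<inter> X))"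
        "maj_parity B (enc n) = odd (card (n \<inter> X))"
        using maj_parity_enc[OF X n'] maj_parity_enc[OF X n] by (simp_all flip: enc_sym_diff)
      show ?thesis
      proof (cases "t \<in> enc n")
        case True
        then have "t \<notin> sym_diff (enc n) ?S" using t by blast
        then show ?thesis using True * by (simp add: g_def matrix2_def parity_sign_def)
      next
        case False
        then have "t \<in> sym_diff (enc n) ?S" using t by blast
        then have "g (sym_diff (enc n) ?S) = parity_sign X (sym_diff n Y)" "g (enc n) = 1"
          using False * by (simp_all add: g_def parity_sign_def)
        then show ?thesis
          using False parity_sign_sym_diff[OF fX, of n Y] by (simp add: matrix2_def mult_ac)
      qed
    qed
    have "?U $ b $ b = c" for b by (simp add: matrix2_def)
    then show ?thesis using A(3)[OF Q_notin_enc m m'] unfolding off enc_sym_diff by simp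
  qed
  show ?thesis
    by (rule exI[of _ A], intro conjI allI impI) (rule circ A0 A1; assumption)+
qed

end

subsection \<open>Rotations and hop gates on the code\<close>

text \<open>The hop gate is the most expensive case. In units of \<open>bk_depth M\<close> times the
  square of \<open>L\<close>, its majorities cost at most 520, its fan-outs 8 and its remaining
  gates 18.\<close>

definition gate_count :: "nat \<Rightarrow> nat \<Rightarrow> nat \<Rightarrow> nat" where
  "gate_count D F M = 600 * (bk_depth M * (code_L D F M)\<^sup>2)"

lemma bk_weight_le_obtain:
  assumes "bk_weight_le M X k"
  obtains B where "bk_mask M X B" "card B \<le> k"
  using assms unfolding bk_weight_le_def by (elim exE conjE)

lemma bk_expressible_two_term:
  assumes "masked M X" "Y \<subseteq> {..<M}"
  shows "bk_expressible M (\<lambda>\<psi> n. a * \<psi> n + b * (parity_sign X (sym_diff n Y) * \<psi> (sym_diff n Y)))"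
proof -
  have "(\<lambda>\<psi>. pauli_X {} (pauli_Z {} \<psi>)) = (\<lambda>\<psi>. \<psi>)"
    by (simp add: pauli_X_def pauli_Z_def)
  then have "bk_expressible M (\<lambda>\<psi>. \<psi>)"
    using bk_expressible_pauli[OF masked_empty, of "{}" M] by simp
  from bk_expressible_add[OF this bk_expressible_pauli[OF assms], of a b] show ?thesis
    by (simp add: pauli_X_def pauli_Z_eq)
qed

context degree_code
begin

lemma weight_term_le: "b \<le> k * bk_depth M \<Longrightarrow> b * (13 * L\<^sup>2) \<le> k * 13 * (bk_depth M * L\<^sup>2)"
  using mult_le_mono1[of b "k * bk_depth M" "13 * L\<^sup>2"] by (simp add: mult_ac)

lemma unit_le: "1 \<le> bk_depth M * L\<^sup>2" and linear_le: "bk_depth M * L \<le> bk_depth M * L\<^sup>2"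
  using bk_depth_ge_1[OF M] L_ge by (simp_all add: power2_eq_square)

lemma implementable_rotation_form:
  fixes \<theta> :: real
  assumes Op: "\<And>\<psi> n. Op \<psi> n = complex_of_real (cos \<theta>) * \<psi> n +
      \<i> * complex_of_real (sin \<theta>) * \<kappa> * (parity_sign X (sym_diff n Y) * \<psi> (sym_diff n Y))"
    and Y: "Y \<subseteq> {..<M}" "card Y \<le> 4" and X: "bk_weight_le M X (4 * bk_depth M)"
    and \<kappa>: "norm \<kappa> = 1" "\<kappa> * \<kappa> * parity_sign X Y = 1"
  shows "implementable D F M y Op (gate_count D F M)"
proof -
  obtain B where B: "bk_mask M X B" "card B \<le> 4 * bk_depth M"
    using X by (rule bk_weight_le_obtain)
  have W: "card B * (13 * L\<^sup>2) \<le> 4 * 13 * (bk_depth M * L\<^sup>2)" using B(2) by (rule weight_term_le)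
  have "Op = (\<lambda>\<psi> n. complex_of_real (cos \<theta>) * \<psi> n +
      \<i> * complex_of_real (sin \<theta>) * \<kappa> * (parity_sign X (sym_diff n Y) * \<psi> (sym_diff n Y)))"
    by (intro ext) (rule Op)
  then have ex: "bk_expressible M Op"
    using bk_expressible_two_term[OF masked_weight[OF X] Y(1)] by simp
  show ?thesis
  proof (cases "Y = {}")
    case True
    \<comment> \<open>Without flipped modes there is no pivot. The term is then diagonal with
      entries 1 and -1, so its rotation is a phase of angle \<theta> or -\<theta> chosen by a
      parity.\<close>
    then have "\<kappa> = 1 \<or> \<kappa> = -1" using \<kappa>(2) by (simp add: square_eq_1_iff)
    then have "complex_of_real (cos \<theta>) + \<i> * complex_of_real (sin \<theta>) * \<kappa> = cis \<theta> \<and> complex_of_real (cos \<theta>) - \<i> * complex_of_real (sin \<theta>) * \<kappa> = cis (-\<theta>) \<or>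
        complex_of_real (cos \<theta>) + \<i> * complex_of_real (sin \<theta>) * \<kappa> = cis (-\<theta>) \<and> complex_of_real (cos \<theta>) - \<i> * complex_of_real (sin \<theta>) * \<kappa> = cis \<theta>"
      by (auto simp: complex_eq_iff)
    then have n: "norm (complex_of_real (cos \<theta>) + \<i> * complex_of_real (sin \<theta>) * \<kappa>) = 1" "norm (complex_of_real (cos \<theta>) - \<i> * complex_of_real (sin \<theta>) * \<kappa>) = 1"
      by auto
    let ?\<delta> = "\<lambda>n. if odd (card (n \<inter> X)) then complex_of_real (cos \<theta>) - \<i> * complex_of_real (sin \<theta>) * \<kappa> else complex_of_real (cos \<theta>) + \<i> * complex_of_real (sin \<theta>) * \<kappa>"
    obtain A where A: "circuit (Q + 1) (2 * (card B * (13 * L\<^sup>2)) + 4) A"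
      "\<And>n. n \<subseteq> {..<M} \<Longrightarrow> card n \<le> F + 4 \<Longrightarrow> A (basis_ket (enc n)) = (\<lambda>r. ?\<delta> n * basis_ket (enc n) r)"
      using phase_circuit[OF B(1) n] by (elim exE conjE) simp
    have circ: "circuit (Q + 1) (gate_count D F M) A"
      using W unit_le by (intro circuit_mono[OF A(1)]) (unfold gate_count_def, linarith)
    show ?thesis
    proof (rule implementable_two_term[where \<delta> = ?\<delta> and \<omega> = "\<lambda>_. 0", OF _ ex Y(1) circ])
      show "Op \<psi> n = ?\<delta> n * \<psi> n + 0 * \<psi> (sym_diff n Y)" for \<psi> n
        by (simp add: Op True parity_sign_def algebra_simps)
      show "A (basis_ket (enc n)) = (\<lambda>r. ?\<delta> n * basis_ket (enc n) r + 0 * basis_ket (enc (sym_diff n Y)) r)"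
        if "n \<subseteq> {..<M}" "card n \<le> F + 4" for n
        unfolding A(2)[OF that] mult_zero_left add_0_right ..
    qed
  next
    case False
    let ?\<kappa> = "\<i> * complex_of_real (sin \<theta>) * \<kappa>"
    have p: "parity_sign X Y = 1 \<or> parity_sign X Y = -1" by (simp add: parity_sign_def)
    have \<kappa>': "cnj \<kappa> * \<kappa> = 1" "cnj \<kappa> = \<kappa> * parity_sign X Y"
    proof -
      show *: "cnj \<kappa> * \<kappa> = 1" using complex_norm_square[of \<kappa>] \<kappa>(1) by (simp add: mult.commute)
      have "cnj \<kappa> = cnj \<kappa> * (\<kappa> * \<kappa> * parity_sign X Y)" using \<kappa>(2) by simp
      also have "\<dots> = (cnj \<kappa> * \<kappa>) * (\<kappa> * parity_sign X Y)" by (simp only: mult_ac)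
      finally show "cnj \<kappa> = \<kappa> * parity_sign X Y" unfolding * by simp
    qed
    have cs: "complex_of_real (cos \<theta>) * complex_of_real (cos \<theta>) + complex_of_real (sin \<theta>) * complex_of_real (sin \<theta>) = 1"
      by (simp only: of_real_mult[symmetric] of_real_add[symmetric] sin_cos_squared_add3 of_real_1)
    have sq: "\<kappa> * \<kappa> * parity_sign X Y = 1" by (rule \<kappa>(2))
    have U: "unitary2 (matrix2 (complex_of_real (cos \<theta>)) ?\<kappa> (?\<kappa> * parity_sign X Y) (complex_of_real (cos \<theta>)))"
    proof -
      have "cnj ?\<kappa> * ?\<kappa> = complex_of_real (sin \<theta>) * complex_of_real (sin \<theta>) * (\<kappa> * \<kappa> * parity_sign X Y)"
        by (simp add: \<kappa>'(2) mult_ac)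
      then have 1: "cnj ?\<kappa> * ?\<kappa> = complex_of_real (sin \<theta>) * complex_of_real (sin \<theta>)" unfolding sq by simp
      have 2: "cnj (?\<kappa> * parity_sign X Y) * (?\<kappa> * parity_sign X Y) = cnj ?\<kappa> * ?\<kappa>"
        using p by auto
      \<comment> \<open>The factor \<open>\<i>\<close> makes the off-diagonal entries negative
        conjugates of each other, as a unitary matrix with equal real diagonal entries
        requires.\<close>
      have 3: "cnj ?\<kappa> = - (?\<kappa> * parity_sign X Y)" by (simp add: \<kappa>'(2) mult_ac)
      have 4: "cnj (?\<kappa> * parity_sign X Y) = - ?\<kappa>"
      proof -
        have "cnj (?\<kappa> * parity_sign X Y) = cnj ?\<kappa> * parity_sign X Y" by simp
        also have "\<dots> = - (?\<kappa> * (parity_sign X Y * parity_sign X Y))"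
          unfolding 3 by (simp only: mult_minus_left mult.assoc)
        also have "\<dots> = - ?\<kappa>" by simp
        finally show ?thesis .
      qed
      show ?thesis
        unfolding unitary2_matrix2 2 1 unfolding 3 4 using cs by (simp add: add.commute mult.commute)
    qed
    have X1: "bk_mask M {} {}" by (simp add: bk_mask_def)
    obtain A where A: "circuit (Q + 1) (4 * (card B * (13 * L\<^sup>2)) + 2 * (card ({} :: nat set) * (13 * L\<^sup>2)) +
        4 * (card Y * bk_depth M * L) + 6) A"
      and A_basis: "\<forall>n. n \<subseteq> {..<M} \<longrightarrow> card n \<le> F + 4 \<longrightarrow>
        (odd (card (n \<inter> {})) \<noteq> False \<longrightarrow> A (basis_ket (enc n)) = basis_ket (enc n)) \<and>
        (odd (card (n \<inter> {})) = False \<longrightarrow> odd (card (sym_diff n Y \<inter> {})) = False \<longrightarrow>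
          card (sym_diff n Y) \<le> F + 4 \<or> ?\<kappa> = 0 \<and> {} = ({} :: nat set) \<longrightarrow>
          A (basis_ket (enc n)) = (\<lambda>r. complex_of_real (cos \<theta>) * basis_ket (enc n) r +
            ?\<kappa> * parity_sign X n * basis_ket (enc (sym_diff n Y)) r))"
      using mixing_circuit[OF Y(1) False Y(2) B(1) X1 U, of False] by (elim exE conjE)
    have A': "A (basis_ket (enc n)) = (\<lambda>r. complex_of_real (cos \<theta>) * basis_ket (enc n) r +
          ?\<kappa> * parity_sign X n * basis_ket (enc (sym_diff n Y)) r)"
      if "n \<subseteq> {..<M}" "card n \<le> F + 4" "card (sym_diff n Y) \<le> F + 4 \<or> ?\<kappa> = 0" for n
      by (rule A_basis[THEN spec, THEN mp, THEN mp, THEN conjunct2, THEN mp, THEN mp, THEN mp,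
          OF that(1,2)]) (use that(3) in auto)
    have "card Y * bk_depth M * L \<le> 4 * (bk_depth M * L)"
      using Y(2) by (simp add: mult.assoc)
    then have "4 * (card B * (13 * L\<^sup>2)) + 2 * (card ({} :: nat set) * (13 * L\<^sup>2)) + 4 * (card Y * bk_depth M * L) + 6
        \<le> gate_count D F M"
      using W unit_le linear_le unfolding gate_count_def card.empty by linarith
    then have circ: "circuit (Q + 1) (gate_count D F M) A" by (rule circuit_mono[OF A])
    show ?thesis
    proof (rule implementable_two_term[OF _ ex Y(1) circ])
      show "Op \<psi> n = (\<lambda>_. complex_of_real (cos \<theta>)) n * \<psi> n +
          (\<lambda>n. ?\<kappa> * parity_sign X n) (sym_diff n Y) * \<psi> (sym_diff n Y)" for \<psi> n
        by (simp add: Op mult.assoc)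
    next
      fix n assume n: "n \<subseteq> {..<M}" "card n \<le> F + 4"
        and "?\<kappa> * parity_sign X n = 0 \<or> card (sym_diff n Y) \<le> F + 4"
      then have "card (sym_diff n Y) \<le> F + 4 \<or> ?\<kappa> = 0" by (auto simp: parity_sign_def split: if_splits)
      from A'[OF n this]
      show "A (basis_ket (enc n)) = (\<lambda>r. complex_of_real (cos \<theta>) * basis_ket (enc n) r +
          ?\<kappa> * parity_sign X n * basis_ket (enc (sym_diff n Y)) r)" .
    qed
  qed
qed

text \<open>The modes strictly between \<open>p\<close> and \<open>q\<close> are the difference of
  two prefixes, so their number does not enter.\<close>

lemma bk_weight_le_exchange:
  assumes "p < M" "q < M"
  shows "bk_weight_le M {k. min p q < k \<and> k < max p q} (2 * bk_depth M)"
proof (cases "p = q")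
  case True
  then have e: "{k. min p q < k \<and> k < max p q} = {}" by auto
  show ?thesis unfolding e bk_weight_le_def bk_mask_def by (intro exI[of _ "{}"]) simp
next
  case False
  then have "{k. min p q < k \<and> k < max p q} = sym_diff {..<Suc (min p q)} {..<max p q}" by auto
  then show ?thesis
    using bk_weight_le_sym_diff[OF bk_weight_le_lessThan[of "Suc (min p q)" M] bk_weight_le_lessThan[of "max p q" M]]
      assms by (simp add: mult_2)
qed

lemma implementable_hop_gate:
  assumes "p < M" "q < M" "p \<noteq> q"
  shows "implementable D F M y (hop_gate ferm \<phi> p q) (gate_count D F M)"
proof -
  let ?E = "if ferm then {k. min p q < k \<and> k < max p q} else {}"
  let ?l = "bk_depth M"
  let ?Y = "{p, q}"
  have pq: "?Y = sym_diff {p} {q}" using assms(3) by auto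
  have Y: "?Y \<subseteq> {..<M}" "?Y \<noteq> {}" "card ?Y = 2" using assms by auto
  have wp: "bk_weight_le M {p} (2 * ?l)" and wq: "bk_weight_le M {q} (2 * ?l)"
    using assms bk_weight_le_singleton by auto
  have wpq: "bk_weight_le M ?Y (4 * ?l)" using bk_weight_le_sym_diff[OF wp wq] pq by simp
  have wE: "bk_weight_le M ?E (2 * ?l)"
  proof (cases ferm)
    case False
    then show ?thesis unfolding bk_weight_le_def bk_mask_def by (intro exI[of _ "{}"]) simp
  qed (use bk_weight_le_exchange[OF assms(1,2)] in simp)
  \<comment> \<open>Including \<open>p\<close> gives the minus sign of one off-diagonal entry of the
    rotation, and \<open>?E\<close> gives the exchange sign.\<close>
  define X where "X = sym_diff {p} ?E"
  have wX: "bk_weight_le M X (4 * ?l)" using bk_weight_le_sym_diff[OF wp wE] X_def by simp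
  have fE: "finite ?E" by simp
  have sE: "parity_sign ?E n = hop_sign ferm p q n" for n
  proof -
    have "n \<inter> {k. min p q < k \<and> k < max p q} = {k \<in> n. min p q < k \<and> k < max p q}" by auto
    then show ?thesis
      by (simp add: hop_sign_def exchange_sign_def parity_sign_def minus_one_power_iff)
  qed
  have sX: "parity_sign X n = (if p \<in> n then -1 else 1) * hop_sign ferm p q n" for n
    unfolding X_def using parity_sign_sym_diff_mask[of "{p}" ?E n] fE sE[of n]
    by (simp add: parity_sign_singleton)
  \<comment> \<open>The signs of \<open>X\<close> and \<open>X'\<close> are opposite if exactly one
    of \<open>p\<close>, \<open>q\<close> is occupied, and equal otherwise. Half their difference is
    the sign of \<open>X\<close> restricted to the rotated block, which makes this block a
    combination of Pauli products.\<close>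
  define X' where "X' = sym_diff {q} ?E"
  have sX': "parity_sign X' n = (if q \<in> n then -1 else 1) * hop_sign ferm p q n" for n
    unfolding X'_def using parity_sign_sym_diff_mask[of "{q}" ?E n] fE sE[of n]
    by (simp add: parity_sign_singleton)
  have spq: "parity_sign ?Y n = (if (p \<in> n) \<noteq> (q \<in> n) then -1 else 1)" for n
    unfolding pq using parity_sign_sym_diff_mask[of "{p}" "{q}" n] by (auto simp: parity_sign_singleton)
  have odd_pq: "odd (card (n \<inter> ?Y)) \<longleftrightarrow> (p \<in> n) \<noteq> (q \<in> n)" for n
    using spq[of n] unfolding parity_sign_def by (auto split: if_splits)
  define \<delta> where "\<delta> n = (if (p \<in> n) \<noteq> (q \<in> n) then complex_of_real (cos \<phi>)
      else if p \<in> n \<and> q \<in> n then -1 else 1)" for n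
  define \<omega> where "\<omega> n = (if (p \<in> n) \<noteq> (q \<in> n) then complex_of_real (sin \<phi>) * parity_sign X n else 0)" for n
  have mem: "p \<in> sym_diff n ?Y \<longleftrightarrow> p \<notin> n" "q \<in> sym_diff n ?Y \<longleftrightarrow> q \<notin> n" for n by auto
  have Op: "hop_gate ferm \<phi> p q \<psi> n = \<delta> n * \<psi> n + \<omega> (sym_diff n ?Y) * \<psi> (sym_diff n ?Y)" for \<psi> n
    unfolding hop_gate_eq[OF assms(3)] pair_rotation_def \<delta>_def \<omega>_def sX mem hop_sign_sym_diff by auto
  have ex: "bk_expressible M (hop_gate ferm \<phi> p q)"
  proof -
    let ?P = "\<lambda>X Y \<psi>. pauli_X Y (pauli_Z X \<psi>)"
    have m: "masked M {}" "masked M {p}" "masked M {q}" "masked M ?Y" "masked M X" "masked M X'"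
      using masked_empty masked_weight[OF wp] masked_weight[OF wq] masked_weight[OF wpq] masked_weight[OF wX]
        masked_sym_diff[OF masked_weight[OF wq] masked_weight[OF wE]] by (simp_all add: X'_def)
    have "bk_expressible M (\<lambda>\<psi> n. 1 * (1 * (complex_of_real (cos \<phi>) / 2 * ?P {} {} \<psi> n + (- complex_of_real (cos \<phi>) / 2) * ?P ?Y {} \<psi> n) +
        1 * (1 / 2 * ?P {p} {} \<psi> n + 1 / 2 * ?P {q} {} \<psi> n)) +
        1 * (complex_of_real (sin \<phi>) / 2 * ?P X ?Y \<psi> n + (- complex_of_real (sin \<phi>) / 2) * ?P X' ?Y \<psi> n))"
      by (intro bk_expressible_add bk_expressible_pauli m Y(1) empty_subsetI)
    also have "(\<lambda>\<psi> n. 1 * (1 * (complex_of_real (cos \<phi>) / 2 * ?P {} {} \<psi> n + (- complex_of_real (cos \<phi>) / 2) * ?P ?Y {} \<psi> n) +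
        1 * (1 / 2 * ?P {p} {} \<psi> n + 1 / 2 * ?P {q} {} \<psi> n)) +
        1 * (complex_of_real (sin \<phi>) / 2 * ?P X ?Y \<psi> n + (- complex_of_real (sin \<phi>) / 2) * ?P X' ?Y \<psi> n)) = hop_gate ferm \<phi> p q"
    proof (rule ext, rule ext)
      fix \<psi> n
      show "1 * (1 * (complex_of_real (cos \<phi>) / 2 * ?P {} {} \<psi> n + (- complex_of_real (cos \<phi>) / 2) * ?P ?Y {} \<psi> n) +
        1 * (1 / 2 * ?P {p} {} \<psi> n + 1 / 2 * ?P {q} {} \<psi> n)) +
        1 * (complex_of_real (sin \<phi>) / 2 * ?P X ?Y \<psi> n + (- complex_of_real (sin \<phi>) / 2) * ?P X' ?Y \<psi> n) = hop_gate ferm \<phi> p q \<psi> n"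
        unfolding Op pauli_X_def pauli_Z_eq \<delta>_def \<omega>_def sX sX' spq mem parity_sign_singleton
        by (cases "p \<in> n"; cases "q \<in> n") simp_all
    qed
    finally show ?thesis .
  qed
  obtain Bp where Bp: "bk_mask M {p} Bp" "card Bp \<le> 2 * ?l" using wp by (rule bk_weight_le_obtain)
  obtain Bq where Bq: "bk_mask M {q} Bq" "card Bq \<le> 2 * ?l" using wq by (rule bk_weight_le_obtain)
  obtain Bpq where Bpq: "bk_mask M ?Y Bpq" "card Bpq \<le> 4 * ?l" using wpq by (rule bk_weight_le_obtain)
  obtain BX where BX: "bk_mask M X BX" "card BX \<le> 4 * ?l" using wX by (rule bk_weight_le_obtain)
  \<comment> \<open>Phases \<i> for \<open>p\<close>, \<i> for \<open>q\<close> and -\<i> for the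
    parity of both multiply to -1 if both modes are occupied and to 1 otherwise. So the sign of the
    hop gate comes from three parity phases.\<close>
  have norms: "norm (1 :: complex) = 1" "norm \<i> = 1" "norm (- \<i>) = 1" by simp_all
  obtain A1 where A1: "circuit (Q + 1) (2 * (card Bp * (13 * L\<^sup>2)) + 4) A1"
    "\<And>n. n \<subseteq> {..<M} \<Longrightarrow> card n \<le> F + 4 \<Longrightarrow>
      A1 (basis_ket (enc n)) = (\<lambda>r. (if odd (card (n \<inter> {p})) then \<i> else 1) * basis_ket (enc n) r)"
    using phase_circuit[OF Bp(1) norms(1,2)] by (elim exE conjE) simp
  obtain A2 where A2: "circuit (Q + 1) (2 * (card Bq * (13 * L\<^sup>2)) + 4) A2"
    "\<And>n. n \<subseteq> {..<M} \<Longrightarrow> card n \<le> F + 4 \<Longrightarrow>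
      A2 (basis_ket (enc n)) = (\<lambda>r. (if odd (card (n \<inter> {q})) then \<i> else 1) * basis_ket (enc n) r)"
    using phase_circuit[OF Bq(1) norms(1,2)] by (elim exE conjE) simp
  obtain A3 where A3: "circuit (Q + 1) (2 * (card Bpq * (13 * L\<^sup>2)) + 4) A3"
    "\<And>n. n \<subseteq> {..<M} \<Longrightarrow> card n \<le> F + 4 \<Longrightarrow>
      A3 (basis_ket (enc n)) = (\<lambda>r. (if odd (card (n \<inter> ?Y)) then - \<i> else 1) * basis_ket (enc n) r)"
    using phase_circuit[OF Bpq(1) norms(1,3)] by (elim exE conjE) simp
  have sXY: "parity_sign X ?Y = -1"
  proof -
    have "hop_sign ferm p q ?Y = hop_sign ferm p q (sym_diff {} ?Y)" by simp
    then have "hop_sign ferm p q ?Y = hop_sign ferm p q {}" unfolding hop_sign_sym_diff .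
    then show ?thesis unfolding sX by (simp add: hop_sign_def exchange_sign_def)
  qed
  have cs: "complex_of_real (cos \<phi>) * complex_of_real (cos \<phi>) + complex_of_real (sin \<phi>) * complex_of_real (sin \<phi>) = 1"
    by (simp only: of_real_mult[symmetric] of_real_add[symmetric] sin_cos_squared_add3 of_real_1)
  have U: "unitary2 (matrix2 (complex_of_real (cos \<phi>)) (complex_of_real (sin \<phi>)) (complex_of_real (sin \<phi>) * parity_sign X ?Y) (complex_of_real (cos \<phi>)))"
    unfolding unitary2_matrix2 sXY using cs by (simp add: add.commute mult.commute)
  have "card ?Y \<le> 4" using Y(3) by simp
  \<comment> \<open>The rotation is switched on by odd parity on \<open>p\<close> and
    \<open>q\<close>, which flipping both preserves.\<close>
  from mixing_circuit[OF Y(1,2) this BX(1) Bpq(1) U, of True]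
  obtain V where V: "circuit (Q + 1) (4 * (card BX * (13 * L\<^sup>2)) + 2 * (card Bpq * (13 * L\<^sup>2)) +
      4 * (card ?Y * ?l * L) + 6) V"
    and V0: "\<And>n. n \<subseteq> {..<M} \<Longrightarrow> card n \<le> F + 4 \<Longrightarrow> (p \<in> n) = (q \<in> n) \<Longrightarrow>
      V (basis_ket (enc n)) = basis_ket (enc n)"
    and V1: "\<And>n. n \<subseteq> {..<M} \<Longrightarrow> card n \<le> F + 4 \<Longrightarrow> (p \<in> n) \<noteq> (q \<in> n) \<Longrightarrow>
      card (sym_diff n ?Y) \<le> F + 4 \<Longrightarrow> V (basis_ket (enc n)) =
        (\<lambda>r. complex_of_real (cos \<phi>) * basis_ket (enc n) r + complex_of_real (sin \<phi>) * parity_sign X n * basis_ket (enc (sym_diff n ?Y)) r)"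
    unfolding odd_pq mem by (elim exE conjE) auto
  let ?A = "\<lambda>\<psi>. V (A3 (A2 (A1 \<psi>)))"
  have "circuit (Q + 1) ((2 * (card Bp * (13 * L\<^sup>2)) + 4) + (2 * (card Bq * (13 * L\<^sup>2)) + 4) +
     (2 * (card Bpq * (13 * L\<^sup>2)) + 4) + (4 * (card BX * (13 * L\<^sup>2)) + 2 * (card Bpq * (13 * L\<^sup>2)) +
      4 * (card ?Y * ?l * L) + 6)) ?A"
    by (rule circuit_comp[OF circuit_comp[OF circuit_comp[OF A1(1) A2(1)] A3(1)] V])
  moreover have "(2 * (card Bp * (13 * L\<^sup>2)) + 4) + (2 * (card Bq * (13 * L\<^sup>2)) + 4) +
     (2 * (card Bpq * (13 * L\<^sup>2)) + 4) + (4 * (card BX * (13 * L\<^sup>2)) + 2 * (card Bpq * (13 * L\<^sup>2)) +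
      4 * (card ?Y * ?l * L) + 6) \<le> gate_count D F M"
    using weight_term_le[OF Bp(2)] weight_term_le[OF Bq(2)] weight_term_le[OF Bpq(2)]
      weight_term_le[OF BX(2)] unit_le linear_le
    unfolding gate_count_def Y(3) mult.assoc[of 2 ?l L] by linarith
  ultimately have circ: "circuit (Q + 1) (gate_count D F M) ?A" by (rule circuit_mono)
  show ?thesis
  proof (rule implementable_two_term[OF Op ex Y(1) circ])
    fix n assume n: "n \<subseteq> {..<M}" "card n \<le> F + 4" and "\<omega> n = 0 \<or> card (sym_diff n ?Y) \<le> F + 4"
    define z :: complex where "z = (if p \<in> n \<and> q \<in> n then -1 else 1)"
    have z: "?A (basis_ket (enc n)) = (\<lambda>r. z * V (basis_ket (enc n)) r)"
      unfolding A1(2)[OF n] circuit_scale[OF A2(1)] A2(2)[OF n] circuit_scale[OF A3(1)] A3(2)[OF n]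
        circuit_scale[OF V] odd_pq
      by (cases "p \<in> n"; cases "q \<in> n") (simp_all add: z_def fun_eq_iff)
    show "?A (basis_ket (enc n)) = (\<lambda>r. \<delta> n * basis_ket (enc n) r + \<omega> n * basis_ket (enc (sym_diff n ?Y)) r)"
    proof (cases "(p \<in> n) = (q \<in> n)")
      case True
      then show ?thesis unfolding z V0[OF n True] by (simp add: \<delta>_def \<omega>_def z_def)
    next
      case False
      \<comment> \<open>With exactly one of the two modes occupied, the hop keeps the number of
        fermions, so the partner is in range.\<close>
      have fn: "finite n" using n(1) finite_subset by blast
      have "sym_diff n ?Y = (if p \<in> n then insert q (n - {p}) else insert p (n - {q}))"
        using False assms(3) by auto
      moreover have "card n > 0" using False fn by (auto simp: card_gt_0_iff)
      ultimately have "card (sym_diff n ?Y) = card n" using False fn by (auto simp: card_insert_if)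
      then have "card (sym_diff n ?Y) \<le> F + 4" using n(2) by simp
      from V1[OF n False this] show ?thesis
        unfolding z using False by (simp add: \<delta>_def \<omega>_def z_def)
    qed
  qed
qed

end

subsection \<open>Rotations generated by products of Majorana operators\<close>

text \<open>Here \<open>k\<close> counts Majorana factors: each contributes one flipped mode and one
  prefix as mask, and a prefix has weight at most \<open>bk_depth M\<close>.\<close>

definition pauli_form :: "nat \<Rightarrow> nat \<Rightarrow> operator \<Rightarrow> bool" where
  "pauli_form M k T \<longleftrightarrow> (\<exists>\<kappa> X Y. norm \<kappa> = 1 \<and> Y \<subseteq> {..<M} \<and> card Y \<le> k \<and>
     bk_weight_le M X (k * bk_depth M) \<and>
     T = (\<lambda>\<psi> n. \<kappa> * (parity_sign X (sym_diff n Y) * \<psi> (sym_diff n Y))))"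

text \<open>The Jordan-Wigner form: flip \<open>j\<close> with the sign of the modes before it. The
  second kind of Majorana operator carries a further \<open>Z\<close> on \<open>j\<close>, which
  extends the prefix by one, and the phase \<i>.\<close>

lemma pauli_form_majorana:
  assumes "j < M"
  shows "pauli_form M 1 (majorana j v)"
proof -
  let ?X = "if v then {..<Suc j} else {..<j}" and ?\<kappa> = "if v then \<i> else 1"
  have "majorana j v = (\<lambda>\<psi> n. ?\<kappa> * (parity_sign ?X (sym_diff n {j}) * \<psi> (sym_diff n {j})))"
  proof (rule ext, rule ext)
    fix \<psi> n
    have s: "{k\<in>n. k < j} = n \<inter> {..<j}" by auto
    show "majorana j v \<psi> n = ?\<kappa> * (parity_sign ?X (sym_diff n {j}) * \<psi> (sym_diff n {j}))"
    proof (cases "j \<in> n")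
      case True
      then have "sym_diff n {j} = n - {j}" by auto
      moreover have "(n - {j}) \<inter> {..<j} = n \<inter> {..<j}" "(n - {j}) \<inter> {..<Suc j} = n \<inter> {..<j}"
        by (auto simp: less_Suc_eq)
      ultimately show ?thesis
        using True by (simp add: majorana_def create_def annihilate_def s parity_sign_def minus_one_power_iff)
    next
      case False
      then have "sym_diff n {j} = insert j n" by auto
      moreover have "insert j n \<inter> {..<j} = n \<inter> {..<j}"
        "insert j n \<inter> {..<Suc j} = insert j (n \<inter> {..<j})"
        using False by (auto simp: less_Suc_eq)
      ultimately show ?thesis
        using False by (simp add: majorana_def create_def annihilate_def s parity_sign_def minus_one_power_iff)
    qed
  qed
  moreover have "bk_weight_le M ?X (1 * bk_depth M)"
    using bk_weight_le_lessThan[of "Suc j" M] bk_weight_le_lessThan[of j M] assms by simp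
  ultimately show ?thesis
    unfolding pauli_form_def using assms by (intro exI[of _ ?\<kappa>] exI[of _ ?X] exI[of _ "{j}"]) simp
qed

text \<open>Moving the sign of the outer factor past the flips of the inner one costs the constant
  \<open>parity_sign X Y'\<close>, which joins the phase. Flips and masks add modulo 2.\<close>

lemma pauli_form_comp:
  assumes "pauli_form M k T" "pauli_form M l U"
  shows "pauli_form M (k + l) (\<lambda>\<psi>. T (U \<psi>))"
proof -
  obtain \<kappa> X Y where T: "norm \<kappa> = 1" "Y \<subseteq> {..<M}" "card Y \<le> k" "bk_weight_le M X (k * bk_depth M)"
    "T = (\<lambda>\<psi> n. \<kappa> * (parity_sign X (sym_diff n Y) * \<psi> (sym_diff n Y)))"
    using assms(1) unfolding pauli_form_def by (elim exE conjE)
  obtain \<kappa>' X' Y' where U: "norm \<kappa>' = 1" "Y' \<subseteq> {..<M}" "card Y' \<le> l" "bk_weight_le M X' (l * bk_depth M)"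
    "U = (\<lambda>\<psi> n. \<kappa>' * (parity_sign X' (sym_diff n Y') * \<psi> (sym_diff n Y')))"
    using assms(2) unfolding pauli_form_def by (elim exE conjE)
  have fX: "finite X" "finite X'" using T(4) U(4) by (auto simp: bk_weight_le_def bk_mask_def)
  have "(\<lambda>\<psi>. T (U \<psi>)) = (\<lambda>\<psi> n. \<kappa> * \<kappa>' * parity_sign X Y' *
     (parity_sign (sym_diff X X') (sym_diff n (sym_diff Y Y')) * \<psi> (sym_diff n (sym_diff Y Y'))))"
  proof (rule ext, rule ext)
    fix \<psi> n
    let ?m = "sym_diff n (sym_diff Y Y')"
    have m: "sym_diff (sym_diff n Y) Y' = ?m" "sym_diff n Y = sym_diff ?m Y'" by auto
    have "parity_sign X (sym_diff n Y) = parity_sign X ?m * parity_sign X Y'"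
      unfolding m(2) by (rule parity_sign_sym_diff[OF fX(1)])
    then show "T (U \<psi>) n = \<kappa> * \<kappa>' * parity_sign X Y' * (parity_sign (sym_diff X X') ?m * \<psi> ?m)"
      unfolding T(5) U(5) m(1) parity_sign_sym_diff_mask[OF fX] by (simp only: mult_ac)
  qed
  moreover have "norm (\<kappa> * \<kappa>' * parity_sign X Y') = 1"
    using T(1) U(1) by (simp add: norm_mult parity_sign_def)
  moreover have "sym_diff Y Y' \<subseteq> {..<M}" using T(2) U(2) by auto
  moreover have "card (sym_diff Y Y') \<le> k + l"
    using card_sym_diff_le[of Y Y'] T(2,3) U(2,3) finite_subset[of _ "{..<M}"] by fastforce
  moreover have "bk_weight_le M (sym_diff X X') ((k + l) * bk_depth M)"
    using bk_weight_le_sym_diff[OF T(4) U(4)] by (simp add: distrib_right)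
  ultimately show ?thesis
    unfolding pauli_form_def
    by (intro exI[of _ "\<kappa> * \<kappa>' * parity_sign X Y'"] exI[of _ "sym_diff X X'"] exI[of _ "sym_diff Y Y'"] conjI)
qed

lemma bk_weight_le_mono: "bk_weight_le M X k \<Longrightarrow> k \<le> l \<Longrightarrow> bk_weight_le M X l"
  unfolding bk_weight_le_def by (elim exE conjE) (rule exI, rule conjI, assumption, rule order_trans)

lemma pauli_form_mono: "pauli_form M k T \<Longrightarrow> k \<le> l \<Longrightarrow> pauli_form M l T"
proof -
  assume "pauli_form M k T" and kl: "k \<le> l"
  then obtain \<kappa> X Y where T: "norm \<kappa> = 1" "Y \<subseteq> {..<M}" "card Y \<le> k" "bk_weight_le M X (k * bk_depth M)"
    "T = (\<lambda>\<psi> n. \<kappa> * (parity_sign X (sym_diff n Y) * \<psi> (sym_diff n Y)))"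
    unfolding pauli_form_def by (elim exE conjE)
  have "card Y \<le> l" "bk_weight_le M X (l * bk_depth M)"
    using T(3,4) kl by (simp, intro bk_weight_le_mono[OF T(4)] mult_le_mono1)
  then show ?thesis unfolding pauli_form_def using T by (intro exI[of _ \<kappa>] exI[of _ X] exI[of _ Y] conjI)
qed

lemma pauli_form_scale:
  assumes "pauli_form M k T" "norm c = 1"
  shows "pauli_form M k (\<lambda>\<psi> n. c * T \<psi> n)"
proof -
  obtain \<kappa> X Y where T: "norm \<kappa> = 1" "Y \<subseteq> {..<M}" "card Y \<le> k" "bk_weight_le M X (k * bk_depth M)"
    "T = (\<lambda>\<psi> n. \<kappa> * (parity_sign X (sym_diff n Y) * \<psi> (sym_diff n Y)))"
    using assms(1) unfolding pauli_form_def by (elim exE conjE)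
  have "(\<lambda>\<psi> n. c * T \<psi> n) = (\<lambda>\<psi> n. c * \<kappa> * (parity_sign X (sym_diff n Y) * \<psi> (sym_diff n Y)))"
    unfolding T(5) by (simp only: mult.assoc)
  moreover have "norm (c * \<kappa>) = 1" using T(1) assms(2) by (simp add: norm_mult)
  ultimately show ?thesis
    unfolding pauli_form_def using T(2-4) by (intro exI[of _ "c * \<kappa>"] exI[of _ X] exI[of _ Y] conjI)
qed

lemma pauli_form_hamiltonian_term:
  assumes "hamiltonian_term M h1 h2 T"
  shows "pauli_form M 4 T"
proof -
  from assms consider
    (two) c i j u v where "norm c = 1" "i < M" "j < M" "T = (\<lambda>\<psi> n. c * majorana i u (majorana j v \<psi>) n)"
  | (four) c i j k l u v w z where "norm c = 1" "i < M" "j < M" "k < M" "l < M"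
      "T = (\<lambda>\<psi> n. c * majorana i u (majorana j v (majorana k w (majorana l z \<psi>))) n)"
    unfolding hamiltonian_term_def by (elim exE conjE disjE)
  then show ?thesis
  proof cases
    case two
    have "pauli_form M (1 + 1) (\<lambda>\<psi>. majorana i u (majorana j v \<psi>))"
      using two by (intro pauli_form_comp pauli_form_majorana)
    then have "pauli_form M 4 (\<lambda>\<psi>. majorana i u (majorana j v \<psi>))" by (rule pauli_form_mono) simp
    then show ?thesis unfolding two(4) by (rule pauli_form_scale) (rule two(1))
  next
    case four
    have "pauli_form M (1 + (1 + (1 + 1)))
        (\<lambda>\<psi>. majorana i u (majorana j v (majorana k w (majorana l z \<psi>))))"
      using four by (intro pauli_form_comp[of M 1 "majorana _ _"] pauli_form_majorana)
    then have "pauli_form M 4 (\<lambda>\<psi>. majorana i u (majorana j v (majorana k w (majorana l z \<psi>))))"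
      by (rule pauli_form_mono) simp
    then show ?thesis unfolding four(6) by (rule pauli_form_scale) (rule four(1))
  qed
qed

text \<open>Comparing the two matrix elements between the vacuum and the basis state
  \<open>Y\<close> relates \<kappa> to its conjugate. The resulting equation says that
  \<open>T\<close> is its own inverse.\<close>

lemma hermitian_pauli_form:
  assumes herm: "hermitian_on M T" and \<kappa>: "norm \<kappa> = 1" and Y: "Y \<subseteq> {..<M}"
    and T: "T = (\<lambda>\<psi> n. \<kappa> * (parity_sign X (sym_diff n Y) * \<psi> (sym_diff n Y)))"
  shows "\<kappa> * \<kappa> * parity_sign X Y = 1"
proof -
  have k: "basis_ket Y \<in> kets M" "basis_ket {} \<in> kets M"
    using Y by (auto simp: kets_def basis_ket_def)
  have "(\<Sum>s\<in>Pow {..<M}. cnj (basis_ket Y s) * T (basis_ket {}) s) =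
      (\<Sum>s\<in>Pow {..<M}. if s = Y then T (basis_ket {}) s else 0)"
    by (intro sum.cong) (auto simp: basis_ket_def)
  also have "\<dots> = T (basis_ket {}) Y" using Y by simp
  also have "\<dots> = \<kappa>" by (simp add: T basis_ket_def)
  finally have 1: "(\<Sum>s\<in>Pow {..<M}. cnj (basis_ket Y s) * T (basis_ket {}) s) = \<kappa>" .
  have "(\<Sum>s\<in>Pow {..<M}. cnj (T (basis_ket Y) s) * basis_ket {} s) =
      (\<Sum>s\<in>Pow {..<M}. if s = {} then cnj (T (basis_ket Y) s) else 0)"
    by (intro sum.cong) (auto simp: basis_ket_def)
  also have "\<dots> = cnj (T (basis_ket Y) {})" by simp
  also have "\<dots> = cnj \<kappa> * parity_sign X Y" by (simp add: T basis_ket_def)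
  finally have "\<kappa> = cnj \<kappa> * parity_sign X Y"
    using herm[unfolded hermitian_on_def, rule_format, OF k] 1 by simp
  then have "\<kappa> * parity_sign X Y = cnj \<kappa> * parity_sign X Y * parity_sign X Y" by simp
  also have "\<dots> = cnj \<kappa>" by (simp add: mult.assoc)
  finally have "\<kappa> * \<kappa> * parity_sign X Y = \<kappa> * cnj \<kappa>" by (simp only: mult.assoc)
  also have "\<dots> = 1" using complex_norm_square[of \<kappa>] \<kappa> by simp
  finally show ?thesis .
qed

text \<open>\<open>T\<close> acts as 1 and -1 on the two halves (\<psi> + T \<psi>) / 2 and (\<psi>
  - T \<psi>) / 2, so at every \<open>n\<close> the exponential series splits into two ordinary
  ones.\<close>

lemma rotation_involution:
  assumes T: "\<And>\<psi>. T (T \<psi>) = \<psi>" and scale: "\<And>c \<psi>. T (\<lambda>n. c * \<psi> n) = (\<lambda>n. c * T \<psi> n)"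
  shows "rotation \<theta> T \<psi> n = complex_of_real (cos \<theta>) * \<psi> n + \<i> * complex_of_real (sin \<theta>) * T \<psi> n"
proof -
  define z where "z = \<i> * complex_of_real \<theta>"
  let ?A = "\<lambda>\<psi> n. z * T \<psi> n"
  have pow: "(?A ^^ k) \<psi> = (if even k then (\<lambda>n. z ^ k * \<psi> n) else (\<lambda>n. z ^ k * T \<psi> n))" for k
    by (induction k) (simp_all add: scale T mult.assoc)
  have e: "(\<lambda>k. w ^ k / fact k) sums exp w" for w :: complex
    using exp_converges[of w] by (simp add: scaleR_conv_of_real field_simps)
  have "(\<lambda>k. z ^ k / fact k * ((\<psi> n + T \<psi> n) / 2) + (- z) ^ k / fact k * ((\<psi> n - T \<psi> n) / 2)) sums
      (exp z * ((\<psi> n + T \<psi> n) / 2) + exp (- z) * ((\<psi> n - T \<psi> n) / 2))"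
    by (intro sums_add sums_mult2 e)
  moreover have "z ^ k / fact k * ((\<psi> n + T \<psi> n) / 2) + (- z) ^ k / fact k * ((\<psi> n - T \<psi> n) / 2) =
      (?A ^^ k) \<psi> n / fact k" for k
    by (cases "even k") (simp_all add: pow field_simps)
  ultimately have "(\<lambda>k. (?A ^^ k) \<psi> n / fact k) sums
      (exp z * ((\<psi> n + T \<psi> n) / 2) + exp (- z) * ((\<psi> n - T \<psi> n) / 2))" by simp
  then have "rotation \<theta> T \<psi> n = exp z * ((\<psi> n + T \<psi> n) / 2) + exp (- z) * ((\<psi> n - T \<psi> n) / 2)"
    unfolding rotation_def op_exp_def z_def by (rule sums_unique[symmetric])
  moreover have "exp z = complex_of_real (cos \<theta>) + \<i> * complex_of_real (sin \<theta>)"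
    unfolding z_def by (simp add: exp_Euler cos_of_real sin_of_real)
  moreover have "exp (- z) = complex_of_real (cos \<theta>) - \<i> * complex_of_real (sin \<theta>)"
    unfolding z_def using exp_Euler[of "- complex_of_real \<theta>"] by (simp add: cos_of_real sin_of_real)
  moreover have "(c + s) * ((a + b) / 2) + (c - s) * ((a - b) / 2) = c * a + s * b" for a b c s :: complex
    by (simp add: field_simps)
  ultimately show ?thesis by (simp only:)
qed

lemma rotation_pauli_form:
  assumes T: "T = (\<lambda>\<psi> n. \<kappa> * (parity_sign X (sym_diff n Y) * \<psi> (sym_diff n Y)))"
    and \<kappa>: "\<kappa> * \<kappa> * parity_sign X Y = 1" and X: "finite X"
  shows "rotation \<theta> T \<psi> n = complex_of_real (cos \<theta>) * \<psi> n +
    \<i> * complex_of_real (sin \<theta>) * \<kappa> * (parity_sign X (sym_diff n Y) * \<psi> (sym_diff n Y))"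
proof -
  have "T (T \<psi>) = \<psi>" for \<psi>
  proof
    fix n
    have inv: "sym_diff (sym_diff n Y) Y = n" by auto
    have "T (T \<psi>) n = \<kappa> * \<kappa> * (parity_sign X (sym_diff n Y) * parity_sign X n) * \<psi> n"
      unfolding T inv by (simp only: mult_ac)
    also have "parity_sign X (sym_diff n Y) * parity_sign X n = parity_sign X Y"
      unfolding parity_sign_sym_diff[OF X] by (simp add: mult_ac)
    finally show "T (T \<psi>) n = \<psi> n" using \<kappa> by simp
  qed
  moreover have "T (\<lambda>n. c * \<psi> n) = (\<lambda>n. c * T \<psi> n)" for c \<psi>
    unfolding T by (simp only: mult_ac)
  ultimately show ?thesis
    by (simp add: rotation_involution T mult.assoc)
qed

context degree_code
begin

lemma implementable_rotation:
  assumes "hamiltonian_term M h1 h2 T"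
  shows "implementable D F M y (rotation \<theta> T) (gate_count D F M)"
proof -
  obtain \<kappa> X Y where T: "norm \<kappa> = 1" "Y \<subseteq> {..<M}" "card Y \<le> 4" "bk_weight_le M X (4 * bk_depth M)"
    "T = (\<lambda>\<psi> n. \<kappa> * (parity_sign X (sym_diff n Y) * \<psi> (sym_diff n Y)))"
    using pauli_form_hamiltonian_term[OF assms] unfolding pauli_form_def by (elim exE conjE)
  have "hermitian_on M T" using assms by (simp add: hamiltonian_term_def)
  then have \<kappa>: "\<kappa> * \<kappa> * parity_sign X Y = 1" using T(1,2,5) by (rule hermitian_pauli_form)
  have "finite X" using T(4) by (auto simp: bk_weight_le_def bk_mask_def)
  then show ?thesis
    by (intro implementable_rotation_form[OF rotation_pauli_form[OF T(5) \<kappa>] T(2,3,4,1) \<kappa>])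
qed

end

subsection \<open>Growth of the gate count\<close>

text \<open>For \<open>M \<ge> 2\<close> the depth is at most 2 log2 M + 1 <= 3 log2 M, and ln 2 >=
  1/2 gives another factor 2.\<close>

lemma bk_depth_le_ln:
  assumes "M \<ge> 2"
  shows "real (bk_depth M) \<le> 6 * ln (real M)"
proof -
  have ln2: "ln 2 \<ge> (1 / 2 :: real)" using ln_2_less_1 ln2_ge_two_thirds by linarith
  have "M + 1 \<le> M * 2" using assms by simp
  also have "\<dots> \<le> M * M" using assms by (intro mult_le_mono2)
  finally have "real M + 1 \<le> real M * real M" by (metis of_nat_1 of_nat_add of_nat_le_iff of_nat_mult)
  then have "log 2 (real M + 1) \<le> log 2 (real M * real M)" using assms by simp
  also have "\<dots> = 2 * log 2 (real M)" using assms by (simp add: log_mult)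
  finally have "log 2 (real M + 1) \<le> 2 * log 2 (real M)" .
  moreover have "1 \<le> log 2 (real M)" using assms by simp
  moreover have "real (bk_depth M) \<le> log 2 (real M + 1) + 1"
    unfolding bk_depth_def using ceiling_correct[of "log 2 (real M + 1)"] by simp
  ultimately have "real (bk_depth M) \<le> 3 * log 2 (real M)" by linarith
  also have "\<dots> \<le> 6 * ln (real M)"
  proof -
    have "ln (real M) \<ge> 0" using assms by simp
    then have "ln (real M) * (1 / 2) \<le> ln (real M) * ln 2" using ln2 by (intro mult_left_mono)
    then show ?thesis using ln2 by (simp add: log_def field_simps)
  qed
  finally show ?thesis .
qed

text \<open>From F + 4 <= 5 F comes \<open>L\<close> <= 10 D F l + 1 <= 11 D F l with l the depth,
  and 72600 is 600 times the square of 11.\<close>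

lemma gate_count_le:
  assumes "D \<ge> 1" "F \<ge> 1" "M \<ge> 1"
  shows "gate_count D F M \<le> 72600 * (D\<^sup>2 * F\<^sup>2 * bk_depth M ^ 3)"
proof -
  let ?l = "bk_depth M"
  have "1 \<le> D * F * ?l" using assms bk_depth_ge_1[OF assms(3)] by simp
  moreover have "code_G F M \<le> 5 * F * ?l"
    unfolding code_G_def bk_depth_def using assms by (intro mult_le_mono1) simp
  then have "2 * D * code_G F M \<le> 2 * D * (5 * F * ?l)" by (rule mult_le_mono2)
  moreover have "2 * D * (5 * F * ?l) = 10 * (D * F * ?l)" by simp
  ultimately have "code_L D F M \<le> 11 * (D * F * ?l)" unfolding code_L_def by linarith
  then have "(code_L D F M)\<^sup>2 \<le> (11 * (D * F * ?l))\<^sup>2" by (rule power_mono) simp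
  then have "gate_count D F M \<le> 600 * (?l * (11 * (D * F * ?l))\<^sup>2)"
    unfolding gate_count_def by (intro mult_le_mono2)
  also have "\<dots> = 72600 * (D\<^sup>2 * F\<^sup>2 * ?l ^ 3)"
    by (simp add: power2_eq_square power3_eq_cube)
  finally show ?thesis .
qed

lemma gate_count_le_ln:
  assumes "D \<ge> 1" "F \<ge> 1" "M \<ge> 2"
  shows "real (gate_count D F M) \<le> 72600 * 6 ^ 3 * ((real D)\<^sup>2 * (real F)\<^sup>2 * ln (real M) ^ 3)"
proof -
  have "real (gate_count D F M) \<le> real (72600 * (D\<^sup>2 * F\<^sup>2 * bk_depth M ^ 3))"
    using gate_count_le[of D F M] assms by (simp only: of_nat_le_iff)
  also have "\<dots> = 72600 * ((real D)\<^sup>2 * (real F)\<^sup>2 * real (bk_depth M) ^ 3)" by simp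
  also have "\<dots> \<le> 72600 * ((real D)\<^sup>2 * (real F)\<^sup>2 * (6 * ln (real M)) ^ 3)"
    using bk_depth_le_ln[OF assms(3)] by (intro mult_left_mono power_mono) simp_all
  also have "\<dots> = 72600 * 6 ^ 3 * ((real D)\<^sup>2 * (real F)\<^sup>2 * ln (real M) ^ 3)"
    by (simp add: power_mult_distrib)
  finally show ?thesis .
qed

text \<open>
  Once \<open>D \<ge> log\<^sub>2 M\<close>, the condition \<open>(L')\<^bsup>D + 1\<^esup> \<ge> M\<close> holds for every prime, so \<open>L'\<close> is the least prime
  above \<open>L\<close> and grows with \<open>D\<close>.
\<close>

lemma num_qubits_strict_mono:
  assumes "F \<ge> 1" "M \<ge> 1" "bk_depth M \<le> D" "D < D'"
  shows "num_qubits D F M < num_qubits D' F M"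
proof -
  have "code_G F M \<ge> 1"
    using bk_depth_ge_1[OF assms(2)] by (simp add: code_G_def bk_depth_def)
  then have L: "code_L D F M < code_L D' F M" using assms(4) by (simp add: code_L_def)
  let ?p = "code_L' D' F M"
  have p: "prime ?p" "code_L D' F M \<le> ?p" using prime_code_L' code_L_le_code_L' by auto
  have "M < 2 ^ (D + 1)"
  proof (rule ccontr)
    assume "\<not> ?thesis"
    then have "2 ^ (D + 1) \<le> M + 1" by simp
    then have "D + 1 \<le> bk_depth M" by (rule power_le_imp_le_bk_depth)
    then show False using assms(3) by simp
  qed
  also have "2 ^ (D + 1) \<le> ?p ^ (D + 1)" using prime_ge_2_nat[OF p(1)] by (intro power_mono) simp_all
  finally have "prime ?p \<and> code_L D F M \<le> ?p \<and> M \<le> ?p ^ (D + 1)" using p L by simp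
  then have "code_L' D F M \<le> ?p" unfolding code_L'_def[of D] by (rule Least_le)
  moreover have "?p > 0" using p(1) by (rule prime_gt_0_nat)
  ultimately show ?thesis
    unfolding num_qubits_def using L by (meson le_less_trans mult_le_mono1 mult_less_mono2)
qed

text \<open>A larger degree would be beaten by \<open>bk_depth M\<close>, which is at least 1 and so
  competes in the minimum.\<close>

lemma optimal_degree_le:
  assumes "is_arg_min (\<lambda>D. num_qubits D F M) (\<lambda>D. D \<ge> 1) D" "F \<ge> 1" "M \<ge> 1"
  shows "D \<ge> 1" "D \<le> bk_depth M"
proof -
  show "D \<ge> 1" using assms(1) by (simp add: is_arg_min_def)
  show "D \<le> bk_depth M"
  proof (rule ccontr)
    assume "\<not> D \<le> bk_depth M"
    then have "num_qubits (bk_depth M) F M < num_qubits D F M"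
      using assms by (intro num_qubits_strict_mono) simp_all
    then show False using assms(1) bk_depth_ge_1[OF assms(3)] by (auto simp: is_arg_min_def)
  qed
qed

lemma eventually_many_modes: "eventually (\<lambda>(F, M). F \<ge> 1 \<and> M \<ge> 2) many_modes"
proof -
  have "eventually (\<lambda>x. x \<ge> (2 :: real)) at_top" by (rule eventually_ge_at_top)
  then have "eventually (\<lambda>(F, M). real M / real F \<ge> 2) (filtercomap (\<lambda>(F, M). real M / real F) at_top)"
    by (auto simp: eventually_filtercomap intro!: exI[of _ "\<lambda>x. x \<ge> 2"])
  moreover have "M \<ge> 2" if "real M / real F \<ge> 2" "F \<ge> 1" for F M :: nat
  proof -
    have "2 * real F \<le> real M" using that by (simp add: field_simps)
    then show ?thesis using that(2) by linarith
  qed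
  ultimately show ?thesis
    unfolding many_modes_def eventually_inf_principal by (auto elim!: eventually_mono)
qed

theorem corollary2p1:
  shows "\<exists>N :: nat \<Rightarrow> nat \<Rightarrow> nat \<Rightarrow> nat.
    (\<forall>D\<ge>1. \<forall>F\<ge>1. \<forall>M\<ge>1.
       (\<forall>ferm. hop_universal ferm M F) \<and>
       (\<forall>y. code_polynomials D F M y \<longrightarrow>
          (\<forall>ferm \<phi> p q. p < M \<and> q < M \<and> p \<noteq> q \<longrightarrow>
             implementable D F M y (hop_gate ferm \<phi> p q) (N D F M)) \<and>
          (\<forall>h1 h2 T \<theta>. hermitian_on M (electronic_hamiltonian M h1 h2) \<and>
             hamiltonian_term M h1 h2 T \<longrightarrow>
             implementable D F M y (rotation \<theta> T) (N D F M)))) \<and>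
    (\<lambda>(D, F, M). real (N D F M)) \<in> O[principal {(D, F, M). D \<ge> 1 \<and> F \<ge> 1 \<and> M \<ge> 2}](
       \<lambda>(D, F, M). (real D)\<^sup>2 * (real F)\<^sup>2 * ln (real M) ^ 3) \<and>
    (\<forall>Dmin. (\<forall>F\<ge>1. \<forall>M\<ge>1.
         is_arg_min (\<lambda>D. num_qubits D F M) (\<lambda>D. D \<ge> 1) (Dmin F M)) \<longrightarrow>
       (\<lambda>(F, M). real (Dmin F M)) \<in> O[many_modes](\<lambda>(F, M). ln (real M)) \<and>
       (\<lambda>(F, M). real (N (Dmin F M) F M)) \<in> O[many_modes](
          \<lambda>(F, M). (real F)\<^sup>2 * ln (real M) ^ 5))"
proof (intro exI[of _ gate_count] conjI allI impI; (elim conjE)?)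
  show "hop_universal ferm M F" for ferm M F by (rule hop_gates_universal)
next
  fix D F M y ferm \<phi> p q
  assume "1 \<le> D" "1 \<le> F" "1 \<le> M" "code_polynomials D F M y" and pq: "p < M" "q < M" "p \<noteq> q"
  then interpret degree_code D F M y by unfold_locales
  show "implementable D F M y (hop_gate ferm \<phi> p q) (gate_count D F M)"
    using pq by (rule implementable_hop_gate)
next
  fix D F M y h1 h2 T \<theta>
  assume "1 \<le> D" "1 \<le> F" "1 \<le> M" "code_polynomials D F M y" and T: "hamiltonian_term M h1 h2 T"
  then interpret degree_code D F M y by unfold_locales
  show "implementable D F M y (rotation \<theta> T) (gate_count D F M)"
    using T by (rule implementable_rotation)
next
  show "(\<lambda>(D, F, M). real (gate_count D F M)) \<in> O[principal {(D, F, M). D \<ge> 1 \<and> F \<ge> 1 \<and> M \<ge> 2}](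
       \<lambda>(D, F, M). (real D)\<^sup>2 * (real F)\<^sup>2 * ln (real M) ^ 3)"
    by (rule bigoI[of _ "72600 * 6 ^ 3"])
      (use gate_count_le_ln in \<open>auto simp: eventually_principal abs_mult power_abs\<close>)
next
  fix Dmin assume *: "\<forall>F\<ge>1. \<forall>M\<ge>1. is_arg_min (\<lambda>D. num_qubits D F M) (\<lambda>D. D \<ge> 1) (Dmin F M)"
  have D: "Dmin F M \<ge> 1" "real (Dmin F M) \<le> 6 * ln (real M)" if "F \<ge> 1" "M \<ge> 2" for F M
  proof -
    have "is_arg_min (\<lambda>D. num_qubits D F M) (\<lambda>D. D \<ge> 1) (Dmin F M)" using * that by simp
    from optimal_degree_le[OF this that(1)] that(2)
    have "Dmin F M \<ge> 1" "Dmin F M \<le> bk_depth M" by simp_all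
    then show "Dmin F M \<ge> 1" "real (Dmin F M) \<le> 6 * ln (real M)"
      using bk_depth_le_ln[OF that(2)] by linarith+
  qed
  show "(\<lambda>(F, M). real (Dmin F M)) \<in> O[many_modes](\<lambda>(F, M). ln (real M))"
  proof (rule bigoI[of _ 6])
    show "\<forall>\<^sub>F x in many_modes. norm (case x of (F, M) \<Rightarrow> real (Dmin F M)) \<le> 6 * norm (case x of (F, M) \<Rightarrow> ln (real M))"
      using eventually_many_modes by (rule eventually_mono) (use D(2) in auto)
  qed
  show "(\<lambda>(F, M). real (gate_count (Dmin F M) F M)) \<in> O[many_modes](\<lambda>(F, M). (real F)\<^sup>2 * ln (real M) ^ 5)"
  \<comment> \<open>Three of the factors 6 come from the cube of the depth, two from the square of
    the optimal degree; each carries one logarithm.\<close>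
  proof (rule bigoI[of _ "72600 * 6 ^ 5"])
    have "real (gate_count (Dmin F M) F M) \<le> 72600 * 6 ^ 5 * ((real F)\<^sup>2 * ln (real M) ^ 5)"
      if FM: "F \<ge> 1" "M \<ge> 2" for F M
    proof -
      have ln: "ln (real M) \<ge> 0" using FM by simp
      have "real (gate_count (Dmin F M) F M) \<le>
          72600 * 6 ^ 3 * ((real (Dmin F M))\<^sup>2 * (real F)\<^sup>2 * ln (real M) ^ 3)"
        using D(1)[OF FM] FM by (intro gate_count_le_ln)
      also have "\<dots> \<le> 72600 * 6 ^ 3 * ((6 * ln (real M))\<^sup>2 * (real F)\<^sup>2 * ln (real M) ^ 3)"
        using D(2)[OF FM] ln by (intro mult_left_mono mult_right_mono power_mono) simp_all
      also have "\<dots> = 72600 * 6 ^ 5 * ((real F)\<^sup>2 * ln (real M) ^ 5)"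
        by (simp add: power_mult_distrib eval_nat_numeral)
      finally show ?thesis .
    qed
    then show "\<forall>\<^sub>F x in many_modes. norm (case x of (F, M) \<Rightarrow> real (gate_count (Dmin F M) F M)) \<le>
        72600 * 6 ^ 5 * norm (case x of (F, M) \<Rightarrow> (real F)\<^sup>2 * ln (real M) ^ 5)"
      using eventually_many_modes by (elim eventually_mono) (auto simp: abs_mult power_abs)
  qed
qed

end
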